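(* Let $k \ge 3$ be an integer, $N=\sqrt2A_{k-1}$, and let $\theta,\hat\nu,\psi\in\mathrm{Aut}(V_N)$ be as defined in the context. Then the centralizer of $\hat\nu$ and the normalizer of $\langle\hat\nu\rangle$ in $\mathrm{Aut}(V_{\sqrt2A_{k-1}})$ are as follows. (1) $C_{\mathrm{Aut}(V_{\sqrt2A_{k-1}})}(\hat\nu)=\langle\psi\rangle:(\langle\theta\rangle\times\langle\hat\nu\rangle)$ with $\langle\psi\rangle:\langle\theta\rangle\cong\mathrm{Dih}_{2k}$. (2) $N_{\mathrm{Aut}(V_{\sqrt2A_{k-1}})}(\langle\hat\nu\rangle)=\langle\psi\rangle:(\langle\theta\rangle\times(\langle\hat\nu\rangle:\mathbb Z_k^\times))$.
   Context: $A:B$ denotes a split extension with normal subgroup $A$ and complement $B$; $\mathrm{Dih}_{2k}$ is the dihedral group of order $2k$; $\mathbb Z_k^\times$ is the multiplicative group of invertible elements of $\mathbb Z_k=\mathbb Z/k\mathbb Z$. Let $\alpha_1,\dots,\alpha_k$ satisfy $\langle\alpha_i,\alpha_j\rangle=2\delta_{i,j}$, $\beta_i=\alpha_i-\alpha_{i+1}$ for $1\le i\le k-1$, and $N=\mathbb Z\beta_1+\cdots+\mathbb Z\beta_{k-1}\cong\sqrt2A_{k-1}$. Since $\langle\alpha,\alpha\rangle\in4\mathbb Z$ on $N$, the lattice vertex operator algebra is $V_N=M(1)\otimes\mathbb C[N]$ with the ordinary group algebra (trivial cocycle), $M(1)$ being the Heisenberg Fock space of $\mathfrak h=\mathbb C\otimes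 N$. Every $g\in O(N)$ lifts to an automorphism of $V_N$ by $h_1(-n_1)\cdots h_r(-n_r)\otimes e^\alpha\mapsto g(h_1)(-n_1)\cdots g(h_r)(-n_r)\otimes e^{g\alpha}$, and $O(N)$ is thereby regarded as a subgroup of $\mathrm{Aut}(V_N)$. Let $\nu\in O(N)$ be induced by the cyclic permutation $\alpha_1\mapsto\alpha_2\mapsto\cdots\mapsto\alpha_k\mapsto\alpha_1$; $\hat\nu$ is its lift, and $\theta$ is the lift of $-1$. For $h\in\mathfrak h$, $\exp(h(0))\in\mathrm{Aut}(V_N)$ acts on $M(1)\otimes e^\alpha$ as the scalar $\exp(\langle h,\alpha\rangle)$. Let $\rho\in\mathbb R\otimes N$ be the vector with $\langle\rho,\beta_i\rangle=\sqrt2$ for $1\le i\le k-1$ (the Weyl vector of the root system of type $A_{k-1}$), and $\psi=\exp\big(2\pi\sqrt{-1}\,\rho(0)/(\sqrt2k)\big)$, so $\psi$ acts on $M(1)\otimes e^\alpha$ as $\zeta_k^{\langle\rho,\alpha\rangle/\sqrt2}$ with $\zeta_k=\exp(2\pi\sqrt{-1}/k)$. In (2), $\mathbb Z_k^\times$ is realized as the group of lifts of the isometries of $N$ induced by $\alpha_i\mapsto\alpha_{si}$ (indices modulo $k$), $s\in\mathbb Z_k^\times$, so that $\langle\hat\nu\rangle:\mathbb Z_k^\times$ corresponds to the normalizer of the $k$-cycle subgroup $\langle\nu\rangle$ in the symmetric group $\mathrm{Sym}_k$. *)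

theory Defs
  imports
    Complex_Main
    "HOL-Library.Multiset"
    "HOL-Library.Poly_Mapping"
    "HOL-Library.Product_Plus"
    "HOL-Algebra.Algebra"
    "HOL-Number_Theory.Residues"
begin

section \<open>The lattice \<open>N = \<surd>2 A\<^bsub>k-1\<^esub>\<close>\<close>

text \<open>
  A vector \<open>\<Sum>\<^sub>i c\<^sub>i \<alpha>\<^sub>i\<close> is the finitely supported function \<open>i \<mapsto> c\<^sub>i\<close>; the coefficient ring is
  \<open>int\<close> for lattice vectors, \<open>real\<close> for \<open>\<real> \<otimes> N\<close> and \<open>complex\<close> for \<open>\<hh> = \<complex> \<otimes> N\<close>.
  The type provides all \<open>\<alpha>\<^sub>i\<close> with \<open>i \<in> \<nat>\<close>; everything depending on \<open>k\<close> uses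
  \<open>\<alpha>\<^sub>1, \<dots>, \<alpha>\<^sub>k\<close> only.
\<close>

abbreviation scl :: "'a::semiring_0 \<Rightarrow> (nat \<Rightarrow>\<^sub>0 'a) \<Rightarrow> (nat \<Rightarrow>\<^sub>0 'a)" where
  "scl c \<equiv> Poly_Mapping.map ((*) c)"

definition alpha :: "nat \<Rightarrow> (nat \<Rightarrow>\<^sub>0 'a::comm_ring_1)" where
  "alpha i = Poly_Mapping.single i 1"

definition beta :: "nat \<Rightarrow> (nat \<Rightarrow>\<^sub>0 'a::comm_ring_1)" where
  "beta i = alpha i - alpha (i + 1)"

text \<open>The bilinear form with \<open>\<langle>\<alpha>\<^sub>i, \<alpha>\<^sub>j\<rangle> = 2 \<delta>\<^sub>i\<^sub>j\<close>.\<close>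

definition ip :: "(nat \<Rightarrow>\<^sub>0 'a::comm_ring_1) \<Rightarrow> (nat \<Rightarrow>\<^sub>0 'a) \<Rightarrow> 'a" where
  "ip x y = (\<Sum>i\<in>Poly_Mapping.keys x. 2 * Poly_Mapping.lookup x i * Poly_Mapping.lookup y i)"

definition beta_span :: "nat \<Rightarrow> (nat \<Rightarrow>\<^sub>0 'a::comm_ring_1) set" where
  "beta_span k = range (\<lambda>c. \<Sum>i\<in>{1..k-1}. scl (c i) (beta i))"

definition N_lat :: "nat \<Rightarrow> (nat \<Rightarrow>\<^sub>0 int) set" where
  "N_lat k = beta_span k"

definition hh :: "nat \<Rightarrow> (nat \<Rightarrow>\<^sub>0 complex) set" where
  "hh k = beta_span k"

definition cvec :: "(nat \<Rightarrow>\<^sub>0 int) \<Rightarrow> (nat \<Rightarrow>\<^sub>0 complex)" where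
  "cvec = Poly_Mapping.map of_int"


section \<open>The space \<open>V\<^sub>N = M(1) \<otimes> \<complex>[N]\<close>\<close>

text \<open>
  The ambient algebra is \<open>\<complex>[\<alpha>\<^sub>i(-n) | i \<in> \<nat>, n \<ge> 1] \<otimes> \<complex>[L]\<close> with \<open>L = \<Oplus>\<^sub>i \<int>\<alpha>\<^sub>i\<close>, written as the
  monoid algebra over pairs (monomial, lattice vector); the pair \<open>(M, \<gamma>)\<close> stands for
  \<open>(\<Prod>(i, n)\<in>#M. \<alpha>\<^sub>i(-n)) \<otimes> e\<^sup>\<gamma>\<close>.  Since \<open>\<langle>L, L\<rangle> \<subseteq> 2\<int>\<close>, the trivial cocycle gives a lattice
  vertex algebra \<open>V\<^sub>L\<close> on it, and \<open>V\<^sub>N\<close> is the vertex subalgebra on the subspace \<open>VN k\<close>, with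
  its own conformal vector \<open>omega k\<close>.
\<close>

type_synonym basis = "(nat \<times> nat) multiset \<times> (nat \<Rightarrow>\<^sub>0 int)"
type_synonym fock = "basis \<Rightarrow>\<^sub>0 complex"

definition csc :: "complex \<Rightarrow> fock \<Rightarrow> fock" where
  "csc c v = Poly_Mapping.single 0 c * v"

global_interpretation fock: vector_space csc
  by unfold_locales
     (simp_all add: csc_def algebra_simps single_add mult_single flip: mult.assoc)

definition bvec :: "basis \<Rightarrow> fock" where
  "bvec b = Poly_Mapping.single b 1"

text \<open>Linear extension of a map given on the basis.\<close>

definition lin :: "(basis \<Rightarrow> fock) \<Rightarrow> fock \<Rightarrow> fock" where
  "lin f v = (\<Sum>b\<in>Poly_Mapping.keys v. csc (Poly_Mapping.lookup v b) (f b))"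

definition evec :: "(nat \<Rightarrow>\<^sub>0 int) \<Rightarrow> fock" where
  "evec \<gamma> = bvec ({#}, \<gamma>)"

text \<open>The element \<open>h(-n)\<close> of the symmetric algebra, \<open>n \<ge> 1\<close>.\<close>

definition hneg :: "(nat \<Rightarrow>\<^sub>0 complex) \<Rightarrow> nat \<Rightarrow> fock" where
  "hneg h n = (\<Sum>i\<in>Poly_Mapping.keys h. csc (Poly_Mapping.lookup h i) (bvec ({#(i, n)#}, 0)))"

definition VN :: "nat \<Rightarrow> fock set" where
  "VN k = fock.span
     {(\<Prod>(h, n)\<leftarrow>hs. hneg h n) * evec \<gamma> | hs \<gamma>.
        (\<forall>(h, n)\<in>set hs. h \<in> hh k \<and> n \<ge> 1) \<and> \<gamma> \<in> N_lat k}"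


section \<open>Vertex operators\<close>

text \<open>
  A field \<open>a(z) = \<Sum>\<^sub>m a\<^sub>m z\<^bsup>-m-1\<^esup>\<close> is given by its modes \<open>m \<mapsto> a\<^sub>m\<close>.  Sums over infinite index
  sets are \<open>Sum_any\<close>, the sum of the nonzero terms; on the fields below, only finitely
  many terms are nonzero.
\<close>

type_synonym field = "int \<Rightarrow> fock \<Rightarrow> fock"

text \<open>The operator \<open>h(m)\<close>: multiplication by \<open>h(m)\<close> for \<open>m < 0\<close>, \<open>\<langle>h, \<gamma>\<rangle>\<close> for \<open>m = 0\<close>, and for
  \<open>m > 0\<close> the derivation with \<open>\<alpha>\<^sub>i(-n) \<mapsto> m \<langle>h, \<alpha>\<^sub>i\<rangle> \<delta>\<^sub>m\<^sub>n\<close>.\<close>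

definition heis :: "(nat \<Rightarrow>\<^sub>0 complex) \<Rightarrow> field" where
  "heis h m = lin (\<lambda>(M, \<gamma>).
     if m < 0 then hneg h (nat (- m)) * bvec (M, \<gamma>)
     else if m = 0 then csc (ip h (cvec \<gamma>)) (bvec (M, \<gamma>))
     else \<Sum>i\<in>Poly_Mapping.keys h.
       csc (of_nat (count M (i, nat m)) * of_int m * ip h (alpha i))
         (bvec (M - {#(i, nat m)#}, \<gamma>)))"

text \<open>\<open>exp_coeff a j\<close> is the coefficient of \<open>x\<^sup>j\<close> in \<open>exp (\<Sum>n\<ge>1. a\<^sub>n x\<^sup>n)\<close>, for commuting operators
  \<open>a\<^sub>n\<close>; \<open>pow_coeff a r j\<close> is the one in \<open>(\<Sum>n\<ge>1. a\<^sub>n x\<^sup>n)\<^sup>r\<close>.\<close>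

primrec pow_coeff :: "(nat \<Rightarrow> fock \<Rightarrow> fock) \<Rightarrow> nat \<Rightarrow> nat \<Rightarrow> fock \<Rightarrow> fock" where
  "pow_coeff a 0 j v = (if j = 0 then v else 0)"
| "pow_coeff a (Suc r) j v = (\<Sum>n\<in>{1..j}. a n (pow_coeff a r (j - n) v))"

definition exp_coeff :: "(nat \<Rightarrow> fock \<Rightarrow> fock) \<Rightarrow> nat \<Rightarrow> fock \<Rightarrow> fock" where
  "exp_coeff a j v = (\<Sum>r\<le>j. csc (1 / fact r) (pow_coeff a r j v))"

text \<open>
  \<open>Y(e\<^sup>\<alpha>, z) = exp (\<Sum>n\<ge>1. \<alpha>(-n)/n z\<^sup>n) exp (- \<Sum>n\<ge>1. \<alpha>(n)/n z\<^bsup>-n\<^esup>) e\<^sub>\<alpha> z\<^bsup>\<alpha>(0)\<^esup>\<close>.  On \<open>(M, \<gamma>)\<close> the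
  coefficients of \<open>z\<^sup>i\<close> and \<open>z\<^bsup>-j\<^esup>\<close> in the two exponentials contribute to the mode \<open>m\<close> with
  \<open>i - j + \<langle>\<alpha>, \<gamma>\<rangle> = - m - 1\<close>.
\<close>

definition exp_field :: "(nat \<Rightarrow>\<^sub>0 int) \<Rightarrow> field" where
  "exp_field \<alpha> m = lin (\<lambda>(M, \<gamma>). Sum_any (\<lambda>j::nat.
     let i = int j - ip \<alpha> \<gamma> - m - 1 in
     if i < 0 then 0
     else exp_coeff (\<lambda>n v. csc (1 / of_nat n) (heis (cvec \<alpha>) (- int n) v)) (nat i)
       (exp_coeff (\<lambda>n v. csc (- 1 / of_nat n) (heis (cvec \<alpha>) (int n) v)) j
         (evec \<alpha> * bvec (M, \<gamma>)))))"

text \<open>The modes of \<open>(1/p!) (d/dz)\<^sup>p a(z)\<close>.\<close>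

definition deriv_field :: "nat \<Rightarrow> field \<Rightarrow> field" where
  "deriv_field p a m v = csc ((- 1) ^ p * (of_int m gchoose p)) (a (m - int p) v)"

text \<open>The normally ordered product \<open>:a(z) b(z): = a(z)\<^sub>- b(z) + b(z) a(z)\<^sub>+\<close>, where \<open>a(z)\<^sub>-\<close> collects
  the modes \<open>a\<^sub>l\<close> with \<open>l < 0\<close>.\<close>

definition normal_product :: "field \<Rightarrow> field \<Rightarrow> field" where
  "normal_product a b m v = Sum_any (\<lambda>l::int.
     if l < 0 then a l (b (m - l - 1) v) else b (m - l - 1) (a l v))"

text \<open>\<open>Y(\<alpha>\<^bsub>i1\<^esub>(-n\<^sub>1) \<cdots> \<alpha>\<^bsub>ir\<^esub>(-n\<^sub>r) \<otimes> e\<^sup>\<alpha>, z)\<close> is the normally ordered product of the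
  \<open>(1/(n\<^sub>j-1)!) (d/dz)\<^bsup>nj-1\<^esup> \<alpha>\<^bsub>ij\<^esub>(z)\<close> and \<open>Y(e\<^sup>\<alpha>, z)\<close>.  It does not depend on the order of the
  factors, so \<open>Y_op\<close> may choose any enumeration of the monomial.\<close>

primrec Y_list :: "(nat \<times> nat) list \<Rightarrow> (nat \<Rightarrow>\<^sub>0 int) \<Rightarrow> field" where
  "Y_list [] \<alpha> = exp_field \<alpha>"
| "Y_list (p # ps) \<alpha> =
     normal_product (deriv_field (snd p - 1) (heis (alpha (fst p)))) (Y_list ps \<alpha>)"

definition Y_op :: "fock \<Rightarrow> int \<Rightarrow> fock \<Rightarrow> fock" where
  "Y_op u m v = lin (\<lambda>(M, \<alpha>). Y_list (SOME ps. mset ps = M) \<alpha> m v) u"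

text \<open>An orthonormal basis of \<open>\<hh>\<close>, and the conformal vector \<open>\<omega> = 1/2 \<Sum>\<^sub>j h\<^sub>j(-1)\<^sup>2\<close>.\<close>

definition onb :: "nat \<Rightarrow> (nat \<Rightarrow>\<^sub>0 complex)" where
  "onb j = scl (1 / of_real (sqrt (2 * real j * (real j + 1))))
     ((\<Sum>i\<in>{1..j}. alpha i) - scl (of_nat j) (alpha (j + 1)))"

definition omega :: "nat \<Rightarrow> fock" where
  "omega k = csc (1 / 2) (\<Sum>j\<in>{1..k-1}. hneg (onb j) 1 * hneg (onb j) 1)"


section \<open>Automorphisms of \<open>V\<^sub>N\<close>\<close>

record 'v voa =
  voa_space :: "'v set"
  voa_scale :: "complex \<Rightarrow> 'v \<Rightarrow> 'v"
  voa_mode :: "'v \<Rightarrow> int \<Rightarrow> 'v \<Rightarrow> 'v"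
  voa_vacuum :: 'v
  voa_conformal :: 'v

definition voa_Aut :: "'v::ab_group_add voa \<Rightarrow> ('v \<Rightarrow> 'v) monoid" where
  "voa_Aut V = BijGroup (voa_space V) \<lparr>carrier := {g \<in> Bij (voa_space V).
     (\<forall>u\<in>voa_space V. \<forall>v\<in>voa_space V. g (u + v) = g u + g v) \<and>
     (\<forall>c. \<forall>u\<in>voa_space V. g (voa_scale V c u) = voa_scale V c (g u)) \<and>
     (\<forall>u\<in>voa_space V. \<forall>v\<in>voa_space V. \<forall>n.
        g (voa_mode V u n v) = voa_mode V (g u) n (g v)) \<and>
     g (voa_vacuum V) = voa_vacuum V \<and>
     g (voa_conformal V) = voa_conformal V}\<rparr>"

definition V_N :: "nat \<Rightarrow> fock voa" where
  "V_N k = \<lparr>voa_space = VN k, voa_scale = csc, voa_mode = Y_op,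
     voa_vacuum = 1, voa_conformal = omega k\<rparr>"

text \<open>The lift of the isometry of \<open>N\<close> induced by an additive map \<open>g\<close> on \<open>\<Oplus>\<^sub>i \<int>\<alpha>\<^sub>i\<close>; by
  \<open>lift_formula\<close> below, it maps \<open>h\<^sub>1(-n\<^sub>1) \<cdots> h\<^sub>r(-n\<^sub>r) \<otimes> e\<^sup>\<gamma>\<close> to
  \<open>g(h\<^sub>1)(-n\<^sub>1) \<cdots> g(h\<^sub>r)(-n\<^sub>r) \<otimes> e\<^bsup>g \<gamma>\<^esup>\<close>.\<close>

definition lift_map :: "((nat \<Rightarrow>\<^sub>0 int) \<Rightarrow> (nat \<Rightarrow>\<^sub>0 int)) \<Rightarrow> fock \<Rightarrow> fock" where
  "lift_map g = lin (\<lambda>(M, \<gamma>). (\<Prod>(i, n)\<in>#M. hneg (cvec (g (alpha i))) n) * evec (g \<gamma>))"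

definition lift :: "nat \<Rightarrow> ((nat \<Rightarrow>\<^sub>0 int) \<Rightarrow> (nat \<Rightarrow>\<^sub>0 int)) \<Rightarrow> fock \<Rightarrow> fock" where
  "lift k g = restrict (lift_map g) (VN k)"

text \<open>The additive map \<open>\<alpha>\<^sub>i \<mapsto> \<alpha>\<^bsub>s i\<^esub>\<close>.\<close>

definition reindex :: "(nat \<Rightarrow> nat) \<Rightarrow> (nat \<Rightarrow>\<^sub>0 int) \<Rightarrow> (nat \<Rightarrow>\<^sub>0 int)" where
  "reindex s \<gamma> = (\<Sum>i\<in>Poly_Mapping.keys \<gamma>. scl (Poly_Mapping.lookup \<gamma> i) (alpha (s i)))"

text \<open>The representative of \<open>m\<close> modulo \<open>k\<close> in \<open>{1..k}\<close>.\<close>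

definition idx :: "nat \<Rightarrow> int \<Rightarrow> nat" where
  "idx k m = nat ((m - 1) mod int k) + 1"

definition nu :: "nat \<Rightarrow> (nat \<Rightarrow>\<^sub>0 int) \<Rightarrow> (nat \<Rightarrow>\<^sub>0 int)" where
  "nu k = reindex (\<lambda>i. idx k (int i + 1))"

definition nu_hat :: "nat \<Rightarrow> fock \<Rightarrow> fock" where
  "nu_hat k = lift k (nu k)"

definition theta :: "nat \<Rightarrow> fock \<Rightarrow> fock" where
  "theta k = lift k uminus"

definition mult_lift :: "nat \<Rightarrow> int \<Rightarrow> fock \<Rightarrow> fock" where
  "mult_lift k s = lift k (reindex (\<lambda>i. idx k (s * int i)))"

definition Zk_units :: "nat \<Rightarrow> (fock \<Rightarrow> fock) set" where
  "Zk_units k = mult_lift k ` carrier (units_of (residue_ring (int k)))"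

definition exp_zero_mode :: "nat \<Rightarrow> (nat \<Rightarrow>\<^sub>0 complex) \<Rightarrow> fock \<Rightarrow> fock" where
  "exp_zero_mode k h =
     restrict (lin (\<lambda>(M, \<gamma>). csc (exp (ip h (cvec \<gamma>))) (bvec (M, \<gamma>)))) (VN k)"

definition rho :: "nat \<Rightarrow> (nat \<Rightarrow>\<^sub>0 real)" where
  "rho k = (THE r. r \<in> beta_span k \<and> (\<forall>i\<in>{1..k-1}. ip r (beta i) = sqrt 2))"

definition psi :: "nat \<Rightarrow> fock \<Rightarrow> fock" where
  "psi k = exp_zero_mode k
     (scl (2 * of_real pi * \<i> / (of_real (sqrt 2) * of_nat k))
       (Poly_Mapping.map of_real (rho k)))"


section \<open>Groups\<close>

definition centralizer :: "('a, 'b) monoid_scheme \<Rightarrow> 'a \<Rightarrow> 'a set" where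
  "centralizer G x = {g \<in> carrier G. g \<otimes>\<^bsub>G\<^esub> x = x \<otimes>\<^bsub>G\<^esub> g}"

text \<open>\<open>E = A : B\<close> and \<open>E = A \<times> B\<close>, for subgroups of \<open>G\<close>.\<close>

definition split_extension ::
    "('a, 'b) monoid_scheme \<Rightarrow> 'a set \<Rightarrow> 'a set \<Rightarrow> 'a set \<Rightarrow> bool" where
  "split_extension G E A B \<longleftrightarrow>
     subgroup E G \<and> A \<lhd> G\<lparr>carrier := E\<rparr> \<and> subgroup B (G\<lparr>carrier := E\<rparr>) \<and>
     A \<inter> B = {\<one>\<^bsub>G\<^esub>} \<and> A <#>\<^bsub>G\<^esub> B = E"

definition internal_direct_product ::
    "('a, 'b) monoid_scheme \<Rightarrow> 'a set \<Rightarrow> 'a set \<Rightarrow> 'a set \<Rightarrow> bool" where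
  "internal_direct_product G E A B \<longleftrightarrow>
     subgroup E G \<and> A \<lhd> G\<lparr>carrier := E\<rparr> \<and> B \<lhd> G\<lparr>carrier := E\<rparr> \<and>
     A \<inter> B = {\<one>\<^bsub>G\<^esub>} \<and> A <#>\<^bsub>G\<^esub> B = E"

text \<open>\<open>Dih\<^bsub>2k\<^esub>\<close>: the pair \<open>(i, b)\<close> is \<open>r\<^sup>i\<close> or \<open>r\<^sup>i s\<close> according to \<open>b\<close>, with \<open>r\<^sup>k = s\<^sup>2 = 1\<close> and
  \<open>s r s = r\<^sup>-\<^sup>1\<close>.\<close>

definition Dih :: "nat \<Rightarrow> (int \<times> bool) monoid" where
  "Dih k = \<lparr>carrier = {0..<int k} \<times> UNIV,
     monoid.mult = (\<lambda>(i, b) (j, c). ((if b then i - j else i + j) mod int k, b \<noteq> c)),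
     one = (0, False)\<rparr>"


section \<open>Consistency of \<open>lift\<close>, \<open>rho\<close> and \<open>onb\<close> with their descriptions\<close>


lemma lookup_csc: "Poly_Mapping.lookup (csc c v) b = c * Poly_Mapping.lookup v b"
proof -
  have "Poly_Mapping.lookup (csc c v) b
    = Sum_any (\<lambda>l. (c * Sum_any (\<lambda>q. Poly_Mapping.lookup v q when b = l + q)) when l = 0)"
    unfolding csc_def lookup_mult lookup_single
    by (rule Sum_any.cong) (auto simp: when_def)
  then show ?thesis by simp
qed

lemma lin_superset:
  assumes "finite S" "Poly_Mapping.keys v \<subseteq> S"
  shows "lin f v = (\<Sum>b\<in>S. csc (Poly_Mapping.lookup v b) (f b))"
  unfolding lin_def
  by (rule sum.mono_neutral_left) (use assms in \<open>auto simp: in_keys_iff\<close>)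

lemma lin_add: "lin f (u + v) = lin f u + lin f v"
proof -
  let ?S = "Poly_Mapping.keys u \<union> Poly_Mapping.keys v"
  have k: "Poly_Mapping.keys (u + v) \<subseteq> ?S"
    by (rule Poly_Mapping.keys_add)
  show ?thesis
    by (simp add: lin_superset[of ?S] k lookup_add fock.scale_left_distrib sum.distrib)
qed

lemma lin_csc: "lin f (csc c v) = csc c (lin f v)"
proof -
  have k: "Poly_Mapping.keys (csc c v) \<subseteq> Poly_Mapping.keys v"
    by (auto simp: in_keys_iff lookup_csc)
  show ?thesis
    by (simp add: lin_superset[of "Poly_Mapping.keys v"] k lookup_csc fock.scale_sum_right)
qed

lemma lin_bvec: "lin f (bvec b) = f b"
  by (simp add: lin_def bvec_def)

lemma lin_zero: "lin f 0 = 0"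
  by (simp add: lin_def)

lemma lin_sum: "lin f (\<Sum>x\<in>A. u x) = (\<Sum>x\<in>A. lin f (u x))"
  by (induction A rule: infinite_finite_induct) (auto simp: lin_add lin_zero)

lemma fock_expand: "(v :: fock) = (\<Sum>b\<in>Poly_Mapping.keys v. csc (Poly_Mapping.lookup v b) (bvec b))"
proof (rule poly_mapping_eqI)
  fix b
  show "Poly_Mapping.lookup v b = Poly_Mapping.lookup
      (\<Sum>b\<in>Poly_Mapping.keys v. csc (Poly_Mapping.lookup v b) (bvec b)) b"
    by (simp add: lookup_sum lookup_csc bvec_def lookup_single when_def if_distrib in_keys_iff
        cong: if_cong)
qed

lemma bvec_mult: "bvec b * bvec b' = bvec (b + b')"
  by (simp add: bvec_def mult_single)

lemma csc_mult_left: "csc c u * v = csc c (u * v)"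
  and csc_mult_right: "u * csc c v = csc c (u * v)"
  by (simp_all add: csc_def algebra_simps)

lemma lin_mult:
  assumes F: "\<And>b b'. F (b + b') = F b * F b'"
  shows "lin F (u * v) = lin F u * lin F v"
proof -
  have "lin F (u * v) = lin F
    ((\<Sum>b\<in>Poly_Mapping.keys u. csc (Poly_Mapping.lookup u b) (bvec b)) *
     (\<Sum>b\<in>Poly_Mapping.keys v. csc (Poly_Mapping.lookup v b) (bvec b)))"
    using fock_expand[of u] fock_expand[of v] by simp
  also have "\<dots> = (\<Sum>b\<in>Poly_Mapping.keys u. \<Sum>b'\<in>Poly_Mapping.keys v.
     csc (Poly_Mapping.lookup v b') (csc (Poly_Mapping.lookup u b) (F b * F b')))"
    by (simp only: sum_product lin_sum csc_mult_left csc_mult_right lin_csc bvec_mult lin_bvec F)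
  also have "\<dots> = lin F u * lin F v"
    by (simp only: lin_def sum_product csc_mult_left csc_mult_right)
  finally show ?thesis .
qed

text \<open>The complex-linear extension of \<open>g\<close>.\<close>

definition cext :: "((nat \<Rightarrow>\<^sub>0 int) \<Rightarrow> (nat \<Rightarrow>\<^sub>0 int)) \<Rightarrow> (nat \<Rightarrow>\<^sub>0 complex) \<Rightarrow> (nat \<Rightarrow>\<^sub>0 complex)" where
  "cext g h = (\<Sum>i\<in>Poly_Mapping.keys h. scl (Poly_Mapping.lookup h i) (cvec (g (alpha i))))"

lemma lookup_scl: "Poly_Mapping.lookup (scl c v) b = c * Poly_Mapping.lookup v b"
  by transfer (auto simp: when_def)

lemma hneg_superset:
  assumes "finite S" "Poly_Mapping.keys h \<subseteq> S"
  shows "hneg h n = (\<Sum>i\<in>S. csc (Poly_Mapping.lookup h i) (bvec ({#(i, n)#}, 0)))"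
  unfolding hneg_def
  by (rule sum.mono_neutral_left) (use assms in \<open>auto simp: in_keys_iff\<close>)

lemma hneg_zero: "hneg 0 n = 0"
  by (simp add: hneg_def)

lemma hneg_add: "hneg (h + h') n = hneg h n + hneg h' n"
proof -
  let ?S = "Poly_Mapping.keys h \<union> Poly_Mapping.keys h'"
  have k: "Poly_Mapping.keys (h + h') \<subseteq> ?S"
    by (rule Poly_Mapping.keys_add)
  show ?thesis
    by (simp add: hneg_superset[of ?S] k lookup_add fock.scale_left_distrib sum.distrib)
qed

lemma hneg_scl: "hneg (scl c h) n = csc c (hneg h n)"
proof -
  have k: "Poly_Mapping.keys (scl c h) \<subseteq> Poly_Mapping.keys h"
    by (auto simp: in_keys_iff lookup_scl)
  show ?thesis
    by (simp add: hneg_superset[of "Poly_Mapping.keys h"] k lookup_scl fock.scale_sum_right)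
qed

lemma hneg_sum: "hneg (\<Sum>x\<in>A. u x) n = (\<Sum>x\<in>A. hneg (u x) n)"
  by (induction A rule: infinite_finite_induct) (auto simp: hneg_add hneg_zero)

lemma evec_add: "evec (\<gamma> + \<gamma>') = evec \<gamma> * evec \<gamma>'"
  by (simp add: evec_def bvec_mult)

lemma lift_map_mult:
  assumes g: "\<And>x y. g (x + y) = g x + g y"
  shows "lift_map g (u * v) = lift_map g u * lift_map g v"
  unfolding lift_map_def
  by (rule lin_mult) (auto simp: g evec_add algebra_simps)

lemma lift_map_hneg:
  assumes g: "\<And>x y. g (x + y) = g x + g y"
  shows "lift_map g (hneg h n) = hneg (cext g h) n"
proof -
  have g0: "g 0 = 0" using g[of 0 0] by simp
  have e0: "evec 0 = 1" by (simp add: evec_def bvec_def zero_prod_def flip: single_one)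
  show ?thesis
    unfolding lift_map_def cext_def hneg_sum hneg_scl
    by (subst hneg_def) (simp add: lin_sum lin_csc lin_bvec g0 e0)
qed

lemma lift_formula:
  assumes g: "\<And>x y. g (x + y) = g x + g y"
    and hs: "\<And>h n. (h, n) \<in> set hs \<Longrightarrow> h \<in> hh k \<and> n \<ge> 1" and \<gamma>: "\<gamma> \<in> N_lat k"
  shows "lift k g ((\<Prod>(h, n)\<leftarrow>hs. hneg h n) * evec \<gamma>) =
    (\<Prod>(h, n)\<leftarrow>hs. hneg (cext g h) n) * evec (g \<gamma>)"
proof -
  have mem: "(\<Prod>(h, n)\<leftarrow>hs. hneg h n) * evec \<gamma> \<in> VN k"
    unfolding VN_def using hs \<gamma> by (intro fock.span_base) fastforce
  have g0: "g 0 = 0" using g[of 0 0] by simp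
  have e0: "evec 0 = 1" by (simp add: evec_def bvec_def zero_prod_def flip: single_one)
  have e: "lift_map g (evec \<gamma>) = evec (g \<gamma>)" for \<gamma>
    by (simp add: lift_map_def evec_def lin_bvec)
  have "lift_map g (\<Prod>(h, n)\<leftarrow>hs. hneg h n) = (\<Prod>(h, n)\<leftarrow>hs. hneg (cext g h) n)"
    using e[of 0] by (induction hs) (auto simp: lift_map_mult[OF g] lift_map_hneg[OF g] g0 e0)
  with mem show ?thesis
    by (simp add: lift_def lift_map_mult[OF g] e)
qed

lemma ip_superset:
  assumes "finite S" "Poly_Mapping.keys x \<subseteq> S"
  shows "ip x y = (\<Sum>i\<in>S. 2 * Poly_Mapping.lookup x i * Poly_Mapping.lookup y i)"
  unfolding ip_def
  by (rule sum.mono_neutral_left) (use assms in \<open>auto simp: in_keys_iff\<close>)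

lemma ip_beta:
  fixes x :: "nat \<Rightarrow>\<^sub>0 'a::comm_ring_1"
  shows "ip x (beta i) = 2 * (Poly_Mapping.lookup x i - Poly_Mapping.lookup x (i + 1))"
proof -
  have "ip x (beta i) = (\<Sum>j\<in>insert i (insert (i + 1) (Poly_Mapping.keys x)).
      2 * Poly_Mapping.lookup x j * Poly_Mapping.lookup (beta i) j)"
    by (rule ip_superset) auto
  also have "\<dots> = (\<Sum>j\<in>insert i (insert (i + 1) (Poly_Mapping.keys x)).
      (if j = i then 2 * Poly_Mapping.lookup x i else 0) -
      (if j = i + 1 then 2 * Poly_Mapping.lookup x (i + 1) else 0))"
    by (intro sum.cong) (auto simp: beta_def alpha_def lookup_minus lookup_single)
  also have "\<dots> = 2 * (Poly_Mapping.lookup x i - Poly_Mapping.lookup x (i + 1))"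
    by (simp add: sum_subtractf algebra_simps)
  finally show ?thesis .
qed

lemma lookup_beta_sum:
  fixes c :: "nat \<Rightarrow> 'a::comm_ring_1"
  shows "Poly_Mapping.lookup (\<Sum>i\<in>{1..k-1}. scl (c i) (beta i)) j =
    (if j \<in> {1..k-1} then c j else 0) - (if j \<in> {2..k} then c (j - 1) else 0)"
proof (cases "j = 0")
  case False
  have "Poly_Mapping.lookup (\<Sum>i\<in>{1..k-1}. scl (c i) (beta i)) j =
    (\<Sum>i\<in>{1..k-1}. (if i = j then c i else 0) - (if i = j - 1 then c i else 0))"
    unfolding lookup_sum lookup_scl
    by (intro sum.cong) (use False in \<open>auto simp: beta_def alpha_def lookup_minus lookup_single when_def\<close>)
  also have "\<dots> = (if j \<in> {1..k-1} then c j else 0) - (if j \<in> {2..k} then c (j - 1) else 0)"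
    using False unfolding sum_subtractf by (auto simp: sum.delta)
  finally show ?thesis .
qed (auto simp: lookup_sum lookup_scl beta_def alpha_def lookup_minus lookup_single when_def
       intro!: sum.neutral)

lemma beta_span_iff:
  fixes x :: "nat \<Rightarrow>\<^sub>0 'a::comm_ring_1"
  assumes "k \<ge> 1"
  shows "x \<in> beta_span k \<longleftrightarrow>
    Poly_Mapping.keys x \<subseteq> {1..k} \<and> (\<Sum>i\<in>{1..k}. Poly_Mapping.lookup x i) = 0"
proof
  assume "x \<in> beta_span k"
  then obtain c where x: "x = (\<Sum>i\<in>{1..k-1}. scl (c i) (beta i))"
    unfolding beta_span_def by blast
  have l: "Poly_Mapping.lookup x j =
    (if j \<in> {1..k-1} then c j else 0) - (if j \<in> {2..k} then c (j - 1) else 0)" for j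
    unfolding x by (rule lookup_beta_sum)
  have "(\<Sum>j\<in>{1..k}. if j \<in> {1..k-1} then c j else 0) = (\<Sum>j\<in>{1..k-1}. c j)"
    by (rule sum.mono_neutral_cong_right) auto
  moreover have "(\<Sum>j\<in>{1..k}. if j \<in> {2..k} then c (j - 1) else 0) = (\<Sum>j\<in>{2..k}. c (j - 1))"
    by (rule sum.mono_neutral_cong_right) auto
  moreover have "(\<Sum>j\<in>{2..k}. c (j - 1)) = (\<Sum>j\<in>{1..k-1}. c j)"
    by (rule sum.reindex_bij_witness[of _ "\<lambda>j. j + 1" "\<lambda>j. j - 1"]) auto
  ultimately have "(\<Sum>i\<in>{1..k}. Poly_Mapping.lookup x i) = 0"
    by (simp only: l sum_subtractf) simp
  moreover have "Poly_Mapping.keys x \<subseteq> {1..k}"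
    by (auto simp: in_keys_iff l split: if_splits)
  ultimately show "Poly_Mapping.keys x \<subseteq> {1..k} \<and> (\<Sum>i\<in>{1..k}. Poly_Mapping.lookup x i) = 0"
    by blast
next
  assume x: "Poly_Mapping.keys x \<subseteq> {1..k} \<and> (\<Sum>i\<in>{1..k}. Poly_Mapping.lookup x i) = 0"
  define c where "c = (\<lambda>i. \<Sum>j\<in>{1..i}. Poly_Mapping.lookup x j)"
  have c: "c j - c (j - 1) = Poly_Mapping.lookup x j" if "j \<ge> 1" for j
    using that by (cases j) (auto simp: c_def)
  have ck: "c k = 0" and c0: "c 0 = 0" using x by (auto simp: c_def)
  have "x = (\<Sum>i\<in>{1..k-1}. scl (c i) (beta i))"
  proof (rule poly_mapping_eqI, unfold lookup_beta_sum)
    fix j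
    have "Poly_Mapping.lookup x j = 0" if "j \<notin> {1..k}"
      using x that by (auto simp: in_keys_iff)
    then show "Poly_Mapping.lookup x j =
      (if j \<in> {1..k-1} then c j else 0) - (if j \<in> {2..k} then c (j - 1) else 0)"
      using c[of j] ck c0 assms by (cases "j = 1"; cases "j = k") auto
  qed
  then show "x \<in> beta_span k" unfolding beta_span_def by blast
qed

lemma rho_eq:
  assumes "k \<ge> 1"
  shows "rho k = (\<Sum>i\<in>{1..k}. Poly_Mapping.single i ((real k + 1 - 2 * real i) / (2 * sqrt 2)))"
    (is "_ = ?r")
    and "rho k \<in> beta_span k \<and> (\<forall>i\<in>{1..k-1}. ip (rho k) (beta i) = sqrt 2)"
proof -
  have l: "Poly_Mapping.lookup ?r j =
    (if j \<in> {1..k} then (real k + 1 - 2 * real j) / (2 * sqrt 2) else 0)" for j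
    by (simp add: lookup_sum lookup_single when_def)
  have s: "(\<Sum>i\<in>{1..n}. real n + 1 - 2 * real i) = 0" for n
  proof -
    have "(\<Sum>i\<in>{1..n}. real k + 1 - 2 * real i) = real n * (real k - real n)" for k
      by (induction n) (auto simp: algebra_simps)
    then show ?thesis by simp
  qed
  have "(\<Sum>i\<in>{1..k}. Poly_Mapping.lookup ?r i) =
      (\<Sum>i\<in>{1..k}. real k + 1 - 2 * real i) / (2 * sqrt 2)"
    unfolding sum_divide_distrib by (intro sum.cong) (simp_all only: l if_True)
  moreover have "Poly_Mapping.keys ?r \<subseteq> {1..k}"
  proof
    fix x assume "x \<in> Poly_Mapping.keys ?r"
    then have "Poly_Mapping.lookup ?r x \<noteq> 0" by (simp only: in_keys_iff not_False_eq_True)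
    then show "x \<in> {1..k}" unfolding l by (rule contrapos_np) (simp only: if_False)
  qed
  ultimately have "?r \<in> beta_span k"
    unfolding beta_span_iff[OF assms] s by (simp only: div_0)
  moreover have "\<forall>i\<in>{1..k-1}. ip ?r (beta i) = sqrt 2"
  proof
    fix i assume i: "i \<in> {1..k-1}"
    then have "ip ?r (beta i) = 2 * ((real k + 1 - 2 * real i) / (2 * sqrt 2)
        - (real k + 1 - 2 * real (i + 1)) / (2 * sqrt 2))"
      unfolding ip_beta l by auto
    also have "\<dots> = 2 / sqrt 2" by (simp flip: diff_divide_distrib)
    also have "\<dots> = sqrt 2" by (simp add: real_div_sqrt)
    finally show "ip ?r (beta i) = sqrt 2" .
  qed
  ultimately have ex: "?r \<in> beta_span k \<and> (\<forall>i\<in>{1..k-1}. ip ?r (beta i) = sqrt 2)" by blast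
  have un: "r = r'" if r: "r \<in> beta_span k" "\<forall>i\<in>{1..k-1}. ip r (beta i) = sqrt 2"
    and r': "r' \<in> beta_span k" "\<forall>i\<in>{1..k-1}. ip r' (beta i) = sqrt 2" for r r' :: "nat \<Rightarrow>\<^sub>0 real"
  proof -
    define d where "d i = Poly_Mapping.lookup r i - Poly_Mapping.lookup r' i" for i
    have st: "d (i + 1) = d i" if i: "i \<in> {1..k-1}" for i
    proof -
      have "ip r (beta i) = ip r' (beta i)" using r(2) r'(2) i by metis
      then show ?thesis unfolding ip_beta d_def by (simp add: algebra_simps)
    qed
    have const: "d i = d 1" if "i \<in> {1..k}" for i
      using that
    proof (induction i)
      case (Suc i)
      then show ?case using st[of i] by (cases "i = 0") auto
    qed auto
    have "(\<Sum>i\<in>{1..k}. d i) = 0"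
      using r(1) r'(1) unfolding d_def sum_subtractf beta_span_iff[OF assms] by simp
    moreover have "(\<Sum>i\<in>{1..k}. d i) = (\<Sum>i\<in>{1..k}. d 1)"
      by (intro sum.cong refl) (rule const)
    ultimately have "d 1 = 0" using assms by simp
    then have in0: "d i = 0" if "i \<in> {1..k}" for i
      by (simp only: const[OF that])
    have out0: "Poly_Mapping.lookup r i = 0" "Poly_Mapping.lookup r' i = 0" if "i \<notin> {1..k}" for i
      using that r(1) r'(1) unfolding beta_span_iff[OF assms] by (auto simp: in_keys_iff)
    show ?thesis
    proof (rule poly_mapping_eqI)
      fix i
      show "Poly_Mapping.lookup r i = Poly_Mapping.lookup r' i"
        using in0[of i] out0[of i] unfolding d_def by (cases "i \<in> {1..k}") auto
    qed
  qed
  show re: "rho k = ?r"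
    unfolding rho_def
  proof (rule the_equality)
    fix r assume "r \<in> beta_span k \<and> (\<forall>i\<in>{1..k-1}. ip r (beta i) = sqrt 2)"
    then show "r = ?r" using ex un by blast
  qed (rule ex)
  show "rho k \<in> beta_span k \<and> (\<forall>i\<in>{1..k-1}. ip (rho k) (beta i) = sqrt 2)"
    unfolding re by (rule ex)
qed

lemma lookup_onb: "Poly_Mapping.lookup (onb j) i =
  (if i \<in> {1..j} then 1 else if i = j + 1 then - of_nat j else 0) /
    of_real (sqrt (2 * real j * (real j + 1)))"
  by (auto simp: onb_def lookup_scl lookup_minus lookup_sum alpha_def lookup_single when_def)

lemma onb_orthonormal:
  assumes "j \<in> {1..k-1}" "l \<in> {1..k-1}"
  shows "onb j \<in> hh k" "ip (onb j) (onb l) = (if j = l then 1 else 0)"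
proof -
  let ?w = "\<lambda>j i. (if i \<in> {1..j} then 1 else if i = j + 1 then - of_nat j else 0) :: complex"
  let ?s = "\<lambda>j. complex_of_real (sqrt (2 * real j * (real j + 1)))"
  have keys: "Poly_Mapping.keys (onb j) \<subseteq> {1..k}" if "j \<in> {1..k-1}" for j
    using that by (auto simp: in_keys_iff lookup_onb split: if_splits)
  have w: "(\<Sum>i\<in>{1..k}. ?w j i * f i) = (\<Sum>i\<in>{1..j}. f i) - of_nat j * f (j + 1)"
    if "j \<in> {1..k-1}" for j and f :: "nat \<Rightarrow> complex"
  proof -
    have "(\<Sum>i\<in>{1..k}. ?w j i * f i) = (\<Sum>i\<in>insert (j + 1) {1..j}. ?w j i * f i)"
      by (rule sum.mono_neutral_right) (use that in auto)
    also have "\<dots> = (\<Sum>i\<in>{1..j}. ?w j i * f i) - of_nat j * f (j + 1)"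
      by (subst sum.insert) auto
    also have "(\<Sum>i\<in>{1..j}. ?w j i * f i) = (\<Sum>i\<in>{1..j}. f i)"
      by (rule sum.cong) auto
    finally show ?thesis .
  qed
  show "onb j \<in> hh k"
  proof -
    have "(\<Sum>i\<in>{1..k}. Poly_Mapping.lookup (onb j) i) = (\<Sum>i\<in>{1..k}. ?w j i * (1 / ?s j))"
      by (rule sum.cong) (auto simp: lookup_onb)
    also have "\<dots> = 0" unfolding w[OF assms(1)] by simp
    finally show ?thesis
      using keys[OF assms(1)] assms(1) unfolding hh_def by (subst beta_span_iff) auto
  qed
  have comm: "ip (onb j) (onb l) = 2 * (\<Sum>i\<in>{1..k}. ?w j i * ?w l i) / (?s j * ?s l)"
    if "j \<in> {1..k-1}" for j l
    unfolding ip_superset[OF _ keys[OF that], simplified] sum_distrib_left sum_divide_distrib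
    by (rule sum.cong) (auto simp: lookup_onb)
  have less0: "(\<Sum>i\<in>{1..k}. ?w j i * ?w l i) = 0" if "j < l" "j \<in> {1..k-1}" for j l
  proof -
    have "(\<Sum>i\<in>{1..j}. ?w l i) = (\<Sum>i\<in>{1..j}. 1)"
      by (rule sum.cong) (use that in auto)
    then show ?thesis unfolding w[OF that(2)] using that by auto
  qed
  show "ip (onb j) (onb l) = (if j = l then 1 else 0)"
  proof (cases j l rule: linorder_cases)
    case equal
    have "(\<Sum>i\<in>{1..j}. ?w j i) = (\<Sum>i\<in>{1..j}. 1)"
      by (rule sum.cong) auto
    then have "(\<Sum>i\<in>{1..k}. ?w j i * ?w j i) = of_nat j * (of_nat j + 1)"
      unfolding w[OF assms(1)] by (simp add: algebra_simps)
    moreover have "?s j * ?s j = 2 * of_nat j * (of_nat j + 1)"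
      unfolding of_real_mult[symmetric] by simp
    moreover have "(of_nat j :: complex) * (of_nat j + 1) \<noteq> 0"
      using assms(1) by (simp flip: of_nat_Suc add: add.commute)
    ultimately show ?thesis
      unfolding comm[OF assms(1)] equal[symmetric] by (simp only: mult.assoc if_True) simp
  next
    case lt: less
    show ?thesis using less0[OF lt assms(1)] lt unfolding comm[OF assms(1)] by simp
  next
    case greater
    have "(\<Sum>i\<in>{1..k}. ?w j i * ?w l i) = (\<Sum>i\<in>{1..k}. ?w l i * ?w j i)"
      by (simp add: mult.commute)
    with less0[OF greater assms(2)] greater show ?thesis unfolding comm[OF assms(1)] by simp
  qed
qed

end

theory Submission
  imports Defs
begin

text \<open>
  Nonzero vectors of \<open>N\<close> have norm at least \<open>4\<close>, so the weight one space of \<open>V\<^sub>N\<close> is \<open>\<hh>(-1)1\<close>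
  and every automorphism \<open>g\<close> permutes the Heisenberg fields.  Hence \<open>g\<close> maps \<open>e\<^sup>x\<close>, a highest weight
  vector for these fields, to a multiple \<open>\<chi>(x) e\<^bsup>f x\<^esup>\<close>; comparing the leading modes of
  \<open>Y(e\<^sup>x, z) e\<^sup>y\<close> shows that \<open>f\<close> is an isometry of \<open>N\<close> and \<open>\<chi>\<close> is a character.  As the \<open>e\<^sup>x\<close>
  generate \<open>V\<^sub>N\<close>, the pair \<open>(f, \<chi>)\<close> determines \<open>g\<close>.

  Suppose that \<open>g \<nu> = \<nu>\<^sup>t g\<close>.  The vector \<open>f \<beta>\<^sub>1\<close> has norm \<open>4\<close>, so it is \<open>\<alpha>\<^sub>p - \<alpha>\<^sub>q\<close> for some \<open>p \<noteq> q\<close>, and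
  \<open>\<langle>f \<beta>\<^sub>1, f \<beta>\<^sub>2\<rangle> = -2\<close> forces \<open>q = p + t\<close> or \<open>p = q + t\<close> modulo \<open>k\<close>.  Thus \<open>f\<close> is plus or minus the
  isometry induced by an affine permutation \<open>i \<mapsto> t i + c\<close>.  The character \<open>\<chi>\<close> is \<open>\<nu>\<close>-invariant, hence
  takes the same value \<open>\<zeta>\<close> on all \<open>\<beta>\<^sub>i\<close>, and \<open>\<zeta>\<^sup>k = 1\<close> since the \<open>\<nu>\<close>-orbit of \<open>\<beta>\<^sub>1\<close> sums to \<open>0\<close>;
  so \<open>\<chi>\<close> is the contribution of a power of \<open>\<psi>\<close>.
\<close>

section \<open>Linear maps and fields on the Fock space\<close>

text \<open>All arguments use explicit modes, so the order of factors in a normally ordered product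
  has to be shown irrelevant before \<open>Y_op\<close> can be computed. After that, a linear map
  respects every mode once it intertwines the Heisenberg modes and multiplication by the e^x and
  acts isometrically on N; this is how lifts and exponentials become automorphisms. The obstacle is
  that computations live in the ambient Fock space, where monomials in the \<alpha>_i form a basis,
  while V_N is not spanned by such monomials. The bridge is the vector \<delta> = \<alpha>_1 + ... +
  \<alpha>_k orthogonal to \<hh>: its nonnegative modes vanish on V_N. Hence on V_N the operator
  \<open>omega\<close>_1 multiplies the coefficient of each ambient monomial by its weight, and
  \<alpha>_i(m) with m \<ge> 0 may replace the mode of its projection to \<hh>. Invariance of
  \<open>omega\<close> is what makes the weight one space stable under automorphisms. Since the e^x
  determine an automorphism, every relation in the group reduces to heights and indices modulo
  k.\<close>

definition flinear :: "(fock \<Rightarrow> fock) \<Rightarrow> bool" where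
  "flinear f \<longleftrightarrow> (\<forall>u v. f (u + v) = f u + f v) \<and> (\<forall>c u. f (csc c u) = csc c (f u))"

lemma flinearI:
  "(\<And>u v. f (u + v) = f u + f v) \<Longrightarrow> (\<And>c u. f (csc c u) = csc c (f u)) \<Longrightarrow> flinear f"
  by (simp add: flinear_def)

lemma flinear_add: "flinear f \<Longrightarrow> f (u + v) = f u + f v"
  and flinear_csc: "flinear f \<Longrightarrow> f (csc c u) = csc c (f u)"
  by (simp_all add: flinear_def)

lemma flinear_0: "flinear f \<Longrightarrow> f 0 = 0"
  using flinear_csc[of f 0 0] by simp

lemma flinear_minus: "flinear f \<Longrightarrow> f (u - v) = f u - f v"
  using flinear_add[of f "u - v" v] by simp

lemma flinear_sum: "flinear f \<Longrightarrow> f (\<Sum>x\<in>A. g x) = (\<Sum>x\<in>A. f (g x))"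
  by (induction A rule: infinite_finite_induct) (auto simp: flinear_add flinear_0)

lemma flinear_compose: "flinear f \<Longrightarrow> flinear g \<Longrightarrow> flinear (\<lambda>v. f (g v))"
  by (simp add: flinear_def)

lemma flinear_id: "flinear (\<lambda>v. v)"
  and flinear_zero: "flinear (\<lambda>v. 0)"
  and flinear_scale: "flinear (csc c)"
  and flinear_mult: "flinear ((*) u)"
  by (simp_all add: flinear_def fock.scale_right_distrib distrib_left csc_mult_right mult.commute)

lemma flinear_plus: "flinear f \<Longrightarrow> flinear g \<Longrightarrow> flinear (\<lambda>v. f v + g v)"
  by (simp add: flinear_def fock.scale_right_distrib algebra_simps)

lemma flinear_sum_fun: "(\<And>x. x \<in> A \<Longrightarrow> flinear (f x)) \<Longrightarrow> flinear (\<lambda>v. \<Sum>x\<in>A. f x v)"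
  by (induction A rule: infinite_finite_induct) (auto simp: flinear_zero flinear_plus)

lemma flinear_lin: "flinear (lin f)"
  by (simp add: flinear_def lin_add lin_csc)

lemma flinear_eqI:
  assumes "flinear f" "flinear g" "\<And>b. f (bvec b) = g (bvec b)"
  shows "f v = g v"
proof -
  have *: "h v = (\<Sum>b\<in>Poly_Mapping.keys v. csc (Poly_Mapping.lookup v b) (h (bvec b)))"
    if "flinear h" for h
    using arg_cong[OF fock_expand[of v], of h] that by (simp only: flinear_sum flinear_csc)
  show ?thesis unfolding *[OF assms(1)] *[OF assms(2)] assms(3) ..
qed

lemma flinear_Sum_any:
  assumes f: "flinear f" and fin: "finite {x. g x \<noteq> 0}"
  shows "f (Sum_any g) = Sum_any (\<lambda>x. f (g x))"
proof -
  have "Sum_any (\<lambda>x. f (g x)) = (\<Sum>x\<in>{x. g x \<noteq> 0}. f (g x))"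
    using fin flinear_0[OF f] by (intro Sum_any.expand_superset) auto
  then show ?thesis by (simp add: Sum_any.expand_set flinear_sum[OF f])
qed

text \<open>Finiteness of the support is not at issue: \<open>Sum_any\<close> over an infinite
  support is 0, which satisfies P as well.\<close>

lemma Sum_any_pred:
  assumes "P 0" "\<And>u v. P u \<Longrightarrow> P v \<Longrightarrow> P (u + v)" "\<And>x. P (g x)"
  shows "P (Sum_any g)"
proof -
  have "P (sum g A)" for A
    by (induction A rule: infinite_finite_induct) (use assms in auto)
  then show ?thesis by (simp add: Sum_any.expand_set)
qed

text \<open>The truncation condition on fields in the sense of vertex algebras. The bound may depend
  on v, which is exactly what makes the sum in \<open>normal_product\<close> finite on each
  vector.\<close>

definition is_field :: "field \<Rightarrow> bool" where
  "is_field a \<longleftrightarrow> (\<forall>m. flinear (a m)) \<and> (\<forall>v. \<exists>B. \<forall>m\<ge>B. a m v = 0)"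

lemma is_fieldI:
  "(\<And>m. flinear (a m)) \<Longrightarrow> (\<And>v. \<exists>B. \<forall>m\<ge>B. a m v = 0) \<Longrightarrow> is_field a"
  by (simp add: is_field_def)

lemma is_field_flinear: "is_field a \<Longrightarrow> flinear (a m)"
  and is_field_bound: "is_field a \<Longrightarrow> \<exists>B. \<forall>m\<ge>B. a m v = 0"
  by (auto simp: is_field_def)

lemma is_field_bound_set:
  assumes a: "is_field a" and "finite S"
  shows "\<exists>B. \<forall>v\<in>S. \<forall>m\<ge>B. a m v = 0"
  using \<open>finite S\<close>
proof induction
  case (insert v S)
  then obtain B where "\<forall>v\<in>S. \<forall>m\<ge>B. a m v = 0" by blast
  moreover obtain C where "\<forall>m\<ge>C. a m v = 0" using is_field_bound[OF a] by blast
  ultimately have "\<forall>v\<in>insert v S. \<forall>m\<ge>max B C. a m v = 0" by auto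
  then show ?case by blast
qed auto

lemma is_field_bvecI:
  assumes lin: "\<And>m. flinear (a m)" and B: "\<And>b. \<exists>B. \<forall>m\<ge>B. a m (bvec b) = 0"
  shows "is_field a"
proof (rule is_fieldI[OF lin])
  fix v :: fock
  have "\<exists>B. \<forall>b\<in>Poly_Mapping.keys v. \<forall>m\<ge>B b. a m (bvec b) = 0" using B by metis
  then obtain B where B: "\<And>b m. b \<in> Poly_Mapping.keys v \<Longrightarrow> m \<ge> B b \<Longrightarrow> a m (bvec b) = 0" by blast
  define C where "C = Max (insert 0 (B ` Poly_Mapping.keys v))"
  have C: "B b \<le> C" if "b \<in> Poly_Mapping.keys v" for b
    unfolding C_def using that by (intro Max_ge) auto
  have "a m v = 0" if "m \<ge> C" for m
  proof -
    have "a m v = (\<Sum>b\<in>Poly_Mapping.keys v. csc (Poly_Mapping.lookup v b) (a m (bvec b)))"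
      using arg_cong[OF fock_expand[of v], of "a m"] by (simp only: flinear_sum[OF lin] flinear_csc[OF lin])
    also have "\<dots> = 0"
      using B C that by (intro sum.neutral) (metis fock.scale_zero_right order_trans)
    finally show ?thesis .
  qed
  then show "\<exists>B. \<forall>m\<ge>B. a m v = 0" by blast
qed

section \<open>Closure of fields under derivatives and normally ordered products\<close>

lemma is_field_deriv: "is_field a \<Longrightarrow> is_field (deriv_field p a)"
proof (rule is_fieldI)
  fix m assume "is_field a"
  then show "flinear (deriv_field p a m)"
    unfolding deriv_field_def by (rule flinear_compose[OF flinear_scale is_field_flinear])
next
  fix v assume "is_field a"
  then obtain B where "\<forall>m\<ge>B. a m v = 0" using is_field_bound by blast
  then have "\<forall>m\<ge>B + int p. deriv_field p a m v = 0" by (simp add: deriv_field_def)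
  then show "\<exists>B. \<forall>m\<ge>B. deriv_field p a m v = 0" by blast
qed

text \<open>For l < 0 the inner index m - l - 1 grows as l decreases, so truncation of b on v
  applies; for l \<ge> 0 truncation of a on v applies.\<close>

lemma normal_product_finite:
  assumes a: "is_field a" and b: "is_field b"
  shows "finite {l::int. (if l < 0 then a l (b (m - l - 1) v) else b (m - l - 1) (a l v)) \<noteq> 0}"
proof -
  obtain A where A: "\<And>l. l \<ge> A \<Longrightarrow> a l v = 0" using is_field_bound[OF a] by blast
  obtain B where B: "\<And>l. l \<ge> B \<Longrightarrow> b l v = 0" using is_field_bound[OF b] by blast
  have "{l::int. (if l < 0 then a l (b (m - l - 1) v) else b (m - l - 1) (a l v)) \<noteq> 0}
      \<subseteq> {min 0 (m - B)..max 0 A}"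
  proof
    fix l assume l: "l \<in> {l::int. (if l < 0 then a l (b (m - l - 1) v) else b (m - l - 1) (a l v)) \<noteq> 0}"
    show "l \<in> {min 0 (m - B)..max 0 A}"
    proof (cases "l < 0")
      case True
      with l have "b (m - l - 1) v \<noteq> 0" by (auto simp: flinear_0[OF is_field_flinear[OF a]])
      then have "m - l - 1 < B" using B not_less by blast
      with True show ?thesis by auto
    next
      case False
      with l have "a l v \<noteq> 0" by (auto simp: flinear_0[OF is_field_flinear[OF b]])
      then have "l < A" using A not_less by blast
      with False show ?thesis by auto
    qed
  qed
  then show ?thesis by (rule finite_subset) simp
qed

lemma is_field_normal_product:
  assumes a: "is_field a" and b: "is_field b"
  shows "is_field (normal_product a b)"
proof (rule is_fieldI)
  fix m
  show "flinear (normal_product a b m)"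
  proof (rule flinearI)
    fix u v
    show "normal_product a b m (u + v) = normal_product a b m u + normal_product a b m v"
      unfolding normal_product_def
      by (subst Sum_any.distrib[symmetric, OF normal_product_finite[OF a b] normal_product_finite[OF a b]],
          rule Sum_any.cong)
         (simp add: flinear_add[OF is_field_flinear[OF a]] flinear_add[OF is_field_flinear[OF b]])
  next
    fix c u
    show "normal_product a b m (csc c u) = csc c (normal_product a b m u)"
      unfolding normal_product_def
      by (subst flinear_Sum_any[OF flinear_scale normal_product_finite[OF a b]], rule Sum_any.cong)
         (simp add: flinear_csc[OF is_field_flinear[OF a]] flinear_csc[OF is_field_flinear[OF b]])
  qed
next
  fix v
  obtain A where A: "\<And>l. l \<ge> A \<Longrightarrow> a l v = 0" using is_field_bound[OF a] by blast
  \<comment> \<open>For l \<ge> 0 the field b acts on \<open>a l v\<close> instead of v. Only the l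
    below A give a nonzero vector, so a single truncation bound serves v and all of these.\<close>
  obtain B where B: "\<And>w l. w \<in> insert v ((\<lambda>l. a l v) ` {0..A}) \<Longrightarrow> l \<ge> B \<Longrightarrow> b l w = 0"
    using is_field_bound_set[OF b, of "insert v ((\<lambda>l. a l v) ` {0..A})"] by blast
  have "normal_product a b m v = 0" if "m \<ge> B + \<bar>A\<bar> + 1" for m
  proof -
    have "(if l < 0 then a l (b (m - l - 1) v) else b (m - l - 1) (a l v)) = 0" for l
    proof (cases "l \<ge> 0 \<and> l < A")
      case True
      with B[of "a l v" "m - l - 1"] that show ?thesis by auto
    next
      case False
      with B[of v "m - l - 1"] A[of l] that show ?thesis
        by (auto simp: flinear_0[OF is_field_flinear[OF a]] flinear_0[OF is_field_flinear[OF b]])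
    qed
    then show ?thesis unfolding normal_product_def by simp
  qed
  then show "\<exists>B. \<forall>m\<ge>B. normal_product a b m v = 0" by blast
qed

text \<open>Whether a mode of a or b stands to the left or to the right of c depends only on the
  sign of its own index. Thus both sides are double sums of the same terms, up to exchanging an
  a-mode and a b-mode on the same side of c; that is why commutation is required only for indices of
  the same sign class.\<close>

lemma normal_product_left_commute:
  assumes a: "is_field a" and b: "is_field b" and c: "is_field c"
    and comm: "\<And>l m v. (l < 0 \<longleftrightarrow> m < 0) \<Longrightarrow> a l (b m v) = b m (a l v)"
  shows "normal_product a (normal_product b c) = normal_product b (normal_product a c)"
proof (intro ext)
  fix n v
  define T where "T a b l m =
    (if l < 0 then if m < 0 then a l (b m (c (n - l - 1 - m - 1) v)) else a l (c (n - l - 1 - m - 1) (b m v))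
     else if m < 0 then b m (c (n - l - 1 - m - 1) (a l v)) else c (n - l - 1 - m - 1) (b m (a l v)))"
    for a b :: field and l m :: int
  have expand: "normal_product a (normal_product b c) n v = (\<Sum>l. \<Sum>m. T a b l m)"
    if a: "is_field a" and b: "is_field b" for a b
    unfolding normal_product_def
    by (rule Sum_any.cong)
       (auto simp: T_def flinear_Sum_any[OF is_field_flinear[OF a] normal_product_finite[OF b c]]
         if_distrib[of "a _"] intro!: Sum_any.cong)
  note zero = flinear_0[OF is_field_flinear[OF a]] flinear_0[OF is_field_flinear[OF b]]
    flinear_0[OF is_field_flinear[OF c]]
  obtain A where A: "\<And>l. l \<ge> A \<Longrightarrow> a l v = 0" using is_field_bound[OF a] by blast
  obtain B where B: "\<And>l. l \<ge> B \<Longrightarrow> b l v = 0" using is_field_bound[OF b] by blast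
  define S where "S = insert v ((\<lambda>l. a l v) ` {0..A} \<union> (\<lambda>l. b l v) ` {0..B})"
  have S: "finite S" by (simp add: S_def)
  obtain B' where B': "\<And>w l. w \<in> S \<Longrightarrow> l \<ge> B' \<Longrightarrow> b l w = 0" using is_field_bound_set[OF b S] by blast
  obtain C where C: "\<And>w l. w \<in> S \<Longrightarrow> l \<ge> C \<Longrightarrow> c l w = 0" using is_field_bound_set[OF c S] by blast
  define K where "K = Max {0, A, B, B', C}"
  have K: "0 \<le> K" "A \<le> K" "B \<le> K" "B' \<le> K" "C \<le> K" by (simp_all add: K_def)
  have aS: "a l v \<in> S \<or> a l v = 0" "b l v \<in> S \<or> b l v = 0" if "l \<ge> 0" for l
    using A[of l] B[of l] that by (cases "l \<ge> A"; cases "l \<ge> B"; auto simp: S_def)+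
  have vS: "v \<in> S" by (simp add: S_def)
  \<comment> \<open>Exchanging the two sums needs all nonzero terms in a finite square. Truncation
    of a and b bounds l and m above; truncation of c bounds n - l - m - 2 above, hence l and m
    below.\<close>
  have nz: "l < K \<and> m < K \<and> (l \<ge> 0 \<and> m \<ge> 0 \<or> n - l - 1 - m - 1 < K)" if T: "T a b l m \<noteq> 0" for l m
  proof -
    consider "l < 0" "m < 0" | "l < 0" "m \<ge> 0" | "l \<ge> 0" "m < 0" | "l \<ge> 0" "m \<ge> 0" by linarith
    then show ?thesis
    proof cases
      case 1
      with T have "c (n - l - 1 - m - 1) v \<noteq> 0" by (auto simp: T_def zero)
      with C[OF vS] have "n - l - 1 - m - 1 < C" using not_less by blast
      with 1 K show ?thesis by auto
    next
      case 2
      with T have "c (n - l - 1 - m - 1) (b m v) \<noteq> 0" by (auto simp: T_def zero)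
      with aS(2)[of m] 2 C have "n - l - 1 - m - 1 < C" "b m v \<noteq> 0" using not_less zero by metis+
      then have "n - l - 1 - m - 1 < C" "m < B" using B not_less by blast+
      with 2 K show ?thesis by auto
    next
      case 3
      with T have "c (n - l - 1 - m - 1) (a l v) \<noteq> 0" by (auto simp: T_def zero)
      with aS(1)[of l] 3 C have "n - l - 1 - m - 1 < C" "a l v \<noteq> 0" using not_less zero by metis+
      then have "n - l - 1 - m - 1 < C" "l < A" using A not_less by blast+
      with 3 K show ?thesis by auto
    next
      case 4
      with T have "b m (a l v) \<noteq> 0" by (auto simp: T_def zero)
      with aS(1)[of l] 4 B' have "m < B'" "a l v \<noteq> 0" using not_less zero by metis+
      then have "m < B'" "l < A" using A not_less by blast+
      with 4 K show ?thesis by auto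
    qed
  qed
  define I where "I = {min 0 (n - 2 - 2 * K)..K}"
  have nz': "l \<in> I \<and> m \<in> I" if "T a b l m \<noteq> 0" for l m
    using nz[OF that] K unfolding I_def by auto
  have "(\<Sum>l. \<Sum>m. T a b l m) = (\<Sum>m. \<Sum>l. T a b l m)"
    by (rule Sum_any.swap[of "I \<times> I"]) (use nz' in \<open>auto simp: I_def\<close>)
  also have "\<dots> = (\<Sum>m. \<Sum>l. T b a m l)"
    by (auto simp: T_def comm algebra_simps intro!: Sum_any.cong)
  finally show "normal_product a (normal_product b c) n v = normal_product b (normal_product a c) n v"
    by (simp add: expand[OF a b] expand[OF b a])
qed

section \<open>Linearity of the normally ordered product\<close>

lemma normal_product_add_left:
  assumes "is_field a" "is_field a'" "is_field b"
  shows "normal_product (\<lambda>m v. a m v + a' m v) b m v = normal_product a b m v + normal_product a' b m v"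
  unfolding normal_product_def
  by (subst Sum_any.distrib[symmetric, OF normal_product_finite normal_product_finite], fact+,
      rule Sum_any.cong)
     (simp add: flinear_add[OF is_field_flinear[OF assms(3)]])

lemma normal_product_csc_left:
  assumes "is_field a" "is_field b"
  shows "normal_product (\<lambda>m v. csc c (a m v)) b m v = csc c (normal_product a b m v)"
  unfolding normal_product_def
  by (subst flinear_Sum_any[OF flinear_scale normal_product_finite], fact+, rule Sum_any.cong)
     (simp add: flinear_csc[OF is_field_flinear[OF assms(2)]])

lemma normal_product_add_right:
  assumes "is_field a" "is_field b" "is_field b'"
  shows "normal_product a (\<lambda>m v. b m v + b' m v) m v = normal_product a b m v + normal_product a b' m v"
  unfolding normal_product_def
  by (subst Sum_any.distrib[symmetric, OF normal_product_finite normal_product_finite], fact+,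
      rule Sum_any.cong)
     (simp add: flinear_add[OF is_field_flinear[OF assms(1)]])

lemma normal_product_csc_right:
  assumes "is_field a" "is_field b"
  shows "normal_product a (\<lambda>m v. csc c (b m v)) m v = csc c (normal_product a b m v)"
  unfolding normal_product_def
  by (subst flinear_Sum_any[OF flinear_scale normal_product_finite], fact+, rule Sum_any.cong)
     (simp add: flinear_csc[OF is_field_flinear[OF assms(1)]])

lemma is_field_add: "is_field a \<Longrightarrow> is_field b \<Longrightarrow> is_field (\<lambda>m v. a m v + b m v)"
proof (rule is_fieldI)
  fix v assume ab: "is_field a" "is_field b"
  obtain A where A: "\<And>l. l \<ge> A \<Longrightarrow> a l v = 0" using is_field_bound[OF ab(1)] by blast
  obtain B where B: "\<And>l. l \<ge> B \<Longrightarrow> b l v = 0" using is_field_bound[OF ab(2)] by blast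
  have "\<forall>m\<ge>max A B. a m v + b m v = 0" using A B by auto
  then show "\<exists>B. \<forall>m\<ge>B. a m v + b m v = 0" by blast
qed (simp add: flinear_plus is_field_flinear)

lemma is_field_csc:
  assumes a: "is_field a"
  shows "is_field (\<lambda>m v. csc c (a m v))"
proof (rule is_fieldI)
  show "\<exists>B. \<forall>m\<ge>B. csc c (a m v) = 0" for v
    using is_field_bound[OF a, of v] by (metis fock.scale_zero_right)
qed (rule flinear_compose[OF flinear_scale is_field_flinear[OF a]])

lemma is_field_zero: "is_field (\<lambda>m v. 0)"
  by (simp add: is_field_def flinear_zero)

lemma is_field_sum: "(\<And>x. x \<in> A \<Longrightarrow> is_field (f x)) \<Longrightarrow> is_field (\<lambda>m v. \<Sum>x\<in>A. f x m v)"
  by (induction A rule: infinite_finite_induct) (auto simp: is_field_zero is_field_add)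

lemma normal_product_sum_left:
  assumes "\<And>x. x \<in> A \<Longrightarrow> is_field (f x)" "is_field b"
  shows "normal_product (\<lambda>m v. \<Sum>x\<in>A. f x m v) b m v = (\<Sum>x\<in>A. normal_product (f x) b m v)"
  using assms(1)
proof (induction A rule: infinite_finite_induct)
  case (insert x A)
  then show ?case
    by (simp add: normal_product_add_left[OF _ is_field_sum assms(2)])
qed (simp_all add: normal_product_def flinear_0[OF is_field_flinear[OF assms(2)]] cong: if_cong)

lemma normal_product_sum_right:
  assumes "\<And>x. x \<in> A \<Longrightarrow> is_field (f x)" "is_field a"
  shows "normal_product a (\<lambda>m v. \<Sum>x\<in>A. f x m v) m v = (\<Sum>x\<in>A. normal_product a (f x) m v)"
  using assms(1)
proof (induction A rule: infinite_finite_induct)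
  case (insert x A)
  then show ?case
    by (simp add: normal_product_add_right[OF assms(2) _ is_field_sum])
qed (simp_all add: normal_product_def flinear_0[OF is_field_flinear[OF assms(2)]] cong: if_cong)

section \<open>The Heisenberg operators\<close>

lemma ip_alpha: "ip h (alpha i) = 2 * Poly_Mapping.lookup h i"
proof -
  have "ip h (alpha i) = (\<Sum>j\<in>insert i (Poly_Mapping.keys h).
      2 * Poly_Mapping.lookup h j * Poly_Mapping.lookup (alpha i) j)"
    by (rule ip_superset) auto
  also have "\<dots> = (\<Sum>j\<in>insert i (Poly_Mapping.keys h). if j = i then 2 * Poly_Mapping.lookup h i else 0)"
    by (intro sum.cong) (auto simp: alpha_def lookup_single)
  finally show ?thesis by simp
qed

lemma ip_alpha_left: "ip (alpha i) h = 2 * Poly_Mapping.lookup h i"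
  for h :: "nat \<Rightarrow>\<^sub>0 'a::comm_ring_1"
  by (subst ip_superset[of "{i}"]) (auto simp: alpha_def lookup_single when_def in_keys_iff split: if_splits)

lemma ip_commute: "ip x y = ip y x"
  by (subst (1 2) ip_superset[of "Poly_Mapping.keys x \<union> Poly_Mapping.keys y"])
     (auto intro!: sum.cong simp: mult_ac)

lemma ip_add_left: "ip (x + y) z = ip x z + ip y z"
proof -
  let ?S = "Poly_Mapping.keys x \<union> Poly_Mapping.keys y"
  have k: "Poly_Mapping.keys (x + y) \<subseteq> ?S"
    by (rule Poly_Mapping.keys_add)
  show ?thesis
    by (simp add: ip_superset[of ?S] k lookup_add algebra_simps sum.distrib)
qed

lemma ip_scl_left: "ip (scl c x) z = c * ip x z"
proof -
  have k: "Poly_Mapping.keys (scl c x) \<subseteq> Poly_Mapping.keys x"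
    by (auto simp: in_keys_iff lookup_scl)
  show ?thesis
    by (simp add: ip_superset[of "Poly_Mapping.keys x"] k lookup_scl sum_distrib_left mult_ac)
qed

lemma ip_add_right: "ip z (x + y) = ip z x + ip z y"
  and ip_scl_right: "ip z (scl c x) = c * ip z x"
  using ip_add_left[of x y z] ip_scl_left[of c x z] by (simp_all only: ip_commute[of z])

lemma ip_zero: "ip 0 x = 0" "ip x 0 = 0"
  by (simp_all add: ip_def)

lemma ip_uminus: "ip (- x) z = - ip x z" "ip z (- x) = - ip z x"
  using ip_add_left[of "- x" x z] ip_add_right[of z "- x" x]
  by (simp_all add: ip_zero eq_neg_iff_add_eq_0)

lemma ip_diff: "ip (x - y) z = ip x z - ip y z" "ip z (x - y) = ip z x - ip z y"
  using ip_add_left[of x "- y" z] ip_add_right[of z x "- y"] by (simp_all add: ip_uminus)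

lemma ip_sum_right: "ip z (\<Sum>x\<in>A. f x) = (\<Sum>x\<in>A. ip z (f x))"
  by (induction A rule: infinite_finite_induct) (auto simp: ip_zero ip_add_right)

lemma lookup_cvec: "Poly_Mapping.lookup (cvec x) i = of_int (Poly_Mapping.lookup x i)"
  unfolding cvec_def by transfer (auto simp: when_def)

lemma keys_cvec: "Poly_Mapping.keys (cvec x) = Poly_Mapping.keys x"
  by (auto simp: in_keys_iff lookup_cvec)

lemma cvec_add: "cvec (x + y) = cvec x + cvec y"
  and cvec_uminus: "cvec (- x) = - cvec x"
  and cvec_zero: "cvec 0 = 0"
  by (rule poly_mapping_eqI, simp add: lookup_cvec lookup_add)+

lemma cvec_alpha: "cvec (alpha i) = alpha i"
  by (rule poly_mapping_eqI) (simp add: lookup_cvec alpha_def lookup_single when_def)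

lemma ip_cvec: "ip (cvec x) (cvec y) = of_int (ip x y)"
  by (simp add: ip_def keys_cvec lookup_cvec)

lemma vec_expand: "(h :: nat \<Rightarrow>\<^sub>0 'a::comm_ring_1) =
    (\<Sum>i\<in>Poly_Mapping.keys h. scl (Poly_Mapping.lookup h i) (alpha i))"
  by (rule poly_mapping_eqI)
     (simp add: lookup_sum lookup_scl alpha_def lookup_single when_def in_keys_iff if_distrib cong: if_cong)

lemma evec_0: "evec 0 = 1"
  by (simp add: evec_def bvec_def zero_prod_def flip: single_one)

lemma hneg_alpha: "hneg (alpha i) n = bvec ({#(i, n)#}, 0)"
  by (simp add: hneg_def alpha_def)

section \<open>Modes of the Heisenberg fields\<close>

lemma flinear_heis: "flinear (heis h m)"
  by (simp add: heis_def flinear_lin)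

lemma heis_neg: "m < 0 \<Longrightarrow> heis h m v = hneg h (nat (- m)) * v"
  by (rule flinear_eqI[OF flinear_heis flinear_mult]) (auto simp: heis_def lin_bvec split: prod.splits)

lemma heis_zero_bvec: "heis h 0 (bvec b) = csc (ip h (cvec (snd b))) (bvec b)"
  by (simp add: heis_def lin_bvec split: prod.splits)

lemma heis_alpha_pos: "m > 0 \<Longrightarrow> heis (alpha i) m (bvec (M, \<gamma>)) =
    csc (2 * of_nat (count M (i, nat m)) * of_int m) (bvec (M - {#(i, nat m)#}, \<gamma>))"
proof -
  have "ip (alpha i) (alpha i) = (2 :: complex)" by (simp add: ip_alpha, simp add: alpha_def)
  moreover assume "m > 0"
  moreover have "Poly_Mapping.keys (alpha i :: nat \<Rightarrow>\<^sub>0 complex) = {i}" by (simp add: alpha_def)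
  ultimately show ?thesis
    by (simp add: heis_def lin_bvec mult_ac)
qed

text \<open>Reduces statements about h(m) to the \<alpha>_i(m), whose nonnegative modes send a
  monomial to a multiple of a single monomial.\<close>

lemma heis_expand: "heis h m v =
    (\<Sum>i\<in>Poly_Mapping.keys h. csc (Poly_Mapping.lookup h i) (heis (alpha i) m v))"
proof (rule flinear_eqI[OF flinear_heis flinear_sum_fun])
  show "flinear (\<lambda>v. csc (Poly_Mapping.lookup h i) (heis (alpha i) m v))" for i
    by (rule flinear_compose[OF flinear_scale flinear_heis])
next
  fix b :: basis
  obtain M \<gamma> where b: "b = (M, \<gamma>)" by (cases b)
  consider "m < 0" | "m = 0" | "m > 0" by linarith
  then show "heis h m (bvec b) =
      (\<Sum>i\<in>Poly_Mapping.keys h. csc (Poly_Mapping.lookup h i) (heis (alpha i) m (bvec b)))"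
  proof cases
    case 1
    then show ?thesis
      by (simp add: heis_neg hneg_alpha hneg_def[of h] sum_distrib_right csc_mult_left)
  next
    case 2
    have "ip h (cvec \<gamma>) = (\<Sum>i\<in>Poly_Mapping.keys h. Poly_Mapping.lookup h i * ip (alpha i) (cvec \<gamma>))"
      by (simp add: ip_def[of h] ip_alpha_left mult_ac)
    with 2 show ?thesis
      by (simp add: heis_zero_bvec b fock.scale_sum_left)
  next
    case 3
    then have "heis h m (bvec b) = (\<Sum>i\<in>Poly_Mapping.keys h.
       csc (of_nat (count M (i, nat m)) * of_int m * ip h (alpha i)) (bvec (M - {#(i, nat m)#}, \<gamma>)))"
      by (simp add: b heis_def lin_bvec)
    with 3 show ?thesis
      by (simp add: b heis_alpha_pos ip_alpha mult_ac)
  qed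
qed

lemma heis_superset:
  assumes "finite S" "Poly_Mapping.keys h \<subseteq> S"
  shows "heis h m v = (\<Sum>i\<in>S. csc (Poly_Mapping.lookup h i) (heis (alpha i) m v))"
  unfolding heis_expand[of h]
  by (rule sum.mono_neutral_left) (use assms in \<open>auto simp: in_keys_iff\<close>)

lemma heis_add: "heis (h + h') m v = heis h m v + heis h' m v"
proof -
  let ?S = "Poly_Mapping.keys h \<union> Poly_Mapping.keys h'"
  have k: "Poly_Mapping.keys (h + h') \<subseteq> ?S"
    by (rule Poly_Mapping.keys_add)
  show ?thesis
    by (simp add: heis_superset[of ?S] k lookup_add fock.scale_left_distrib sum.distrib)
qed

lemma heis_scl: "heis (scl c h) m v = csc c (heis h m v)"
proof -
  have k: "Poly_Mapping.keys (scl c h) \<subseteq> Poly_Mapping.keys h"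
    by (auto simp: in_keys_iff lookup_scl)
  show ?thesis
    by (simp add: heis_superset[of "Poly_Mapping.keys h"] k lookup_scl fock.scale_sum_right)
qed

lemma heis_0_left: "heis 0 m v = 0"
  by (simp add: heis_expand[of 0])

text \<open>Counts the oscillators only; the contribution of the charge to the conformal weight is
  added in \<open>weight\<close>.\<close>

definition deg :: "basis \<Rightarrow> nat" where
  "deg b = (\<Sum>p\<in>#fst b. snd p)"

lemma snd_le_deg: "(i, n) \<in># M \<Longrightarrow> n \<le> deg (M, \<gamma>)"
  by (auto simp: deg_def dest!: multi_member_split)

lemma is_field_heis_alpha: "is_field (heis (alpha i))"
proof (rule is_field_bvecI[OF flinear_heis])
  fix b :: basis
  obtain M \<gamma> where b: "b = (M, \<gamma>)" by (cases b)
  have "heis (alpha i) m (bvec b) = 0" if m: "m \<ge> int (deg b) + 1" for m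
  proof -
    have "(i, nat m) \<notin># M" using snd_le_deg[of i "nat m" M \<gamma>] m unfolding b by auto
    with m show ?thesis by (simp add: b heis_alpha_pos not_in_iff)
  qed
  then show "\<exists>B. \<forall>m\<ge>B. heis (alpha i) m (bvec b) = 0" by blast
qed

lemma heis_field_expand: "heis h = (\<lambda>m v. \<Sum>i\<in>Poly_Mapping.keys h.
    csc (Poly_Mapping.lookup h i) (heis (alpha i) m v))"
  by (intro ext) (rule heis_expand)

lemma is_field_heis: "is_field (heis h)"
  unfolding heis_field_expand[of h]
  by (intro is_field_sum is_field_csc is_field_heis_alpha)

text \<open>Restricted to pairs on the same side of the normal ordering, where the Heisenberg
  bracket vanishes. The mixed case is \<open>heis_alpha_hneg\<close>.\<close>

lemma heis_alpha_commute:
  assumes "l < 0 \<longleftrightarrow> m < 0"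
  shows "heis (alpha i) l (heis (alpha j) m v) = heis (alpha j) m (heis (alpha i) l v)"
proof (rule flinear_eqI[OF flinear_compose[OF flinear_heis flinear_heis] flinear_compose[OF flinear_heis flinear_heis]])
  fix b :: basis
  obtain M \<gamma> where b: "b = (M, \<gamma>)" by (cases b)
  note csc = flinear_csc[OF flinear_heis]
  have count: "count M p * count (M - {#p#}) q = count M q * count (M - {#q#}) p" for p q
    by (cases "p = q") auto
  consider "l < 0" "m < 0" | "l = 0" "m \<ge> 0" | "l > 0" "m = 0" | "l > 0" "m > 0"
    using assms by linarith
  then show "heis (alpha i) l (heis (alpha j) m (bvec b)) = heis (alpha j) m (heis (alpha i) l (bvec b))"
  proof cases
    case 1
    then show ?thesis by (simp add: heis_neg mult_ac)
  next
    case 2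
    then show ?thesis
      by (cases "m = 0") (simp_all add: b csc heis_alpha_pos heis_zero_bvec mult_ac)
  next
    case 3
    then show ?thesis
      by (simp add: b csc heis_alpha_pos heis_zero_bvec mult_ac)
  next
    case 4
    have "of_nat (count M (i, nat l)) * of_nat (count (M - {#(i, nat l)#}) (j, nat m)) =
      (of_nat (count M (j, nat m)) * of_nat (count (M - {#(j, nat m)#}) (i, nat l)) :: complex)"
      using arg_cong[OF count[of "(i, nat l)" "(j, nat m)"], of of_nat] by (simp only: of_nat_mult)
    with 4 show ?thesis
      by (simp only: b csc heis_alpha_pos fock.scale_scale diff_right_commute[of M])
         (simp add: mult_ac del: count_diff)
  qed
qed

text \<open>The bracket of \<alpha>_i(m) and \<alpha>_j(-n). The extra term arises because
  multiplication by \<alpha>_j(-n) raises the multiplicity of (j, n) by one.\<close>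

lemma heis_alpha_hneg:
  assumes n: "n \<ge> 1" and m: "m \<ge> 0"
  shows "heis (alpha i) m (hneg (alpha j) n * v) = hneg (alpha j) n * heis (alpha i) m v +
    csc (if m = int n \<and> i = j then 2 * of_int m else 0) v"
proof -
  have "flinear (\<lambda>v. hneg (alpha j) n * heis (alpha i) m v + csc (if m = int n \<and> i = j then 2 * of_int m else 0) v)"
    by (rule flinear_plus[OF flinear_compose[OF flinear_mult flinear_heis] flinear_scale])
  with flinear_compose[OF flinear_heis flinear_mult] show ?thesis
  proof (rule flinear_eqI)
    fix b :: basis
    obtain M \<gamma> where b: "b = (M, \<gamma>)" by (cases b)
    show "heis (alpha i) m (hneg (alpha j) n * bvec b) = hneg (alpha j) n * heis (alpha i) m (bvec b) +
      csc (if m = int n \<and> i = j then 2 * of_int m else 0) (bvec b)"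
    proof (cases "m = 0")
      case True
      with n show ?thesis
        by (simp add: b hneg_alpha bvec_mult heis_zero_bvec csc_mult_right)
    next
      case False
      with m have m: "m > 0" by simp
      have L: "heis (alpha i) m (hneg (alpha j) n * bvec b) =
        csc (2 * of_nat (count ({#(j, n)#} + M) (i, nat m)) * of_int m)
          (bvec ({#(j, n)#} + M - {#(i, nat m)#}, \<gamma>))"
        by (simp only: b hneg_alpha bvec_mult plus_prod_def fst_conv snd_conv add_0_left heis_alpha_pos[OF m])
      have R: "hneg (alpha j) n * heis (alpha i) m (bvec b) =
        csc (2 * of_nat (count M (i, nat m)) * of_int m)
          (bvec ({#(j, n)#} + (M - {#(i, nat m)#}), \<gamma>))"
        by (simp only: b hneg_alpha heis_alpha_pos[OF m] csc_mult_right bvec_mult plus_prod_def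
            fst_conv snd_conv add_0_left)
      show ?thesis
      proof (cases "m = int n \<and> i = j")
        case True
        then have nm: "nat m = n" "i = j" by auto
        show ?thesis
        \<comment> \<open>Multiset difference is truncated: removing (j, n) and adding it again
          restores M only if it occurs in M. Otherwise the multiplicity 0 annihilates that
          term.\<close>
        proof (cases "(j, n) \<in># M")
          case in_M: True
          then have "{#(j, n)#} + (M - {#(j, n)#}) = M" by simp
          then show ?thesis unfolding L R using True
            by (simp add: b distrib_left distrib_right fock.scale_left_distrib mult.commute add.commute)
        next
          case False
          then have "count M (j, n) = 0" by (simp add: not_in_iff)
          then show ?thesis unfolding L R using True by (simp add: b mult.commute)
        qed
      next
        case False
        with m have ne: "(i, nat m) \<noteq> (j, n)" by auto
        have "{#(j, n)#} + M - {#(i, nat m)#} = {#(j, n)#} + (M - {#(i, nat m)#})"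
          using ne by (auto intro!: multiset_eqI)
        moreover have "count ({#(j, n)#} + M) (i, nat m) = count M (i, nat m)" using ne by auto
        ultimately show ?thesis unfolding L R by (simp only: False if_False fock.scale_zero_left add_0_right)
      qed
    qed
  qed
qed

text \<open>The Heisenberg relation in full, by bilinearity from the \<alpha>_i. Inductions over V_N
  rest on it, since it moves a mode h(m) with m \<ge> 0 past a creation operator until it meets some
  e^x.\<close>

lemma heis_hneg_commute:
  assumes n: "n \<ge> 1" and m: "m \<ge> 0"
  shows "heis h m (hneg h' n * v) = hneg h' n * heis h m v + csc (if m = int n then of_int m * ip h h' else 0) v"
proof -
  let ?K = "Poly_Mapping.keys h" and ?K' = "Poly_Mapping.keys h'"
  have ip: "ip h h' = (\<Sum>i\<in>?K. \<Sum>j\<in>?K'. if i = j then 2 * Poly_Mapping.lookup h i * Poly_Mapping.lookup h' j else 0)"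
    unfolding ip_def by (rule sum.cong) (auto simp: in_keys_iff)
  have "hneg h' n * v = (\<Sum>j\<in>?K'. csc (Poly_Mapping.lookup h' j) (hneg (alpha j) n * v))" for v
    by (simp add: hneg_def[of h'] hneg_alpha sum_distrib_right csc_mult_left)
  note H = this
  have "heis h m (hneg h' n * v) = (\<Sum>i\<in>?K. \<Sum>j\<in>?K'. csc (Poly_Mapping.lookup h i * Poly_Mapping.lookup h' j)
      (hneg (alpha j) n * heis (alpha i) m v + csc (if m = int n \<and> i = j then 2 * of_int m else 0) v))"
    by (simp add: heis_expand[of h] H flinear_sum[OF flinear_heis] flinear_csc[OF flinear_heis]
      heis_alpha_hneg[OF n m] fock.scale_sum_right del: fock.scale_right_distrib)
       (subst sum.swap, simp only: mult.commute)
  also have "\<dots> = (\<Sum>i\<in>?K. \<Sum>j\<in>?K'. csc (Poly_Mapping.lookup h i) (csc (Poly_Mapping.lookup h' j)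
      (hneg (alpha j) n * heis (alpha i) m v))) +
      (\<Sum>i\<in>?K. \<Sum>j\<in>?K'. csc (if m = int n then of_int m * (if i = j then 2 * Poly_Mapping.lookup h i * Poly_Mapping.lookup h' j else 0) else 0) v)"
    unfolding sum.distrib[symmetric]
    by (intro sum.cong refl) (auto simp: fock.scale_right_distrib mult_ac)
  also have "(\<Sum>i\<in>?K. \<Sum>j\<in>?K'. csc (Poly_Mapping.lookup h i) (csc (Poly_Mapping.lookup h' j)
      (hneg (alpha j) n * heis (alpha i) m v))) = hneg h' n * heis h m v"
    by (simp add: heis_expand[of h] H sum_distrib_left csc_mult_right fock.scale_sum_right)
  also have "(\<Sum>i\<in>?K. \<Sum>j\<in>?K'. csc (if m = int n then of_int m * (if i = j then 2 * Poly_Mapping.lookup h i * Poly_Mapping.lookup h' j else 0) else 0) v)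
     = csc (if m = int n then of_int m * ip h h' else 0) v"
    by (cases "m = int n") (simp_all add: ip sum_distrib_left fock.scale_sum_left del: sum.delta sum.delta')
  finally show ?thesis .
qed

lemma heis_evec: "m > 0 \<Longrightarrow> heis h m (evec \<gamma>) = 0"
  by (simp add: heis_expand[of h] evec_def heis_alpha_pos)

lemma heis_zero_evec: "heis h 0 (evec \<gamma>) = csc (ip h (cvec \<gamma>)) (evec \<gamma>)"
  by (simp add: evec_def heis_zero_bvec)

section \<open>The fields of lattice vectors\<close>

lemma sum_closed:
  assumes "P 0" "\<And>u v. P u \<Longrightarrow> P v \<Longrightarrow> P (u + v)" "\<And>x. x \<in> A \<Longrightarrow> P (f x)"
  shows "P (\<Sum>x\<in>A. f x)"
  using assms(3) by (induction A rule: infinite_finite_induct) (auto simp: assms(1,2))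

section \<open>Coefficients of exponentials of operators\<close>

lemma flinear_pow_coeff:
  assumes "\<And>n. flinear (a n)"
  shows "flinear (pow_coeff a r j)"
proof (induction r arbitrary: j)
  case 0
  then show ?case by (cases "j = 0") (simp_all add: flinear_id flinear_zero)
next
  case (Suc r)
  have "flinear (\<lambda>v. \<Sum>n\<in>{1..j}. a n (pow_coeff a r (j - n) v))"
    by (rule flinear_sum_fun, rule flinear_compose[OF assms Suc])
  then show ?case by simp
qed

lemma flinear_exp_coeff:
  assumes "\<And>n. flinear (a n)"
  shows "flinear (exp_coeff a j)"
  unfolding exp_coeff_def
  by (rule flinear_sum_fun, rule flinear_compose[OF flinear_scale flinear_pow_coeff[OF assms]])

lemma exp_coeff_0: "exp_coeff a 0 v = v"
  by (simp add: exp_coeff_def)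

lemma exp_coeff_1: "exp_coeff a (Suc 0) v = a (Suc 0) v"
  by (simp add: exp_coeff_def)

lemma pow_coeff_pred:
  assumes "P 0" "\<And>u v. P u \<Longrightarrow> P v \<Longrightarrow> P (u + v)" "\<And>n v. n \<ge> 1 \<Longrightarrow> P v \<Longrightarrow> P (a n v)" "P v"
  shows "P (pow_coeff a r j v)"
proof (induction r arbitrary: j)
  case (Suc r)
  have "P (\<Sum>n\<in>{1..j}. a n (pow_coeff a r (j - n) v))"
    by (rule sum_closed[of P]) (use assms Suc in auto)
  then show ?case by simp
qed (use assms in auto)

lemma exp_coeff_pred:
  assumes P: "P 0" "\<And>u v. P u \<Longrightarrow> P v \<Longrightarrow> P (u + v)" "\<And>c v. P v \<Longrightarrow> P (csc c v)"
    "\<And>n v. n \<ge> 1 \<Longrightarrow> P v \<Longrightarrow> P (a n v)" "P v"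
  shows "P (exp_coeff a j v)"
proof -
  have "P (\<Sum>r\<in>A. csc (1 / fact r) (pow_coeff a r j v))" for A
    using pow_coeff_pred[of P a v] P by (induction A rule: infinite_finite_induct) auto
  then show ?thesis by (simp add: exp_coeff_def)
qed

text \<open>The two halves of \<open>exp_field\<close>, the coefficients of \<open>exp (\<Sum>n\<ge>1. \<alpha>(-n)/n z\<^sup>n)\<close> and of
  \<open>exp (- \<Sum>n\<ge>1. \<alpha>(n)/n z\<^bsup>-n\<^esup>)\<close>.\<close>

definition exp_creation :: "(nat \<Rightarrow>\<^sub>0 int) \<Rightarrow> nat \<Rightarrow> fock \<Rightarrow> fock" where
  "exp_creation \<alpha> = exp_coeff (\<lambda>n v. csc (1 / of_nat n) (heis (cvec \<alpha>) (- int n) v))"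

definition exp_annihilation :: "(nat \<Rightarrow>\<^sub>0 int) \<Rightarrow> nat \<Rightarrow> fock \<Rightarrow> fock" where
  "exp_annihilation \<alpha> = exp_coeff (\<lambda>n v. csc (- 1 / of_nat n) (heis (cvec \<alpha>) (int n) v))"

lemma flinear_exp_creation: "flinear (exp_creation \<alpha> j)"
  and flinear_exp_annihilation: "flinear (exp_annihilation \<alpha> j)"
  unfolding exp_creation_def exp_annihilation_def
  by (rule flinear_exp_coeff, rule flinear_compose[OF flinear_scale flinear_heis])+

text \<open>The bound is an integer, so that lowering it below 0 forces the vector to vanish
  (\<open>deg_le_neg\<close>).\<close>

definition deg_le :: "int \<Rightarrow> fock \<Rightarrow> bool" where
  "deg_le d v \<longleftrightarrow> (\<forall>b\<in>Poly_Mapping.keys v. int (deg b) \<le> d)"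

text \<open>The exponent contributed by z^{\<alpha>(0)} is constant exactly on vectors of one
  charge; there \<open>exp_field\<close> has a formula without reference to a basis.\<close>

definition has_charge :: "(nat \<Rightarrow>\<^sub>0 int) \<Rightarrow> fock \<Rightarrow> bool" where
  "has_charge \<gamma> v \<longleftrightarrow> (\<forall>b\<in>Poly_Mapping.keys v. snd b = \<gamma>)"

lemma keys_csc: "Poly_Mapping.keys (csc c v) \<subseteq> Poly_Mapping.keys v"
  by (auto simp: in_keys_iff lookup_csc)

lemma keys_bvec: "Poly_Mapping.keys (bvec b) = {b}"
  by (simp add: bvec_def)

lemma fock_pred_flinear:
  assumes f: "flinear f" and P: "P 0" "\<And>u v. P u \<Longrightarrow> P v \<Longrightarrow> P (u + v)" "\<And>c v. P v \<Longrightarrow> P (csc c v)"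
    and base: "\<And>b. b \<in> Poly_Mapping.keys v \<Longrightarrow> P (f (bvec b))"
  shows "P (f v)"
proof -
  have "P (\<Sum>b\<in>A. csc (Poly_Mapping.lookup v b) (f (bvec b)))" if "A \<subseteq> Poly_Mapping.keys v" for A
    using that by (induction A rule: infinite_finite_induct) (use P base in auto)
  then have "P (\<Sum>b\<in>Poly_Mapping.keys v. csc (Poly_Mapping.lookup v b) (f (bvec b)))" by blast
  then show ?thesis
    using arg_cong[OF fock_expand[of v], of f] by (simp only: flinear_sum[OF f] flinear_csc[OF f])
qed

lemma deg_le_closed: "deg_le d 0" "deg_le d u \<Longrightarrow> deg_le d v \<Longrightarrow> deg_le d (u + v)"
    "deg_le d v \<Longrightarrow> deg_le d (csc c v)"
  using Poly_Mapping.keys_add[of u v] keys_csc[of c v] unfolding deg_le_def by auto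

lemma has_charge_closed: "has_charge \<gamma> 0" "has_charge \<gamma> u \<Longrightarrow> has_charge \<gamma> v \<Longrightarrow> has_charge \<gamma> (u + v)"
    "has_charge \<gamma> v \<Longrightarrow> has_charge \<gamma> (csc c v)"
  using Poly_Mapping.keys_add[of u v] keys_csc[of c v] unfolding has_charge_def by auto

lemma deg_le_exists: "\<exists>d::nat. deg_le (int d) v"
proof
  show "deg_le (int (Max (deg ` Poly_Mapping.keys v))) v" by (auto simp: deg_le_def)
qed

lemma deg_le_mono: "deg_le d v \<Longrightarrow> d \<le> d' \<Longrightarrow> deg_le d' v"
  by (auto simp: deg_le_def)

lemma deg_le_neg: "deg_le d v \<Longrightarrow> d < 0 \<Longrightarrow> v = 0"
  unfolding deg_le_def by (metis equals0I keys_eq_empty not_less of_nat_0_le_iff order_trans)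

lemma deg_diff: "(i, n) \<in># M \<Longrightarrow> deg (M, \<gamma>) = n + deg (M - {#(i, n)#}, \<gamma>)"
  by (auto simp: deg_def dest!: multi_member_split)

lemma deg_le_heis:
  assumes "deg_le d v" "n > 0"
  shows "deg_le (d - n) (heis h n v)"
proof (rule fock_pred_flinear[OF flinear_heis deg_le_closed])
  fix b assume b: "b \<in> Poly_Mapping.keys v"
  obtain M \<gamma> where M: "b = (M, \<gamma>)" by (cases b)
  have d: "int (deg (M, \<gamma>)) \<le> d" using assms b M by (auto simp: deg_le_def)
  have "deg_le (d - n) (csc (of_nat (count M (i, nat n)) * c) (bvec (M - {#(i, nat n)#}, \<gamma>)))" for i c
  proof (cases "(i, nat n) \<in># M")
    case True
    with d assms(2) deg_diff[OF True, of \<gamma>] show ?thesis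
      by (intro deg_le_closed) (auto simp: deg_le_def keys_bvec)
  qed (simp add: not_in_iff deg_le_closed)
  have "deg_le (d - n) (heis (alpha i) n (bvec b))" for i
  proof -
    have "heis (alpha i) n (bvec b) =
      csc (of_nat (count M (i, nat n)) * (2 * of_int n)) (bvec (M - {#(i, nat n)#}, \<gamma>))"
      unfolding M heis_alpha_pos[OF assms(2)] by (simp only: mult_ac)
    then show ?thesis
      using \<open>\<And>i c. deg_le (d - n) (csc (of_nat (count M (i, nat n)) * c) (bvec (M - {#(i, nat n)#}, \<gamma>)))\<close>
      by (simp only:)
  qed
  then have "deg_le (d - n) (\<Sum>i\<in>A. csc (Poly_Mapping.lookup h i) (heis (alpha i) n (bvec b)))" for A
    by (induction A rule: infinite_finite_induct) (auto simp: deg_le_closed)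
  then show "deg_le (d - n) (heis h n (bvec b))" by (simp add: heis_expand[of h])
qed

text \<open>Every product of modes in the coefficient of z^{-j} has total index j, and each mode
  lowers the degree by its index.\<close>

lemma deg_le_exp_annihilation:
  assumes "deg_le d v"
  shows "deg_le (d - int j) (exp_annihilation \<alpha> j v)"
proof -
  let ?a = "\<lambda>n v. csc (- 1 / of_nat n) (heis (cvec \<alpha>) (int n) v)"
  have "deg_le (d - int j) (pow_coeff ?a r j v)" for r
  proof (induction r arbitrary: j)
    case (Suc r)
    have "deg_le (d - int j) (?a n (pow_coeff ?a r (j - n) v))" if "1 \<le> n" "n \<le> j" for n
      using deg_le_heis[OF Suc[of "j - n"], of "int n" "cvec \<alpha>"] that
      by (intro deg_le_closed) (simp add: of_nat_diff algebra_simps)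
    note step = this
    have "deg_le (d - int j) (\<Sum>n\<in>{1..j}. ?a n (pow_coeff ?a r (j - n) v))"
      by (rule sum_closed[of "deg_le (d - int j)", OF deg_le_closed(1) deg_le_closed(2)], assumption+, rule step) auto
    then show ?case by simp
  qed (use assms in \<open>auto simp: deg_le_closed\<close>)
  then have "deg_le (d - int j) (\<Sum>r\<in>A. csc (1 / fact r) (pow_coeff ?a r j v))" for A
    by (induction A rule: infinite_finite_induct) (auto simp: deg_le_closed)
  then show ?thesis by (simp add: exp_annihilation_def exp_coeff_def)
qed

lemma exp_annihilation_zero: "deg_le d v \<Longrightarrow> int j > d \<Longrightarrow> exp_annihilation \<alpha> j v = 0"
  using deg_le_neg deg_le_exp_annihilation by fastforce

lemma deg_le_evec_mult: "deg_le (int (deg b)) (evec \<alpha> * bvec b)"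
  by (cases b) (simp add: evec_def bvec_mult deg_le_def keys_bvec deg_def)

text \<open>Annihilation coefficients beyond the degree vanish. The cut-off J is left free so that
  monomials of different degrees can share one range of summation.\<close>

lemma exp_field_bvec:
  assumes J: "deg b \<le> J"
  shows "exp_field \<alpha> m (bvec b) = (\<Sum>j\<le>J.
     let i = int j - ip \<alpha> (snd b) - m - 1 in
     if i < 0 then 0 else exp_creation \<alpha> (nat i) (exp_annihilation \<alpha> j (evec \<alpha> * bvec b)))"
proof -
  obtain M \<gamma> where b: "b = (M, \<gamma>)" by (cases b)
  have z: "exp_annihilation \<alpha> j (evec \<alpha> * bvec b) = 0" if "j > J" for j
    by (rule exp_annihilation_zero[OF deg_le_evec_mult]) (use J that in auto)
  have "exp_field \<alpha> m (bvec b) = Sum_any (\<lambda>j::nat.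
     let i = int j - ip \<alpha> (snd b) - m - 1 in
     if i < 0 then 0 else exp_creation \<alpha> (nat i) (exp_annihilation \<alpha> j (evec \<alpha> * bvec b)))"
    unfolding exp_field_def exp_creation_def exp_annihilation_def lin_bvec b prod.case snd_conv ..
  also have "\<dots> = (\<Sum>j\<le>J.
     let i = int j - ip \<alpha> (snd b) - m - 1 in
     if i < 0 then 0 else exp_creation \<alpha> (nat i) (exp_annihilation \<alpha> j (evec \<alpha> * bvec b)))"
  proof (rule Sum_any.expand_superset, simp, rule subsetI, rule ccontr)
    fix j assume j: "j \<in> {j. (let i = int j - ip \<alpha> (snd b) - m - 1 in
     if i < 0 then 0 else exp_creation \<alpha> (nat i) (exp_annihilation \<alpha> j (evec \<alpha> * bvec b))) \<noteq> 0}"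
      and "j \<notin> {..J}"
    then have "exp_annihilation \<alpha> j (evec \<alpha> * bvec b) = 0" using z by simp
    with j show False by (simp add: Let_def flinear_0[OF flinear_exp_creation] split: if_splits)
  qed
  finally show ?thesis .
qed

text \<open>With the charge fixed, the formula on monomials is linear in v. This form is suited to
  symmetries, which carry charges to charges but need not carry monomials to monomials.\<close>

lemma exp_field_charge:
  assumes \<gamma>: "has_charge \<gamma> v" and J: "deg_le (int J) v"
  shows "exp_field \<alpha> m v = (\<Sum>j\<le>J.
     let i = int j - ip \<alpha> \<gamma> - m - 1 in
     if i < 0 then 0 else exp_creation \<alpha> (nat i) (exp_annihilation \<alpha> j (evec \<alpha> * v)))"
proof -
  define g where "g v = (\<Sum>j\<le>J. let i = int j - ip \<alpha> \<gamma> - m - 1 in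
     if i < 0 then 0 else exp_creation \<alpha> (nat i) (exp_annihilation \<alpha> j (evec \<alpha> * v)))" for v
  have g: "flinear g"
    unfolding g_def
  proof (rule flinear_sum_fun)
    fix j
    have "flinear (\<lambda>v. exp_creation \<alpha> i (exp_annihilation \<alpha> j (evec \<alpha> * v)))" for i
      by (rule flinear_compose[OF flinear_exp_creation flinear_compose[OF flinear_exp_annihilation flinear_mult]])
    then show "flinear (\<lambda>v. let i = int j - ip \<alpha> \<gamma> - m - 1 in
     if i < 0 then 0 else exp_creation \<alpha> (nat i) (exp_annihilation \<alpha> j (evec \<alpha> * v)))"
      unfolding Let_def by (cases "int j - ip \<alpha> \<gamma> - m - 1 < 0") (simp_all only: if_True if_False flinear_zero)
  qed
  have f: "flinear (exp_field \<alpha> m)" by (simp add: exp_field_def flinear_lin)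
  have eq: "exp_field \<alpha> m (bvec b) = g (bvec b)" if "b \<in> Poly_Mapping.keys v" for b
  proof -
    have b: "snd b = \<gamma>" "deg b \<le> J" using assms that by (auto simp: has_charge_def deg_le_def)
    show ?thesis unfolding exp_field_bvec[OF b(2)] b(1) g_def ..
  qed
  have *: "h v = (\<Sum>b\<in>Poly_Mapping.keys v. csc (Poly_Mapping.lookup v b) (h (bvec b)))"
    if "flinear h" for h
    using arg_cong[OF fock_expand[of v], of h] that by (simp only: flinear_sum flinear_csc)
  have "exp_field \<alpha> m v = g v"
    unfolding *[OF f] *[OF g] using eq by (intro sum.cong) auto
  then show ?thesis by (simp add: g_def)
qed

lemma flinear_exp_field: "flinear (exp_field \<alpha> m)"
  by (simp add: exp_field_def flinear_lin)

lemma is_field_exp_field: "is_field (exp_field \<alpha>)"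
proof (rule is_field_bvecI[OF flinear_exp_field])
  fix b
  have "exp_field \<alpha> m (bvec b) = 0" if "m \<ge> int (deg b) - ip \<alpha> (snd b)" for m
    unfolding exp_field_bvec[OF order_refl] using that by (intro sum.neutral) auto
  then show "\<exists>B. \<forall>m\<ge>B. exp_field \<alpha> m (bvec b) = 0" by blast
qed

lemma exp_annihilation_evec: "exp_annihilation \<alpha> j (evec \<gamma>) = (if j = 0 then evec \<gamma> else 0)"
proof -
  have "deg_le 0 (evec \<gamma>)" by (simp add: evec_def deg_le_def keys_bvec deg_def)
  then show ?thesis
    using exp_annihilation_zero[of 0 "evec \<gamma>" j] by (auto simp: exp_annihilation_def exp_coeff_0)
qed

text \<open>As e^\<gamma> contains no oscillators, the annihilation exponential acts as 1 and only
  z^{\<langle>\<alpha>, \<gamma>\<rangle>} and the creation exponential remain.\<close>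

lemma exp_field_evec: "exp_field \<alpha> m (evec \<gamma>) =
    (let i = - ip \<alpha> \<gamma> - m - 1 in if i < 0 then 0 else exp_creation \<alpha> (nat i) (evec (\<alpha> + \<gamma>)))"
  unfolding evec_def[of \<gamma>]
  by (subst exp_field_bvec[of _ 0])
     (simp_all add: deg_def evec_def[symmetric] evec_add[symmetric] exp_annihilation_evec)

lemma exp_field_0: "exp_field 0 m v = (if m = - 1 then v else 0)"
proof (rule flinear_eqI[OF flinear_exp_field])
  show "flinear (\<lambda>v. if m = - 1 then v else 0)"
    by (cases "m = - 1") (simp_all add: flinear_id flinear_zero)
  fix b
  have pow: "pow_coeff (\<lambda>n v. 0) r j v = (if r = 0 \<and> j = 0 then v else 0)" for r j v
    by (cases r) auto
  have z: "exp_coeff (\<lambda>n v. 0) j v = (if j = 0 then v else 0)" for j v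
    by (simp add: exp_coeff_def pow if_distrib[of "csc _"] cong: if_cong)
  have "exp_field 0 m (bvec b) = (\<Sum>j\<le>deg b. if j = 0 then if m = - 1 then bvec b else 0 else 0)"
    unfolding exp_field_bvec[OF order_refl]
    by (rule sum.cong)
       (auto simp: exp_creation_def exp_annihilation_def cvec_zero heis_0_left z Let_def ip_zero evec_0)
  then show "exp_field 0 m (bvec b) = (if m = - 1 then bvec b else 0)" by simp
qed

section \<open>Vertex operators and the subspace \<open>VN\<close>\<close>

text \<open>Differentiation shifts the index from l to l - p and could turn a nonnegative index into
  a negative one. The binomial coefficient vanishes precisely for 0 \<le> l < p, so every surviving
  mode keeps its sign class and \<open>heis_alpha_commute\<close> applies.\<close>

lemma deriv_heis_commute:
  assumes "l < 0 \<longleftrightarrow> m < 0"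
  shows "deriv_field p (heis (alpha i)) l (deriv_field q (heis (alpha j)) m v) =
    deriv_field q (heis (alpha j)) m (deriv_field p (heis (alpha i)) l v)"
proof -
  have choose: "(of_int l :: complex) gchoose p = 0" if "0 \<le> l" "l < int p" for l p
    using that binomial_gbinomial[of "nat l" p, where 'a = complex] binomial_eq_0[of "nat l" p] by simp
  have D: "deriv_field p (heis h) l v = (if 0 \<le> l \<and> l < int p then 0 else
      csc ((- 1) ^ p * (of_int l gchoose p)) (heis h (l - int p) v))" for p h l v
    by (simp add: deriv_field_def choose)
  have "flinear (deriv_field p (heis h) l)" for p h l
    by (intro is_field_flinear is_field_deriv is_field_heis)
  note z = flinear_0[OF this]
  have comm: "heis (alpha i) (l - int p) (heis (alpha j) (m - int q) v) =
     heis (alpha j) (m - int q) (heis (alpha i) (l - int p) v)"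
    if "\<not> (0 \<le> l \<and> l < int p)" "\<not> (0 \<le> m \<and> m < int q)"
    by (rule heis_alpha_commute) (use that assms in auto)
  show ?thesis
  proof (cases "(0 \<le> l \<and> l < int p) \<or> (0 \<le> m \<and> m < int q)")
    case True
    then have "deriv_field p (heis (alpha i)) l u = 0" "True" if "0 \<le> l \<and> l < int p" for u
      using that by (simp_all add: D)
    moreover have "deriv_field q (heis (alpha j)) m u = 0" if "0 \<le> m \<and> m < int q" for u
      using that by (simp add: D)
    ultimately show ?thesis using True z by metis
  next
    case False
    then have "\<not> (0 \<le> l \<and> l < int p)" "\<not> (0 \<le> m \<and> m < int q)" by blast+
    note F = this
    show ?thesis
      unfolding D if_not_P[OF F(1)] if_not_P[OF F(2)] flinear_csc[OF flinear_heis] comm[OF F]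
      by (simp only: fock.scale_scale mult.commute)
  qed
qed

section \<open>Independence of the enumeration of a monomial, and the recursion for vertex
  operators\<close>

lemma is_field_Y_list: "is_field (Y_list ps \<alpha>)"
  by (induction ps) (simp_all add: is_field_exp_field is_field_normal_product is_field_deriv is_field_heis)

lemma Y_list_move: "p \<in> set qs \<Longrightarrow> Y_list qs \<alpha> = Y_list (p # remove1 p qs) \<alpha>"
proof (induction qs)
  case (Cons q qs)
  show ?case
  proof (cases "p = q")
    case False
    with Cons have "Y_list qs \<alpha> = Y_list (p # remove1 p qs) \<alpha>" by simp
    then have "Y_list (q # qs) \<alpha> = normal_product (deriv_field (snd q - 1) (heis (alpha (fst q))))
      (normal_product (deriv_field (snd p - 1) (heis (alpha (fst p)))) (Y_list (remove1 p qs) \<alpha>))"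
      by simp
    also have "\<dots> = normal_product (deriv_field (snd p - 1) (heis (alpha (fst p))))
      (normal_product (deriv_field (snd q - 1) (heis (alpha (fst q)))) (Y_list (remove1 p qs) \<alpha>))"
      by (rule normal_product_left_commute)
         (auto intro: is_field_deriv is_field_heis is_field_Y_list deriv_heis_commute)
    finally show ?thesis using False by simp
  qed simp
qed simp

text \<open>Makes the choice of enumeration in \<open>Y_op\<close> harmless: any factor can be moved
  to the front by left commutativity.\<close>

lemma Y_list_mset: "mset ps = mset qs \<Longrightarrow> Y_list ps \<alpha> = Y_list qs \<alpha>"
proof (induction ps arbitrary: qs)
  case (Cons p ps)
  then have p: "p \<in> set qs" by (metis list.set_intros(1) mset_eq_setD)
  have "mset ps = mset (remove1 p qs)" using Cons.prems by (metis add_mset_remove_trivial mset.simps(2) mset_remove1)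
  then have "Y_list ps \<alpha> = Y_list (remove1 p qs) \<alpha>" by (rule Cons.IH)
  then show ?case by (simp add: Y_list_move[OF p])
qed simp

lemma Y_op_bvec: "Y_op (bvec (mset ps, \<alpha>)) m v = Y_list ps \<alpha> m v"
proof -
  have "mset (SOME qs. mset qs = mset ps) = mset ps" by (rule someI) simp
  then have "Y_list (SOME qs. mset qs = mset ps) \<alpha> = Y_list ps \<alpha>" by (rule Y_list_mset)
  then show ?thesis unfolding Y_op_def lin_bvec prod.case by (simp only:)
qed

lemma flinear_Y_op_left: "flinear (\<lambda>u. Y_op u m v)"
  by (simp add: Y_op_def flinear_lin)

lemma Y_op_expand: "Y_op u = (\<lambda>m v. \<Sum>b\<in>Poly_Mapping.keys u.
    csc (Poly_Mapping.lookup u b) (Y_op (bvec b) m v))"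
  by (intro ext) (simp add: Y_op_def lin_def[of _ u] lin_bvec)

lemma is_field_Y_op_bvec: "is_field (Y_op (bvec b))"
proof -
  obtain ps \<alpha> where b: "b = (mset ps, \<alpha>)" by (metis ex_mset surj_pair)
  then have "Y_op (bvec b) = Y_list ps \<alpha>" by (intro ext) (simp add: Y_op_bvec)
  then show ?thesis by (simp add: is_field_Y_list)
qed

lemma is_field_Y_op: "is_field (Y_op u)"
  unfolding Y_op_expand[of u] by (intro is_field_sum is_field_csc is_field_Y_op_bvec)

lemma flinear_Y_op: "flinear (Y_op u m)"
  by (rule is_field_flinear[OF is_field_Y_op])

lemma Y_op_evec: "Y_op (evec \<alpha>) m v = exp_field \<alpha> m v"
  using Y_op_bvec[of "[]"] by (simp add: evec_def)

lemma Y_op_1: "Y_op 1 m v = (if m = - 1 then v else 0)"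
  using Y_op_evec[of 0] by (simp add: evec_0 exp_field_0)

lemma Y_op_hneg_alpha: "Y_op (hneg (alpha i) n * u) m v =
    normal_product (deriv_field (n - 1) (heis (alpha i))) (Y_op u) m v"
proof -
  have a: "is_field (deriv_field (n - 1) (heis (alpha i)))" by (intro is_field_deriv is_field_heis)
  have basis: "Y_op (hneg (alpha i) n * bvec b) m v =
    normal_product (deriv_field (n - 1) (heis (alpha i))) (Y_op (bvec b)) m v" for b
  proof -
    obtain ps \<alpha> where b: "b = (mset ps, \<alpha>)" by (metis ex_mset surj_pair)
    have "hneg (alpha i) n * bvec b = bvec (mset ((i, n) # ps), \<alpha>)"
      by (simp add: hneg_alpha b bvec_mult)
    moreover have "Y_op (bvec b) = Y_list ps \<alpha>" unfolding b by (intro ext) (rule Y_op_bvec)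
    ultimately show ?thesis by (simp only: Y_op_bvec Y_list.simps fst_conv snd_conv)
  qed
  have "Y_op (hneg (alpha i) n * u) m v =
    (\<Sum>b\<in>Poly_Mapping.keys u. csc (Poly_Mapping.lookup u b) (Y_op (hneg (alpha i) n * bvec b) m v))"
    using arg_cong[OF fock_expand[of u], of "\<lambda>u. Y_op (hneg (alpha i) n * u) m v"]
    by (simp only: sum_distrib_left csc_mult_right flinear_sum[OF flinear_Y_op_left] flinear_csc[OF flinear_Y_op_left])
  also have "\<dots> = normal_product (deriv_field (n - 1) (heis (alpha i))) (Y_op u) m v"
    unfolding Y_op_expand[of u] basis
    by (simp only: normal_product_sum_right[OF is_field_csc[OF is_field_Y_op_bvec] a]
        normal_product_csc_right[OF a is_field_Y_op_bvec])
  finally show ?thesis .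
qed

text \<open>Recursion in a form adapted to V_N: the definition handles monomials in the \<alpha>_i,
  whereas V_N is built with general h in \<hh>. Together with \<open>Y_op_evec\<close> it determines
  all modes on V_N.\<close>

lemma Y_op_hneg: "Y_op (hneg h n * u) m v = normal_product (deriv_field (n - 1) (heis h)) (Y_op u) m v"
proof -
  have a: "is_field (deriv_field (n - 1) (heis (alpha i)))" for i by (intro is_field_deriv is_field_heis)
  have "hneg h n * u = (\<Sum>i\<in>Poly_Mapping.keys h. csc (Poly_Mapping.lookup h i) (hneg (alpha i) n * u))"
    by (simp add: hneg_def[of h] hneg_alpha sum_distrib_right csc_mult_left)
  then have L: "Y_op (hneg h n * u) m v = (\<Sum>i\<in>Poly_Mapping.keys h. csc (Poly_Mapping.lookup h i)
      (normal_product (deriv_field (n - 1) (heis (alpha i))) (Y_op u) m v))"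
    by (simp only: flinear_sum[OF flinear_Y_op_left] flinear_csc[OF flinear_Y_op_left] Y_op_hneg_alpha)
  have R: "deriv_field (n - 1) (heis h) = (\<lambda>m v. \<Sum>i\<in>Poly_Mapping.keys h.
     csc (Poly_Mapping.lookup h i) (deriv_field (n - 1) (heis (alpha i)) m v))"
    by (intro ext) (simp add: deriv_field_def heis_expand[of h] fock.scale_sum_right mult_ac)
  show ?thesis unfolding L R
    by (simp only: normal_product_sum_left[OF is_field_csc[OF a] is_field_Y_op]
        normal_product_csc_left[OF a is_field_Y_op])
qed

lemma Y_op_hneg_1: "Y_op (hneg h 1) m v = heis h m v"
proof -
  have "Y_op (hneg h 1) m v = normal_product (deriv_field 0 (heis h)) (Y_op 1) m v"
    using Y_op_hneg[of h 1 1 m v] by simp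
  \<comment> \<open>The vacuum field has only the mode -1, and m - l - 1 = -1 selects l = m.\<close>
  also have "\<dots> = Sum_any (\<lambda>l. if l = m then heis h m v else 0)"
    unfolding normal_product_def deriv_field_def
    by (rule Sum_any.cong) (auto simp: Y_op_1 flinear_0[OF flinear_heis])
  also have "\<dots> = heis h m v" by simp
  finally show ?thesis .
qed

section \<open>The subspace V_N and its closure under all modes\<close>

lemma beta_span_closed:
  fixes x y :: "nat \<Rightarrow>\<^sub>0 'a::comm_ring_1"
  assumes "k \<ge> 1"
  shows "0 \<in> (beta_span k :: (nat \<Rightarrow>\<^sub>0 'a) set)"
    "x \<in> beta_span k \<Longrightarrow> y \<in> beta_span k \<Longrightarrow> x + y \<in> beta_span k"
    "x \<in> beta_span k \<Longrightarrow> - x \<in> beta_span k"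
    "x \<in> beta_span k \<Longrightarrow> scl c x \<in> beta_span k"
proof -
  have keys: "Poly_Mapping.keys (x + y) \<subseteq> {1..k}"
    if "Poly_Mapping.keys x \<subseteq> {1..k}" "Poly_Mapping.keys y \<subseteq> {1..k}"
    using Poly_Mapping.keys_add[of x y] that by blast
  show "x \<in> beta_span k \<Longrightarrow> y \<in> beta_span k \<Longrightarrow> x + y \<in> beta_span k"
    using keys by (simp add: beta_span_iff[OF assms] lookup_add sum.distrib)
  have "Poly_Mapping.keys (- x) = Poly_Mapping.keys x" by (auto simp: in_keys_iff)
  then show "x \<in> beta_span k \<Longrightarrow> - x \<in> beta_span k"
    by (simp add: beta_span_iff[OF assms] sum_negf)
  have "Poly_Mapping.keys (scl c x) \<subseteq> Poly_Mapping.keys x" by (auto simp: in_keys_iff lookup_scl)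
  then show "x \<in> beta_span k \<Longrightarrow> scl c x \<in> beta_span k"
    by (auto simp: beta_span_iff[OF assms] lookup_scl simp flip: sum_distrib_left)
  show "0 \<in> (beta_span k :: (nat \<Rightarrow>\<^sub>0 'a) set)" by (simp add: beta_span_iff[OF assms])
qed

lemma hh_closed: "0 \<in> hh k" "h \<in> hh k \<Longrightarrow> h' \<in> hh k \<Longrightarrow> h + h' \<in> hh k"
    "h \<in> hh k \<Longrightarrow> - h \<in> hh k" "h \<in> hh k \<Longrightarrow> scl c h \<in> hh k"
  if "k \<ge> 1"
  unfolding hh_def by (fact beta_span_closed[OF that])+

lemma N_lat_iff: "k \<ge> 1 \<Longrightarrow> x \<in> N_lat k \<longleftrightarrow>
    Poly_Mapping.keys x \<subseteq> {1..k} \<and> (\<Sum>i\<in>{1..k}. Poly_Mapping.lookup x i) = 0"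
  by (simp add: N_lat_def beta_span_iff)

lemma hh_iff: "k \<ge> 1 \<Longrightarrow> x \<in> hh k \<longleftrightarrow>
    Poly_Mapping.keys x \<subseteq> {1..k} \<and> (\<Sum>i\<in>{1..k}. Poly_Mapping.lookup x i) = 0"
  by (simp add: hh_def beta_span_iff)

lemma N_lat_closed: "0 \<in> N_lat k" "x \<in> N_lat k \<Longrightarrow> y \<in> N_lat k \<Longrightarrow> x + y \<in> N_lat k"
    "x \<in> N_lat k \<Longrightarrow> - x \<in> N_lat k"
  if "k \<ge> 1"
  unfolding N_lat_def by (fact beta_span_closed[OF that])+

lemma cvec_in_hh: "k \<ge> 1 \<Longrightarrow> x \<in> N_lat k \<Longrightarrow> cvec x \<in> hh k"
  by (auto simp: N_lat_iff hh_iff keys_cvec lookup_cvec simp flip: of_int_sum)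

lemma VN_closed: "0 \<in> VN k" "u \<in> VN k \<Longrightarrow> v \<in> VN k \<Longrightarrow> u + v \<in> VN k" "v \<in> VN k \<Longrightarrow> csc c v \<in> VN k"
  by (simp_all add: VN_def fock.span_zero fock.span_add fock.span_scale)

lemma VN_sum: "(\<And>x. x \<in> A \<Longrightarrow> f x \<in> VN k) \<Longrightarrow> (\<Sum>x\<in>A. f x) \<in> VN k"
  by (simp add: VN_def fock.span_sum)

text \<open>Generators are built one creation operator at a time, so that induction meets
  \<open>heis_hneg_commute\<close> and \<open>Y_op_hneg\<close> directly. Each generator has a
  single charge.\<close>

inductive_set VN_gen :: "nat \<Rightarrow> fock set" for k where
  evec: "\<gamma> \<in> N_lat k \<Longrightarrow> evec \<gamma> \<in> VN_gen k"
| hneg: "v \<in> VN_gen k \<Longrightarrow> h \<in> hh k \<Longrightarrow> n \<ge> 1 \<Longrightarrow> hneg h n * v \<in> VN_gen k"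

lemma VN_eq_span: "VN k = fock.span (VN_gen k)"
proof -
  have "(\<Prod>(h, n)\<leftarrow>hs. hneg h n) * evec \<gamma> \<in> VN_gen k"
    if "\<forall>(h, n)\<in>set hs. h \<in> hh k \<and> n \<ge> 1" "\<gamma> \<in> N_lat k" for hs \<gamma>
    using that by (induction hs) (auto simp: mult.assoc intro: VN_gen.intros)
  moreover have "\<exists>hs \<gamma>. v = (\<Prod>(h, n)\<leftarrow>hs. hneg h n) * evec \<gamma> \<and>
     (\<forall>(h, n)\<in>set hs. h \<in> hh k \<and> n \<ge> 1) \<and> \<gamma> \<in> N_lat k" if "v \<in> VN_gen k" for v
    using that
  proof induction
    case (evec \<gamma>)
    then show ?case by (intro exI[of _ "[]"] exI[of _ \<gamma>]) simp
  next
    case (hneg v h n)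
    then obtain hs \<gamma> where "v = (\<Prod>(h, n)\<leftarrow>hs. hneg h n) * evec \<gamma>"
      "\<forall>(h, n)\<in>set hs. h \<in> hh k \<and> n \<ge> 1" "\<gamma> \<in> N_lat k" by blast
    with hneg show ?case
      by (intro exI[of _ "(h, n) # hs"] exI[of _ \<gamma>]) (simp add: mult.assoc)
  qed
  ultimately have "{(\<Prod>(h, n)\<leftarrow>hs. hneg h n) * evec \<gamma> | hs \<gamma>.
        (\<forall>(h, n)\<in>set hs. h \<in> hh k \<and> n \<ge> 1) \<and> \<gamma> \<in> N_lat k} = VN_gen k"
    by blast
  then show ?thesis unfolding VN_def by simp
qed

lemma VN_gen_in_VN: "v \<in> VN_gen k \<Longrightarrow> v \<in> VN k"
  by (simp add: VN_eq_span fock.span_base)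

lemma VN_induct [consumes 1, case_names zero add csc gen]:
  assumes "v \<in> VN k" "P 0"
    "\<And>u v. u \<in> VN k \<Longrightarrow> v \<in> VN k \<Longrightarrow> P u \<Longrightarrow> P v \<Longrightarrow> P (u + v)"
    "\<And>c v. v \<in> VN k \<Longrightarrow> P v \<Longrightarrow> P (csc c v)"
    "\<And>v. v \<in> VN_gen k \<Longrightarrow> P v"
  shows "P v"
proof -
  have "v \<in> VN k \<and> P v"
    using assms(1) unfolding VN_eq_span
  proof (induction rule: fock.span_induct_alt)
    case base
    then show ?case using assms(2) by (simp add: fock.span_zero)
  next
    case (step c x y)
    then have "x \<in> VN k" "P x" "y \<in> VN k" "P y"
      using assms(5) VN_gen_in_VN by (auto simp: VN_eq_span)
    then have "csc c x + y \<in> VN k \<and> P (csc c x + y)"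
      by (simp add: VN_closed assms(3,4))
    then show ?case by (simp add: VN_eq_span)
  qed
  then show ?thesis ..
qed

lemma VN_induct' [consumes 1, case_names zero add csc evec hneg]:
  assumes "v \<in> VN k" "P 0"
    "\<And>u v. u \<in> VN k \<Longrightarrow> v \<in> VN k \<Longrightarrow> P u \<Longrightarrow> P v \<Longrightarrow> P (u + v)"
    "\<And>c v. v \<in> VN k \<Longrightarrow> P v \<Longrightarrow> P (csc c v)"
    "\<And>\<gamma>. \<gamma> \<in> N_lat k \<Longrightarrow> P (evec \<gamma>)"
    "\<And>v h n. v \<in> VN k \<Longrightarrow> h \<in> hh k \<Longrightarrow> n \<ge> 1 \<Longrightarrow> P v \<Longrightarrow> P (hneg h n * v)"
  shows "P v"
  using assms(1)
proof (induction rule: VN_induct)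
  case (gen v)
  then show ?case by induction (use assms VN_gen_in_VN in auto)
qed (use assms in auto)

lemma VN_hneg: "v \<in> VN k \<Longrightarrow> h \<in> hh k \<Longrightarrow> n \<ge> 1 \<Longrightarrow> hneg h n * v \<in> VN k"
  by (induction rule: VN_induct)
     (auto simp: VN_closed distrib_left csc_mult_right VN_gen_in_VN VN_gen.hneg)

lemma VN_heis: "v \<in> VN k \<Longrightarrow> h \<in> hh k \<Longrightarrow> heis h m v \<in> VN k"
proof (cases "m < 0")
  assume vh: "v \<in> VN k" "h \<in> hh k"
  case False
  show ?thesis using vh(1)
  proof (induction rule: VN_induct')
    case (evec \<gamma>)
    then show ?case using False
      by (cases "m = 0") (auto simp: heis_evec heis_zero_evec intro: VN_closed VN_gen_in_VN VN_gen.intros)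
  next
    case (hneg v h n)
    then show ?case using False by (simp add: heis_hneg_commute VN_closed VN_hneg)
  qed (auto simp: flinear_0[OF flinear_heis] flinear_add[OF flinear_heis] flinear_csc[OF flinear_heis] VN_closed)
qed (auto simp: heis_neg VN_hneg)

lemma VN_evec_mult: "v \<in> VN k \<Longrightarrow> \<alpha> \<in> N_lat k \<Longrightarrow> k \<ge> 1 \<Longrightarrow> evec \<alpha> * v \<in> VN k"
proof (induction rule: VN_induct')
  case (evec \<gamma>)
  then show ?case by (auto simp flip: evec_add intro!: VN_gen_in_VN VN_gen.intros N_lat_closed)
next
  case (hneg v h n)
  then show ?case using VN_hneg[of "evec \<alpha> * v" k h n] by (simp add: mult_ac)
qed (auto simp: distrib_left csc_mult_right VN_closed)

lemma VN_uminus: "v \<in> VN k \<Longrightarrow> - v \<in> VN k"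
  using VN_closed(3)[of v k "- 1"] by simp

lemma VN_exp_creation: "v \<in> VN k \<Longrightarrow> \<alpha> \<in> N_lat k \<Longrightarrow> k \<ge> 1 \<Longrightarrow> exp_creation \<alpha> j v \<in> VN k"
  and VN_exp_annihilation: "v \<in> VN k \<Longrightarrow> \<alpha> \<in> N_lat k \<Longrightarrow> k \<ge> 1 \<Longrightarrow> exp_annihilation \<alpha> j v \<in> VN k"
  unfolding exp_creation_def exp_annihilation_def
  by (rule exp_coeff_pred; simp add: VN_closed VN_uminus VN_heis cvec_in_hh)+

lemma hneg_charge: "has_charge \<gamma> v \<Longrightarrow> has_charge \<gamma> (hneg h n * v)"
proof (rule fock_pred_flinear[OF flinear_mult has_charge_closed])
  fix b assume "has_charge \<gamma> v" "b \<in> Poly_Mapping.keys v"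
  then have b: "snd b = \<gamma>" by (simp add: has_charge_def)
  have "hneg h n * bvec b = (\<Sum>i\<in>Poly_Mapping.keys h. csc (Poly_Mapping.lookup h i) (bvec (({#(i, n)#}, 0) + b)))"
    by (simp add: hneg_def sum_distrib_right csc_mult_left bvec_mult)
  moreover have "has_charge \<gamma> \<dots>"
    by (rule sum_closed[of "has_charge \<gamma>", OF has_charge_closed(1) has_charge_closed(2)], assumption+,
        rule has_charge_closed(3)) (simp add: b has_charge_def keys_bvec)
  ultimately show "has_charge \<gamma> (hneg h n * bvec b)" by simp
qed

lemma VN_gen_charge: "v \<in> VN_gen k \<Longrightarrow> \<exists>\<gamma>\<in>N_lat k. has_charge \<gamma> v"
proof (induction rule: VN_gen.induct)
  case (evec \<gamma>)
  then show ?case by (intro bexI[of _ \<gamma>]) (simp_all add: has_charge_def evec_def keys_bvec)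
qed (use hneg_charge in blast)

text \<open>On a generator, which has one charge, \<open>exp_field\<close> is a finite sum of
  operators that preserve V_N.\<close>

lemma VN_exp_field: "v \<in> VN k \<Longrightarrow> \<alpha> \<in> N_lat k \<Longrightarrow> k \<ge> 1 \<Longrightarrow> exp_field \<alpha> m v \<in> VN k"
proof (induction rule: VN_induct)
  case (gen v)
  obtain \<gamma> where \<gamma>: "has_charge \<gamma> v" using VN_gen_charge[OF gen(1)] by blast
  obtain J where J: "deg_le (int J) v" using deg_le_exists by blast
  have "evec \<alpha> * v \<in> VN k" using gen by (simp add: VN_evec_mult VN_gen_in_VN)
  then show ?case
    unfolding exp_field_charge[OF \<gamma> J] using gen
    by (intro VN_sum) (auto simp: Let_def VN_closed VN_exp_creation VN_exp_annihilation)
qed (auto simp: flinear_0[OF flinear_exp_field] flinear_add[OF flinear_exp_field] flinear_csc[OF flinear_exp_field] VN_closed)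

lemma VN_Y_op: "u \<in> VN k \<Longrightarrow> v \<in> VN k \<Longrightarrow> k \<ge> 1 \<Longrightarrow> Y_op u m v \<in> VN k"
proof (induction arbitrary: m v rule: VN_induct')
  case (evec \<gamma>)
  then show ?case by (simp add: Y_op_evec VN_exp_field)
next
  case (hneg u h n)
  then show ?case
    unfolding Y_op_hneg normal_product_def deriv_field_def
    by (intro Sum_any_pred[of "\<lambda>v. v \<in> VN k"]) (auto simp: VN_closed VN_heis)
qed (auto simp: flinear_0[OF flinear_Y_op_left] flinear_add[OF flinear_Y_op_left] flinear_csc[OF flinear_Y_op_left] VN_closed)

lemma evec_in_VN: "\<gamma> \<in> N_lat k \<Longrightarrow> evec \<gamma> \<in> VN k"
  by (intro VN_gen_in_VN VN_gen.intros)

section \<open>The conformal vector and the weight one space\<close>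

text \<open>Spans the orthogonal complement of \<hh> inside the span of \<alpha>_1, ...,
  \<alpha>_k.\<close>

definition delta :: "nat \<Rightarrow> (nat \<Rightarrow>\<^sub>0 complex)" where
  "delta k = (\<Sum>i\<in>{1..k}. alpha i)"

lemma ip_delta: "ip (delta k) h = 2 * (\<Sum>i\<in>{1..k}. Poly_Mapping.lookup h i)"
  by (subst ip_commute) (simp add: delta_def ip_sum_right ip_alpha sum_distrib_left)

lemma lookup_delta: "Poly_Mapping.lookup (delta k) i = (if i \<in> {1..k} then 1 else 0)"
  by (simp add: delta_def lookup_sum alpha_def lookup_single when_def)

lemma ip_delta_hh: "k \<ge> 1 \<Longrightarrow> h \<in> hh k \<Longrightarrow> ip (delta k) h = 0"
  by (simp add: ip_delta hh_iff)

text \<open>The direction orthogonal to \<open>\<hh>\<close> acts trivially, so on \<open>VN\<close> every \<open>\<alpha>\<^sub>i(m)\<close> with \<open>m \<ge> 0\<close>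
  coincides with the mode of the projection of \<open>\<alpha>\<^sub>i\<close> to \<open>\<hh>\<close>.\<close>

lemma heis_delta_VN:
  assumes k: "k \<ge> 1" and m: "m \<ge> 0" and v: "v \<in> VN k"
  shows "heis (delta k) m v = 0"
  using v
proof (induction rule: VN_induct')
  case (evec \<gamma>)
  then show ?case using m k ip_delta_hh[OF k cvec_in_hh[OF k evec]]
    by (cases "m = 0") (auto simp: heis_evec heis_zero_evec)
next
  case (hneg v h n)
  then show ?case using m k by (simp add: heis_hneg_commute ip_delta_hh)
qed (simp_all add: flinear_0[OF flinear_heis] flinear_add[OF flinear_heis] flinear_csc[OF flinear_heis])

text \<open>This is the orthogonal projection of \<alpha>_i: the coefficient is \<langle>\<delta>,
  \<alpha>_i\<rangle> / \<langle>\<delta>, \<delta>\<rangle> = 2 / (2k).\<close>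

lemma alpha_proj_hh: "k \<ge> 1 \<Longrightarrow> i \<in> {1..k} \<Longrightarrow> alpha i - scl (1 / of_nat k) (delta k) \<in> hh k"
proof -
  assume k: "k \<ge> 1" "i \<in> {1..k}"
  let ?h = "alpha i - scl (1 / of_nat k) (delta k) :: nat \<Rightarrow>\<^sub>0 complex"
  have l: "Poly_Mapping.lookup ?h j = (if j = i then 1 else 0) - (if j \<in> {1..k} then 1 / of_nat k else 0)" for j
    by (simp add: lookup_minus lookup_scl lookup_delta alpha_def lookup_single when_def)
  have "(\<Sum>j\<in>{1..k}. Poly_Mapping.lookup ?h j) =
      (\<Sum>j\<in>{1..k}. if j = i then 1 else 0) - (\<Sum>j\<in>{1..k}. 1 / of_nat k :: complex)"
    unfolding sum_subtractf[symmetric] by (rule sum.cong) (simp_all add: l)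
  also have "\<dots> = 0" using k by simp
  finally have "(\<Sum>j\<in>{1..k}. Poly_Mapping.lookup ?h j) = 0" .
  moreover have "Poly_Mapping.keys ?h \<subseteq> {1..k}"
    using k by (auto simp: in_keys_iff l split: if_splits)
  ultimately show ?thesis using k by (simp add: hh_iff)
qed

lemma heis_alpha_VN:
  assumes "k \<ge> 1" "m \<ge> 0" "v \<in> VN k"
  shows "heis (alpha i) m v = heis (alpha i - scl (1 / of_nat k) (delta k)) m v"
proof -
  have "heis (alpha i) m v = heis ((alpha i - scl (1 / of_nat k) (delta k)) + scl (1 / of_nat k) (delta k)) m v"
    by simp
  also have "\<dots> = heis (alpha i - scl (1 / of_nat k) (delta k)) m v"
    by (simp only: heis_add heis_scl heis_delta_VN[OF assms] fock.scale_zero_right add_0_right)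
  finally show ?thesis .
qed

section \<open>A symmetric formula for the conformal vector and the weight operator\<close>

lemma csc_square: "(u + csc c v) * (u + csc c v) = u * u + csc (2 * c) (u * v) + csc (c * c) (v * v)"
proof -
  have "(u + csc c v) * (u + csc c v) = u * u + (csc c (u * v) + csc c (v * u)) + csc (c * c) (v * v)"
    unfolding distrib_left distrib_right csc_mult_left csc_mult_right fock.scale_scale fock.scale_right_distrib
    by (simp only: add_ac)
  then show ?thesis unfolding mult.commute[of v u] mult_2 fock.scale_left_distrib .
qed

lemma lookup_bvec: "Poly_Mapping.lookup (bvec b) b' = (if b = b' then 1 else 0)"
  by (simp add: bvec_def lookup_single when_def)

text \<open>The arithmetic of the induction step in \<open>omega_eq\<close>, with x = k and y = k +
  1: the coefficients of the square of \<delta>_k(-1), of the mixed product, and of the square of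
  \<alpha>_{k+1}(-1).\<close>

lemma omega_coefficients:
  fixes x y :: complex
  assumes "x \<noteq> 0" "y \<noteq> 0" "y = 1 + x"
  shows "1 / (2 * x * y) - 1 / (2 * x) = - 1 / (2 * y)" "- 2 * x / (2 * x * y) = - 1 / y"
    "x * x / (2 * x * y) = 1 / 2 - 1 / (2 * y)"
proof -
  show "1 / (2 * x * y) - 1 / (2 * x) = - 1 / (2 * y)"
    using assms(1,2) by (simp add: divide_simps) (simp add: assms(3) algebra_simps)
  show "- 2 * x / (2 * x * y) = - 1 / y"
    using assms(1,2) by (simp add: divide_simps)
  show "x * x / (2 * x * y) = 1 / 2 - 1 / (2 * y)"
    using assms(1,2) by (simp add: divide_simps) (simp add: assms(3) algebra_simps)
qed

text \<open>Half the sum of squares over an orthonormal basis of \<hh> equals that for the full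
  k-dimensional span minus that for the line of \<delta>. The constants come from
  \<langle>\<alpha>_i, \<alpha>_i\<rangle> = 2 and \<langle>\<delta>, \<delta>\<rangle> = 2k. In
  this form invariance under permutations of the \<alpha>_i is visible.\<close>

lemma omega_eq:
  assumes "k \<ge> 1"
  shows "omega k = csc (1 / 4) ((\<Sum>i\<in>{1..k}. hneg (alpha i) 1 * hneg (alpha i) 1) -
    csc (1 / of_nat k) (hneg (delta k) 1 * hneg (delta k) 1))"
proof -
  have "(\<Sum>j\<in>{1..k-1}. hneg (onb j) 1 * hneg (onb j) 1) =
    csc (1 / 2) ((\<Sum>i\<in>{1..k}. hneg (alpha i) 1 * hneg (alpha i) 1) -
    csc (1 / of_nat k) (hneg (delta k) 1 * hneg (delta k) 1))"
    using assms
  proof (induction k rule: dec_induct)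
    case base
    then show ?case by (simp add: delta_def)
  next
    case (step k)
    let ?A = "hneg (delta k) 1" and ?a = "hneg (alpha (Suc k)) 1"
    let ?s = "complex_of_real (sqrt (2 * real k * (real k + 1)))"
    have k0: "(of_nat k :: complex) \<noteq> 0" "(1 + of_nat k :: complex) \<noteq> 0"
      using step by (simp_all flip: of_nat_Suc)
    \<comment> \<open>This is the norm 2(k + k^2) of \<alpha>_1 + ... + \<alpha>_k - k
      \<alpha>_{k+1}.\<close>
    have s: "?s * ?s = 2 * of_nat k * (1 + of_nat k)"
      unfolding of_real_mult[symmetric] by (simp add: algebra_simps)
    have "onb k = scl (1 / ?s) (delta k + scl (- of_nat k) (alpha (Suc k)))"
      unfolding onb_def delta_def
      by (rule poly_mapping_eqI) (simp add: lookup_scl lookup_minus lookup_add)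
    then have "hneg (onb k) 1 = csc (1 / ?s) (?A + csc (- of_nat k) ?a)"
      by (simp only: hneg_scl hneg_add)
    then have "hneg (onb k) 1 * hneg (onb k) 1 =
        csc (1 / (?s * ?s)) ((?A + csc (- of_nat k) ?a) * (?A + csc (- of_nat k) ?a))"
      by (simp add: csc_mult_left csc_mult_right)
    also have "(?A + csc (- of_nat k) ?a) * (?A + csc (- of_nat k) ?a) =
        ?A * ?A + csc (- 2 * of_nat k) (?A * ?a) + csc (of_nat k * of_nat k) (?a * ?a)"
      unfolding csc_square by simp
    finally have onb: "hneg (onb k) 1 * hneg (onb k) 1 =
        csc (1 / (?s * ?s)) (?A * ?A) + csc (- 2 * of_nat k / (?s * ?s)) (?A * ?a) +
        csc (of_nat k * of_nat k / (?s * ?s)) (?a * ?a)"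
      by (simp add: fock.scale_right_distrib fock.scale_right_diff_distrib)
    have "delta (Suc k) = delta k + alpha (Suc k)" by (simp add: delta_def)
    then have D: "hneg (delta (Suc k)) 1 * hneg (delta (Suc k)) 1 = ?A * ?A + csc 2 (?A * ?a) + ?a * ?a"
      by (simp add: hneg_add csc_def algebra_simps)
    have set: "{1..Suc k - 1} = insert k {1..k-1}" using step by auto
    have "k \<notin> {1..k-1}" using step by auto
    then have "(\<Sum>j\<in>{1..Suc k - 1}. hneg (onb j) 1 * hneg (onb j) 1) =
      hneg (onb k) 1 * hneg (onb k) 1 + (\<Sum>j\<in>{1..k-1}. hneg (onb j) 1 * hneg (onb j) 1)"
      unfolding set by (subst sum.insert) auto
    also have "\<dots> =
        csc (1 / 2) (\<Sum>i\<in>{1..k}. hneg (alpha i) 1 * hneg (alpha i) 1) +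
        (csc (1 / (?s * ?s) - 1 / (2 * of_nat k)) (?A * ?A) + csc (- 2 * of_nat k / (?s * ?s)) (?A * ?a) +
        csc (of_nat k * of_nat k / (?s * ?s)) (?a * ?a))"
      unfolding onb step.IH
      by (simp add: fock.scale_right_diff_distrib fock.scale_left_diff_distrib)
    also have "1 / (?s * ?s) - 1 / (2 * of_nat k) = - 1 / (2 * (1 + of_nat k))"
      unfolding s by (rule omega_coefficients[OF k0 refl])
    also have "- 2 * of_nat k / (?s * ?s) = - 1 / (1 + of_nat k)"
      unfolding s by (rule omega_coefficients[OF k0 refl])
    also have "of_nat k * of_nat k / (?s * ?s) = 1 / 2 - 1 / (2 * (1 + of_nat k))"
      unfolding s by (rule omega_coefficients[OF k0 refl])
    finally show ?case
      unfolding D by (simp add: fock.scale_right_distrib fock.scale_right_diff_distrib fock.scale_left_diff_distrib)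
  qed
  then show ?thesis by (simp add: omega_def)
qed

text \<open>Mode 1 is the one that measures weight: its index m - l - 1 becomes -l, so h(l) is
  paired with h(-l).\<close>

lemma Y_op_hneg_square: "Y_op (hneg h 1 * hneg h 1) 1 v =
    Sum_any (\<lambda>l. if l < 0 then heis h l (heis h (- l) v) else heis h (- l) (heis h l v))"
proof -
  have "Y_op (hneg h 1) = heis h" by (intro ext) (rule Y_op_hneg_1)
  then show ?thesis
    by (simp add: Y_op_hneg normal_product_def deriv_field_def cong: if_cong)
qed

text \<open>A necessary condition on the monomials occurring in elements of V_N. The monomials
  themselves need not lie in V_N; \<alpha>_1(-1) is an example.\<close>

definition supported :: "nat \<Rightarrow> basis \<Rightarrow> bool" where
  "supported k b \<longleftrightarrow> set_mset (fst b) \<subseteq> {1..k} \<times> {1..} \<and> snd b \<in> N_lat k"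

lemma VN_keys: "v \<in> VN k \<Longrightarrow> b \<in> Poly_Mapping.keys v \<Longrightarrow> supported k b" if k: "k \<ge> 1"
proof -
  define Q where "Q v \<longleftrightarrow> (\<forall>b\<in>Poly_Mapping.keys v. supported k b)" for v :: fock
  have Q: "Q 0" "Q u \<Longrightarrow> Q v \<Longrightarrow> Q (u + v)" "Q v \<Longrightarrow> Q (csc c v)" for u v c
    using Poly_Mapping.keys_add[of u v] keys_csc[of c v] unfolding Q_def by auto
  have "Q v" if "v \<in> VN k" for v
    using that
  proof (induction rule: VN_induct')
    case (evec \<gamma>)
    then show ?case by (simp add: Q_def evec_def keys_bvec supported_def)
  next
    case (hneg v h n)
    show ?case
    proof (rule fock_pred_flinear[OF flinear_mult Q])
      fix b assume "b \<in> Poly_Mapping.keys v"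
      then have b: "supported k b" using hneg by (simp add: Q_def)
      have "Poly_Mapping.keys h \<subseteq> {1..k}" using hneg k by (simp add: hh_iff)
      then have "Q (\<Sum>i\<in>Poly_Mapping.keys h. csc (Poly_Mapping.lookup h i) (bvec (({#(i, n)#}, 0) + b)))"
        using b hneg(3)
        by (intro sum_closed[of Q, OF Q(1) Q(2)] Q(3))
           (auto simp: Q_def keys_bvec supported_def)
      then show "Q (hneg h n * bvec b)"
        by (simp add: hneg_def sum_distrib_right csc_mult_left bvec_mult)
    qed
  qed (use Q in auto)
  then show "v \<in> VN k \<Longrightarrow> b \<in> Poly_Mapping.keys v \<Longrightarrow> supported k b"
    by (auto simp: Q_def)
qed

lemma sum_count_mult:
  assumes "finite S" "set_mset M \<subseteq> S"
  shows "(\<Sum>p\<in>S. count M p * f p) = (\<Sum>p\<in>#M. f p)"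
  using assms(2)
proof (induction M)
  case (add x M)
  have "(\<Sum>p\<in>S. count (add_mset x M) p * f p) = (\<Sum>p\<in>S. count M p * f p + (if p = x then f p else 0))"
    by (rule sum.cong) auto
  also have "\<dots> = (\<Sum>p\<in>S. count M p * f p) + f x"
    using add assms(1) by (simp add: sum.distrib)
  finally show ?case using add by simp
qed simp

text \<open>A normally ordered pair removes an oscillator and restores the same one, so it acts
  diagonally; for l = 0 it is the square of the eigenvalue \<langle>\<alpha>_i, \<gamma>\<rangle> =
  2 \<gamma>_i.\<close>

lemma heis_alpha_square_bvec:
  assumes b: "supported k b"
  shows "(if l < 0 then heis (alpha i) l (heis (alpha i) (- l) (bvec b))
    else heis (alpha i) (- l) (heis (alpha i) l (bvec b))) =
    csc (if l = 0 then 4 * of_int (Poly_Mapping.lookup (snd b) i ^ 2)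
      else 2 * of_nat (count (fst b) (i, nat \<bar>l\<bar>)) * of_int \<bar>l\<bar>) (bvec b)"
proof -
  obtain M \<gamma> where M: "b = (M, \<gamma>)" by (cases b)
  note csc = flinear_csc[OF flinear_heis]
  have "csc (2 * of_nat (count M p) * c) (bvec ({#p#} + (M - {#p#}), \<gamma>)) =
      csc (2 * of_nat (count M p) * c) (bvec (M, \<gamma>))" for p c
    by (cases "p \<in># M") (simp_all add: not_in_iff)
  note pos = this
  have m: "heis (alpha i) (- l) (heis (alpha i) l (bvec b)) =
     csc (2 * of_nat (count M (i, nat l)) * of_int l) (bvec b)" if "l > 0" for l
    using that pos[of "(i, nat l)" "of_int l"]
    by (simp add: M heis_alpha_pos csc heis_neg hneg_alpha bvec_mult)
  consider "l < 0" | "l = 0" | "l > 0" by linarith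
  then show ?thesis
  proof cases
    case 1
    then show ?thesis using m[of "- l"] by (simp add: M)
  next
    case 2
    then show ?thesis
      by (simp add: M heis_zero_bvec csc ip_alpha_left lookup_cvec power2_eq_square mult_ac)
  next
    case 3
    then show ?thesis using m[of l] by (simp add: M)
  qed
qed

lemma omega_alpha_bvec:
  assumes b: "supported k b"
  shows "(\<Sum>i\<in>{1..k}. Y_op (hneg (alpha i) 1 * hneg (alpha i) 1) 1 (bvec b)) =
    csc (4 * of_int (int (deg b) + (\<Sum>i\<in>{1..k}. Poly_Mapping.lookup (snd b) i ^ 2))) (bvec b)"
proof -
  define D where "D = int (deg b)"
  define c :: "nat \<Rightarrow> int \<Rightarrow> complex" where "c i l = (if l = 0 then 4 * of_int (Poly_Mapping.lookup (snd b) i ^ 2)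
      else 2 * of_nat (count (fst b) (i, nat \<bar>l\<bar>)) * of_int \<bar>l\<bar>)" for i l
  have cD: "c i l = 0" if "l \<notin> {-D..D}" for i l
  proof -
    have "(i, nat \<bar>l\<bar>) \<notin># fst b"
      using that snd_le_deg[of i "nat \<bar>l\<bar>" "fst b" "snd b"] unfolding D_def by auto
    then show ?thesis using that by (auto simp: c_def not_in_iff D_def)
  qed
  have Y: "Y_op (hneg (alpha i) 1 * hneg (alpha i) 1) 1 (bvec b) = csc (\<Sum>l\<in>{-D..D}. c i l) (bvec b)" for i
  proof -
    have "Y_op (hneg (alpha i) 1 * hneg (alpha i) 1) 1 (bvec b) = Sum_any (\<lambda>l. csc (c i l) (bvec b))"
      unfolding Y_op_hneg_square heis_alpha_square_bvec[OF b] c_def ..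
    also have "\<dots> = (\<Sum>l\<in>{-D..D}. csc (c i l) (bvec b))"
    proof (rule Sum_any.expand_superset, simp, rule subsetI, rule ccontr)
      fix l assume "l \<in> {l. csc (c i l) (bvec b) \<noteq> 0}" "l \<notin> {-D..D}"
      with cD[of l i] show False by simp
    qed
    finally show ?thesis by (simp add: fock.scale_sum_left)
  qed
  have c: "(\<Sum>l\<in>{-D..D}. c i l) = 4 * of_int (Poly_Mapping.lookup (snd b) i ^ 2) +
      4 * (\<Sum>n\<in>{1..deg b}. of_nat (count (fst b) (i, n) * n))" for i
  proof -
    have "{-D..D} = insert 0 ({-D..-1} \<union> {1..D})" unfolding D_def by auto
    then have "(\<Sum>l\<in>{-D..D}. c i l) = c i 0 + ((\<Sum>l\<in>{-D..-1}. c i l) + (\<Sum>l\<in>{1..D}. c i l))"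
      by (simp, subst sum.union_disjoint) auto
    \<comment> \<open>Normal ordering makes the terms for l and -l equal. The doubling produces the
      common factor 4 that cancels the 1/4 in \<open>omega_eq\<close>.\<close>
    also have "(\<Sum>l\<in>{-D..-1}. c i l) = (\<Sum>l\<in>{1..D}. c i l)"
      by (rule sum.reindex_bij_witness[of _ uminus uminus]) (auto simp: c_def)
    also have "(\<Sum>l\<in>{1..D}. c i l) = (\<Sum>n\<in>{1..deg b}. 2 * of_nat (count (fst b) (i, n) * n))"
      by (rule sum.reindex_bij_witness[of _ int nat]) (auto simp: c_def D_def)
    finally show ?thesis by (simp add: c_def sum_distrib_left)
  qed
  have "(\<Sum>i\<in>{1..k}. \<Sum>n\<in>{1..deg b}. count (fst b) (i, n) * n) =
      (\<Sum>p\<in>{1..k} \<times> {1..deg b}. count (fst b) p * snd p)"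
    by (simp add: sum.cartesian_product case_prod_beta)
  also have "\<dots> = deg b"
  proof -
    have "set_mset (fst b) \<subseteq> {1..k} \<times> {1..deg b}"
      using b snd_le_deg[of _ _ "fst b" "snd b"] by (fastforce simp: supported_def)
    then show ?thesis by (simp add: sum_count_mult deg_def)
  qed
  finally have deg: "(\<Sum>i\<in>{1..k}. \<Sum>n\<in>{1..deg b}. of_nat (count (fst b) (i, n) * n)) = (of_nat (deg b) :: complex)"
    by (metis (mono_tags, lifting) of_nat_sum sum.cong)
  show ?thesis
    unfolding Y fock.scale_sum_left[symmetric] c sum.distrib sum_distrib_left[symmetric] deg
    by (simp add: algebra_simps)
qed

text \<open>The conformal weight: the sum of squares is \<langle>\<gamma>, \<gamma>\<rangle> / 2 for
  a charge \<gamma> supported on 1, ..., k.\<close>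

definition weight :: "nat \<Rightarrow> basis \<Rightarrow> int" where
  "weight k b = int (deg b) + (\<Sum>i\<in>{1..k}. Poly_Mapping.lookup (snd b) i ^ 2)"

text \<open>The \<delta> part of \<open>omega_eq\<close> acts as 0 on V_N, and what remains is
  diagonal. The statement is about coefficients because the monomials of v may lie outside
  V_N.\<close>

lemma lookup_omega_mode:
  assumes k: "k \<ge> 1" and v: "v \<in> VN k"
  shows "Poly_Mapping.lookup (Y_op (omega k) 1 v) b = of_int (weight k b) * Poly_Mapping.lookup v b"
proof -
  let ?D = "hneg (delta k) 1 * hneg (delta k) 1" and ?a = "\<lambda>i. hneg (alpha i) 1 * hneg (alpha i) 1"
  have D: "Y_op ?D 1 v = 0"
    unfolding Y_op_hneg_square
    using heis_delta_VN[OF k _ v] by (simp add: flinear_0[OF flinear_heis] cong: if_cong)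
  have "Y_op (omega k) 1 v = csc (1 / 4) (\<Sum>i\<in>{1..k}. Y_op (?a i) 1 v)"
    unfolding omega_eq[OF k]
    by (simp only: flinear_csc[OF flinear_Y_op_left] flinear_minus[OF flinear_Y_op_left]
        flinear_sum[OF flinear_Y_op_left] D) simp
  also have "\<dots> = (\<Sum>b\<in>Poly_Mapping.keys v. csc (Poly_Mapping.lookup v b)
      (csc (1 / 4) (\<Sum>i\<in>{1..k}. Y_op (?a i) 1 (bvec b))))"
  proof -
    have "flinear (\<lambda>v. csc (1 / 4) (\<Sum>i\<in>{1..k}. Y_op (?a i) 1 v))"
      by (rule flinear_compose[OF flinear_scale], rule flinear_sum_fun, rule flinear_Y_op)
    note lin = this
    show ?thesis
      using arg_cong[OF fock_expand[of v], of "\<lambda>v. csc (1 / 4) (\<Sum>i\<in>{1..k}. Y_op (?a i) 1 v)"]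
      by (simp only: flinear_sum[OF lin] flinear_csc[OF lin])
  qed
  also have "\<dots> = (\<Sum>b\<in>Poly_Mapping.keys v. csc (of_int (weight k b) * Poly_Mapping.lookup v b) (bvec b))"
  proof (rule sum.cong[OF refl])
    fix b assume "b \<in> Poly_Mapping.keys v"
    note b = VN_keys[OF k v this]
    show "csc (Poly_Mapping.lookup v b) (csc (1 / 4) (\<Sum>i\<in>{1..k}. Y_op (?a i) 1 (bvec b))) =
      csc (of_int (weight k b) * Poly_Mapping.lookup v b) (bvec b)"
      unfolding omega_alpha_bvec[OF b] weight_def[symmetric] fock.scale_scale by (simp add: mult_ac)
  qed
  finally show ?thesis
    by (simp add: lookup_sum lookup_csc lookup_bvec if_distrib in_keys_iff cong: if_cong)
qed

text \<open>Coordinate sum 0 forces a second nonzero integer coordinate; together the two already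
  contribute 2.\<close>

lemma N_lat_norm:
  assumes k: "k \<ge> 1" and x: "x \<in> N_lat k" "x \<noteq> 0"
  shows "(\<Sum>i\<in>{1..k}. Poly_Mapping.lookup x i ^ 2) \<ge> 2"
proof -
  have xk: "Poly_Mapping.keys x \<subseteq> {1..k}" and s: "(\<Sum>i\<in>{1..k}. Poly_Mapping.lookup x i) = 0"
    using x k by (auto simp: N_lat_iff)
  obtain i where i: "i \<in> Poly_Mapping.keys x" using x(2) by fastforce
  then have ik: "i \<in> {1..k}" "Poly_Mapping.lookup x i \<noteq> 0" using xk by (auto simp: in_keys_iff)
  have "(\<Sum>j\<in>{1..k} - {i}. Poly_Mapping.lookup x j) \<noteq> 0"
    using s ik sum.remove[of "{1..k}" i "Poly_Mapping.lookup x"] by simp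
  then obtain j where j: "j \<in> {1..k} - {i}" "Poly_Mapping.lookup x j \<noteq> 0"
    by (metis sum.neutral)
  have sq: "(y::int)\<^sup>2 \<ge> 1" if "y \<noteq> 0" for y
    using that zero_less_power2[of y] by linarith
  have "(\<Sum>l\<in>{i, j}. Poly_Mapping.lookup x l ^ 2) \<le> (\<Sum>l\<in>{1..k}. Poly_Mapping.lookup x l ^ 2)"
    by (rule sum_mono2) (use ik j in auto)
  moreover have "(\<Sum>l\<in>{i, j}. Poly_Mapping.lookup x l ^ 2) \<ge> 1 + 1"
    using sq[OF ik(2)] sq[OF j(2)] j by simp
  ultimately show ?thesis by linarith
qed

lemma weight_one:
  assumes k: "k \<ge> 1" and b: "supported k b" "weight k b = 1"
  shows "\<exists>i\<in>{1..k}. b = ({#(i, 1)#}, 0)"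
proof -
  have g0: "snd b = 0"
  proof (rule ccontr)
    assume "snd b \<noteq> 0"
    then have "(\<Sum>i\<in>{1..k}. Poly_Mapping.lookup (snd b) i ^ 2) \<ge> 2"
      using N_lat_norm[OF k] b by (simp add: supported_def)
    with b(2) show False by (simp add: weight_def)
  qed
  with b(2) have d: "deg b = 1" by (simp add: weight_def)
  then have "fst b \<noteq> {#}" by (auto simp: deg_def)
  then obtain p M where M: "fst b = add_mset p M" by (metis multiset_cases)
  have p: "fst p \<in> {1..k}" "snd p \<ge> 1" using b(1) M by (auto simp: supported_def)
  have s: "snd p + deg (M, 0) = 1" using d M by (simp add: deg_def)
  with p have "deg (M, 0) = 0" "snd p = 1" by auto
  moreover have "M = {#}"
  proof (rule ccontr)
    assume "M \<noteq> {#}"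
    then obtain q where q: "q \<in># M" by blast
    then have "snd q \<ge> 1" using b(1) M by (auto simp: supported_def)
    moreover have "snd q \<le> deg (M, 0)" using q snd_le_deg[of "fst q" "snd q" M 0] by simp
    ultimately show False using \<open>deg (M, 0) = 0\<close> by simp
  qed
  ultimately have "b = ({#(fst p, 1)#}, 0)" using M g0 by (metis prod.collapse)
  with p show ?thesis by blast
qed

text \<open>Describes the vectors h(-1)1 with h in \<hh> by an equation in \<open>omega\<close>
  alone, hence one that automorphisms respect.\<close>

lemma weight_one_space:
  assumes k: "k \<ge> 1" and v: "v \<in> VN k"
  shows "Y_op (omega k) 1 v = v \<longleftrightarrow> (\<exists>h\<in>hh k. v = hneg h 1)"
proof
  assume eq: "Y_op (omega k) 1 v = v"
  have keys: "\<exists>i\<in>{1..k}. b = ({#(i, 1)#}, 0)" if "b \<in> Poly_Mapping.keys v" for b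
  proof -
    have "of_int (weight k b) * Poly_Mapping.lookup v b = Poly_Mapping.lookup v b"
      using lookup_omega_mode[OF k v, of b] eq by simp
    then have "weight k b = 1" using that by (simp add: in_keys_iff)
    then show ?thesis using weight_one[OF k VN_keys[OF k v that]] by blast
  qed
  define e :: "nat \<Rightarrow> basis" where "e i = ({#(i, 1)#}, 0)" for i
  have inj: "inj_on e A" for A by (auto simp: inj_on_def e_def)
  define h where "h = (\<Sum>i\<in>{1..k}. Poly_Mapping.single i (Poly_Mapping.lookup v (e i)))"
  have l: "Poly_Mapping.lookup h i = (if i \<in> {1..k} then Poly_Mapping.lookup v (e i) else 0)" for i
    by (simp add: h_def lookup_sum lookup_single when_def)
  have hk: "Poly_Mapping.keys h \<subseteq> {1..k}" by (auto simp: in_keys_iff l split: if_splits)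
  have "v = (\<Sum>b\<in>e ` {1..k}. csc (Poly_Mapping.lookup v b) (bvec b))"
    using fock_expand[of v] keys
    by (subst (asm) sum.mono_neutral_left[of "e ` {1..k}"]) (auto simp: e_def in_keys_iff)
  also have "\<dots> = (\<Sum>i\<in>{1..k}. csc (Poly_Mapping.lookup v (e i)) (bvec (e i)))"
    by (simp add: sum.reindex[OF inj])
  also have "\<dots> = hneg h 1"
    unfolding hneg_superset[OF _ hk, simplified]
    by (rule sum.cong) (auto simp: l e_def)
  finally have vh: "v = hneg h 1" .
  \<comment> \<open>Weight one only shows that h is a combination of the \<alpha>_i. The mode
    \<delta>(1) turns h(-1)1 into \<langle>\<delta>, h\<rangle> 1 and so detects any component
    outside \<hh>.\<close>
  have "heis (delta k) 1 (hneg h 1 * 1) = csc (ip (delta k) h) 1"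
    using heis_hneg_commute[of 1 1 "delta k" h 1] heis_evec[of 1 "delta k" 0] by (simp add: evec_0)
  moreover have "heis (delta k) 1 v = 0" by (rule heis_delta_VN[OF k _ v]) simp
  ultimately have "csc (ip (delta k) h) 1 = 0" using vh by simp
  then have "ip (delta k) h = 0" by simp
  then have "h \<in> hh k" using hk k by (simp add: ip_delta hh_iff)
  with vh show "\<exists>h\<in>hh k. v = hneg h 1" by blast
next
  assume "\<exists>h\<in>hh k. v = hneg h 1"
  then obtain h where h: "h \<in> hh k" "v = hneg h 1" by blast
  show "Y_op (omega k) 1 v = v"
  proof (rule poly_mapping_eqI)
    fix b
    show "Poly_Mapping.lookup (Y_op (omega k) 1 v) b = Poly_Mapping.lookup v b"
    proof (cases "b \<in> Poly_Mapping.keys v")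
      case True
      have "Poly_Mapping.lookup v b = (\<Sum>i\<in>Poly_Mapping.keys h. Poly_Mapping.lookup h i *
          (if b = ({#(i, 1)#}, 0) then 1 else 0))"
        unfolding h(2) hneg_def by (simp add: lookup_sum lookup_csc lookup_bvec eq_commute)
      then have "\<exists>i. b = ({#(i, 1)#}, 0)"
      proof (rule contrapos_pp)
        assume "\<nexists>i. b = ({#(i, 1)#}, 0)"
        then have "(\<Sum>i\<in>Poly_Mapping.keys h. Poly_Mapping.lookup h i *
          (if b = ({#(i, 1)#}, 0) then 1 else 0)) = 0" by (intro sum.neutral) simp
        with True show "Poly_Mapping.lookup v b \<noteq> (\<Sum>i\<in>Poly_Mapping.keys h. Poly_Mapping.lookup h i *
          (if b = ({#(i, 1)#}, 0) then 1 else 0))" by (simp only: in_keys_iff not_False_eq_True)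
      qed
      then have "weight k b = 1" by (auto simp: weight_def deg_def)
      then show ?thesis by (simp add: lookup_omega_mode[OF k v])
    next
      case False
      then show ?thesis by (simp add: lookup_omega_mode[OF k v] in_keys_iff)
    qed
  qed
qed

text \<open>Exactly one monomial is sent to a multiple of (M, \<gamma>), namely the one with (i, n)
  added. So vanishing of \<alpha>_i(n) v kills every coefficient of v whose monomial contains (i,
  n).\<close>

lemma lookup_heis_alpha:
  assumes "n \<ge> 1"
  shows "Poly_Mapping.lookup (heis (alpha i) (int n) v) (M, \<gamma>) =
    2 * of_nat n * of_nat (Suc (count M (i, n))) * Poly_Mapping.lookup v (add_mset (i, n) M, \<gamma>)"
proof -
  let ?P = "\<lambda>v. Poly_Mapping.lookup (heis (alpha i) (int n) v) (M, \<gamma>) =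
    2 * of_nat n * of_nat (Suc (count M (i, n))) * Poly_Mapping.lookup v (add_mset (i, n) M, \<gamma>)"
  show "?P v"
  proof (rule fock_pred_flinear[OF flinear_id, of ?P])
    fix b :: basis
    obtain M' \<gamma>' where b: "b = (M', \<gamma>')" by (cases b)
    show "?P (bvec b)"
    proof (cases "(i, n) \<in># M'")
      case True
      then have "M' - {#(i, n)#} = M \<longleftrightarrow> M' = add_mset (i, n) M" by (auto dest: multi_member_split)
      then show ?thesis using assms
        by (auto simp: b heis_alpha_pos lookup_csc lookup_bvec)
    next
      case False
      then have "M' \<noteq> add_mset (i, n) M" by auto
      with False show ?thesis using assms
        by (auto simp: b heis_alpha_pos lookup_csc lookup_bvec not_in_iff)
    qed
  qed (simp_all add: flinear_0[OF flinear_heis] flinear_add[OF flinear_heis] flinear_csc[OF flinear_heis]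
    lookup_add lookup_csc algebra_simps)
qed

lemma lookup_heis_alpha_zero:
  "Poly_Mapping.lookup (heis (alpha i) 0 v) b =
    2 * of_int (Poly_Mapping.lookup (snd b) i) * Poly_Mapping.lookup v b"
proof -
  let ?P = "\<lambda>v. Poly_Mapping.lookup (heis (alpha i) 0 v) b =
    2 * of_int (Poly_Mapping.lookup (snd b) i) * Poly_Mapping.lookup v b"
  show "?P v"
    by (rule fock_pred_flinear[OF flinear_id, of ?P])
       (simp_all add: flinear_0[OF flinear_heis] flinear_add[OF flinear_heis] flinear_csc[OF flinear_heis]
         lookup_add lookup_csc algebra_simps heis_zero_bvec ip_alpha_left lookup_cvec lookup_bvec)
qed

text \<open>Positive modes exclude all oscillators, and the eigenvalues 2 \<gamma>_i of the
  \<alpha>_i(0) separate charges. The assumptions concern \<hh> only; \<open>heis_alpha_VN\<close>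
  passes from the projection of \<alpha>_i to \<alpha>_i itself.\<close>

lemma highest_weight_vector:
  assumes k: "k \<ge> 1" and v: "v \<in> VN k" "v \<noteq> 0"
    and pos: "\<And>h m. h \<in> hh k \<Longrightarrow> m > 0 \<Longrightarrow> heis h m v = 0"
    and zero: "\<And>h. h \<in> hh k \<Longrightarrow> \<exists>c. heis h 0 v = csc c v"
  shows "\<exists>c x. c \<noteq> 0 \<and> x \<in> N_lat k \<and> v = csc c (evec x)"
proof -
  have empty: "fst b = {#}" if b: "b \<in> Poly_Mapping.keys v" for b
  proof (rule ccontr)
    assume "fst b \<noteq> {#}"
    then obtain p M where M: "fst b = add_mset p M" by (metis multiset_cases)
    obtain i n where p: "p = (i, n)" by (cases p)
    have i: "i \<in> {1..k}" "n \<ge> 1" using VN_keys[OF k v(1) b] M p by (auto simp: supported_def)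
    have "heis (alpha i) (int n) v = 0"
      using heis_alpha_VN[OF k _ v(1), of "int n" i] pos[OF alpha_proj_hh[OF k i(1)], of "int n"] i(2) by simp
    then have "2 * of_nat n * of_nat (Suc (count M (i, n))) * Poly_Mapping.lookup v (add_mset (i, n) M, snd b) = 0"
      using lookup_heis_alpha[OF i(2), of i v M "snd b"] by simp
    moreover have "(2 * of_nat n * of_nat (Suc (count M (i, n))) :: complex) \<noteq> 0"
      using i by (simp del: of_nat_Suc)
    moreover have "b = (add_mset (i, n) M, snd b)" using M p by (metis prod.collapse)
    ultimately have "Poly_Mapping.lookup v b = 0" by (metis mult_eq_0_iff)
    with b show False by (simp add: in_keys_iff)
  qed
  have same: "snd b = snd b'" if b: "b \<in> Poly_Mapping.keys v" "b' \<in> Poly_Mapping.keys v" for b b'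
  proof (rule poly_mapping_eqI)
    fix i
    show "Poly_Mapping.lookup (snd b) i = Poly_Mapping.lookup (snd b') i"
    proof (cases "i \<in> {1..k}")
      case True
      obtain c where "heis (alpha i - scl (1 / of_nat k) (delta k)) 0 v = csc c v"
        using zero[OF alpha_proj_hh[OF k True]] by blast
      then have "heis (alpha i) 0 v = csc c v" using heis_alpha_VN[OF k _ v(1), of 0 i] by simp
      then have "2 * of_int (Poly_Mapping.lookup (snd b) i) * Poly_Mapping.lookup v b =
          c * Poly_Mapping.lookup v b" for b
        by (metis lookup_heis_alpha_zero lookup_csc)
      note eq = this
      have "2 * of_int (Poly_Mapping.lookup (snd b) i) = c"
        if "b \<in> Poly_Mapping.keys v" for b using that eq[of b] by (simp add: in_keys_iff)
      from this[OF b(1)] this[OF b(2)] have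
        "of_int (Poly_Mapping.lookup (snd b) i) = (of_int (Poly_Mapping.lookup (snd b') i) :: complex)"
        by (metis mult_cancel_left zero_neq_numeral)
      then show ?thesis by (simp only: of_int_eq_iff)
    next
      case False
      have "Poly_Mapping.lookup (snd b) i = 0" if "b \<in> Poly_Mapping.keys v" for b
      proof -
        have "Poly_Mapping.keys (snd b) \<subseteq> {1..k}"
          using VN_keys[OF k v(1) that] N_lat_iff[OF k] by (simp only: supported_def)
        with False show ?thesis by (auto simp only: in_keys_iff)
      qed
      then show ?thesis using b by simp
    qed
  qed
  obtain b where b: "b \<in> Poly_Mapping.keys v" using v(2) by (metis keys_eq_empty ex_in_conv)
  have "Poly_Mapping.keys v = {b}"
  proof (intro equalityI subsetI)
    fix b' assume b': "b' \<in> Poly_Mapping.keys v"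
    then have "b' = b" using empty[OF b'] empty[OF b] same[OF b' b] by (simp add: prod_eq_iff)
    then show "b' \<in> {b}" by simp
  qed (use b in simp)
  then have "v = csc (Poly_Mapping.lookup v b) (bvec b)" using fock_expand[of v] by simp
  moreover have "bvec b = evec (snd b)" using empty[OF b] by (metis evec_def prod.collapse)
  moreover have "snd b \<in> N_lat k" using VN_keys[OF k v(1) b] by (simp add: supported_def)
  ultimately show ?thesis using b by (metis in_keys_iff)
qed

section \<open>Automorphisms\<close>

text \<open>The predicate P stands for an invariant subspace, later V_N: symmetries are only known
  to intertwine the modes there.\<close>

lemma pow_coeff_intertwine:
  assumes f: "flinear f" and P: "P 0" "\<And>u v. P u \<Longrightarrow> P v \<Longrightarrow> P (u + v)"
    and a: "\<And>n v. n \<ge> 1 \<Longrightarrow> P v \<Longrightarrow> P (a n v)" "\<And>n v. n \<ge> 1 \<Longrightarrow> P v \<Longrightarrow> f (a n v) = a' n (f v)"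
    and v: "P v"
  shows "f (pow_coeff a r j v) = pow_coeff a' r j (f v)"
proof (induction r arbitrary: j)
  case 0
  then show ?case by (simp add: flinear_0[OF f])
next
  case (Suc r)
  have "f (a n (pow_coeff a r (j - n) v)) = a' n (pow_coeff a' r (j - n) (f v))" if "n \<ge> 1" for n
    using a(2)[OF that pow_coeff_pred[of P, OF P a(1) v]] Suc by simp
  then show ?case by (simp add: flinear_sum[OF f])
qed

lemma exp_coeff_intertwine:
  assumes f: "flinear f" and P: "P 0" "\<And>u v. P u \<Longrightarrow> P v \<Longrightarrow> P (u + v)"
    and a: "\<And>n v. n \<ge> 1 \<Longrightarrow> P v \<Longrightarrow> P (a n v)" "\<And>n v. n \<ge> 1 \<Longrightarrow> P v \<Longrightarrow> f (a n v) = a' n (f v)"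
    and v: "P v"
  shows "f (exp_coeff a j v) = exp_coeff a' j (f v)"
  using pow_coeff_intertwine[of f P a a', OF assms]
  by (simp add: exp_coeff_def flinear_sum[OF f] flinear_csc[OF f])

lemma lookup_beta: "Poly_Mapping.lookup (beta i) j = (if j = i then 1 else 0) - (if j = Suc i then 1 else 0)"
  by (simp add: beta_def alpha_def lookup_minus lookup_single when_def)

lemma beta_in_span: "i \<in> {1..k-1} \<Longrightarrow> beta i \<in> beta_span k"
proof -
  assume "i \<in> {1..k-1}"
  then have "i \<ge> 1" "Suc i \<le> k" by auto
  then show ?thesis
    by (subst beta_span_iff) (auto simp: in_keys_iff lookup_beta sum_subtractf split: if_splits)
qed

text \<open>As N spans \<hh> over the complex numbers, a linear statement about \<hh> needs to be
  checked on lattice vectors only.\<close>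

lemma hh_induct [consumes 2, case_names zero add scl cvec]:
  assumes "k \<ge> 1" "h \<in> hh k" "P 0"
    "\<And>h h'. h \<in> hh k \<Longrightarrow> h' \<in> hh k \<Longrightarrow> P h \<Longrightarrow> P h' \<Longrightarrow> P (h + h')"
    "\<And>c h. h \<in> hh k \<Longrightarrow> P h \<Longrightarrow> P (scl c h)"
    "\<And>x. x \<in> N_lat k \<Longrightarrow> P (cvec x)"
  shows "P h"
proof -
  obtain c where h: "h = (\<Sum>i\<in>{1..k-1}. scl (c i) (beta i))"
    using assms(2) unfolding hh_def beta_span_def by blast
  have cv: "beta i = cvec (beta i)" for i
    by (rule poly_mapping_eqI) (simp add: lookup_cvec lookup_beta)
  have b: "P (scl (c i) (beta i))" "scl (c i) (beta i) \<in> hh k" if "i \<in> {1..k-1}" for i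
  proof -
    have "(beta i :: nat \<Rightarrow>\<^sub>0 complex) \<in> hh k" using beta_in_span[OF that] by (simp add: hh_def)
    moreover have "P (beta i)"
      unfolding cv by (rule assms(6)) (use beta_in_span[OF that] in \<open>simp add: N_lat_def\<close>)
    ultimately show "P (scl (c i) (beta i))" "scl (c i) (beta i) \<in> hh k"
      using assms(5) hh_closed(4)[OF assms(1)] by simp_all
  qed
  have "P (\<Sum>i\<in>A. scl (c i) (beta i)) \<and> (\<Sum>i\<in>A. scl (c i) (beta i)) \<in> hh k" if "A \<subseteq> {1..k-1}" for A
    using that
    by (induction A rule: infinite_finite_induct) (simp_all add: assms(3,4) b hh_closed[OF assms(1)])
  then show ?thesis unfolding h by blast
qed

lemma one_in_VN: "k \<ge> 1 \<Longrightarrow> 1 \<in> VN k"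
  using evec_in_VN[OF N_lat_closed(1)] by (simp add: evec_0)

text \<open>A common criterion for both kinds of automorphism: \<phi> is the action on \<hh>, while
  f and \<chi> describe the action on the e^x. For lifts \<chi> is 1 and \<phi> is the complex
  extension of f; for exponentials of zero modes \<phi> and f are identities and \<chi> is the
  exponential character.\<close>

locale VN_symmetry =
  fixes k :: nat and \<Phi> :: "fock \<Rightarrow> fock" and \<phi> :: "(nat \<Rightarrow>\<^sub>0 complex) \<Rightarrow> (nat \<Rightarrow>\<^sub>0 complex)"
    and \<chi> :: "(nat \<Rightarrow>\<^sub>0 int) \<Rightarrow> complex" and f :: "(nat \<Rightarrow>\<^sub>0 int) \<Rightarrow> (nat \<Rightarrow>\<^sub>0 int)"
  assumes k: "k \<ge> 1" and lin: "flinear \<Phi>"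
    and lat: "x \<in> N_lat k \<Longrightarrow> f x \<in> N_lat k"
    and hh: "h \<in> hh k \<Longrightarrow> \<phi> h \<in> hh k"
    and heis: "h \<in> hh k \<Longrightarrow> v \<in> VN k \<Longrightarrow> \<Phi> (heis h m v) = heis (\<phi> h) m (\<Phi> v)"
    and evec_mult: "x \<in> N_lat k \<Longrightarrow> v \<in> VN k \<Longrightarrow> \<Phi> (evec x * v) = csc (\<chi> x) (evec (f x) * \<Phi> v)"
    and one: "\<Phi> 1 = 1"
    and cvec: "x \<in> N_lat k \<Longrightarrow> \<phi> (cvec x) = cvec (f x)"
    and isometry: "x \<in> N_lat k \<Longrightarrow> y \<in> N_lat k \<Longrightarrow> ip (f x) (f y) = ip x y"
    and omega: "\<Phi> (omega k) = omega k"
begin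

lemma map_evec: "x \<in> N_lat k \<Longrightarrow> \<Phi> (evec x) = csc (\<chi> x) (evec (f x))"
  using evec_mult[OF _ one_in_VN[OF k]] by (simp add: one)

lemma map_hneg: "v \<in> VN k \<Longrightarrow> h \<in> hh k \<Longrightarrow> n \<ge> 1 \<Longrightarrow> \<Phi> (hneg h n * v) = hneg (\<phi> h) n * \<Phi> v"
  using heis[of h v "- int n"] by (simp add: heis_neg)

lemma in_VN: "v \<in> VN k \<Longrightarrow> \<Phi> v \<in> VN k"
  by (induction rule: VN_induct')
     (auto simp: flinear_0[OF lin] flinear_add[OF lin] flinear_csc[OF lin] VN_closed map_evec evec_in_VN lat
       map_hneg VN_hneg hh)

lemma charge: "v \<in> VN_gen k \<Longrightarrow> \<exists>\<gamma>\<in>N_lat k. has_charge \<gamma> v \<and> has_charge (f \<gamma>) (\<Phi> v)"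
proof (induction rule: VN_gen.induct)
  case (evec \<gamma>)
  have "has_charge \<gamma> (evec \<gamma>)" for \<gamma> by (simp add: has_charge_def evec_def keys_bvec)
  with evec show ?case by (intro bexI[of _ \<gamma>]) (simp_all add: map_evec has_charge_closed)
next
  case (hneg v h n)
  then show ?case using hneg_charge by (fastforce simp: map_hneg VN_gen_in_VN)
qed

lemma exp_creation: "x \<in> N_lat k \<Longrightarrow> v \<in> VN k \<Longrightarrow> \<Phi> (exp_creation x j v) = exp_creation (f x) j (\<Phi> v)"
  unfolding exp_creation_def
  by (rule exp_coeff_intertwine[OF lin, of "\<lambda>v. v \<in> VN k"])
     (simp_all add: VN_closed VN_heis cvec_in_hh[OF k] flinear_csc[OF lin] heis cvec)

lemma exp_annihilation: "x \<in> N_lat k \<Longrightarrow> v \<in> VN k \<Longrightarrow> \<Phi> (exp_annihilation x j v) = exp_annihilation (f x) j (\<Phi> v)"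
  unfolding exp_annihilation_def
  by (rule exp_coeff_intertwine[OF lin, of "\<lambda>v. v \<in> VN k"])
     (simp_all only: VN_closed VN_heis cvec_in_hh[OF k] flinear_csc[OF lin] heis cvec)

text \<open>\<Phi> carries charge \<gamma> to charge f \<gamma>, and f is an isometry, so both sides
  expand with the same powers of z. A common degree bound J makes the two finite sums range over the
  same j.\<close>

lemma exp_field:
  assumes x: "x \<in> N_lat k" and v: "v \<in> VN k"
  shows "\<Phi> (exp_field x m v) = csc (\<chi> x) (exp_field (f x) m (\<Phi> v))"
  using v
proof (induction rule: VN_induct)
  case (gen v)
  then have v: "v \<in> VN k" by (rule VN_gen_in_VN)
  obtain \<gamma> where \<gamma>: "\<gamma> \<in> N_lat k" "has_charge \<gamma> v" "has_charge (f \<gamma>) (\<Phi> v)" using charge[OF gen] by blast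
  obtain J1 J2 where J: "deg_le (int J1) v" "deg_le (int J2) (\<Phi> v)" using deg_le_exists by blast
  define J where "J = max J1 J2"
  have J: "deg_le (int J) v" "deg_le (int J) (\<Phi> v)"
    using J by (auto simp: J_def intro: deg_le_mono)
  have xv: "evec x * v \<in> VN k" using v x k by (simp add: VN_evec_mult)
  have "\<Phi> (exp_creation x i (exp_annihilation x j (evec x * v))) =
    csc (\<chi> x) (exp_creation (f x) i (exp_annihilation (f x) j (evec (f x) * \<Phi> v)))" for i j
    using x k xv v
    by (simp add: exp_creation exp_annihilation VN_exp_annihilation evec_mult
        flinear_csc[OF flinear_exp_creation] flinear_csc[OF flinear_exp_annihilation])
  then show ?case
    unfolding exp_field_charge[OF \<gamma>(2) J(1)] exp_field_charge[OF \<gamma>(3) J(2)] isometry[OF x \<gamma>(1)]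
      flinear_sum[OF lin] fock.scale_sum_right
    by (intro sum.cong) (simp_all add: Let_def flinear_0[OF lin])
qed (simp_all add: flinear_0[OF lin] flinear_add[OF lin] flinear_csc[OF lin] flinear_0[OF flinear_exp_field]
  flinear_add[OF flinear_exp_field] flinear_csc[OF flinear_exp_field] fock.scale_right_distrib mult_ac)

text \<open>\<Phi> intertwines both clauses of the recursion that builds \<open>Y_op u\<close> from
  some e^x; v stays general because the normally ordered product applies inner modes to other
  vectors.\<close>

lemma Y_op: "u \<in> VN k \<Longrightarrow> v \<in> VN k \<Longrightarrow> \<Phi> (Y_op u m v) = Y_op (\<Phi> u) m (\<Phi> v)"
proof (induction arbitrary: m v rule: VN_induct')
  case (evec \<gamma>)
  then show ?case by (simp add: Y_op_evec exp_field map_evec flinear_csc[OF flinear_Y_op_left])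
next
  case (hneg u h n)
  define p where "p = n - 1"
  have a: "is_field (deriv_field (p) (heis h))" by (rule is_field_deriv[OF is_field_heis])
  have eq: "\<Phi> (deriv_field (p) (heis h) l v) = deriv_field (p) (heis (\<phi> h)) l (\<Phi> v)"
    if "v \<in> VN k" for l v
    using that hneg(2) by (simp add: deriv_field_def flinear_csc[OF lin] heis)
  have "deriv_field (p) (heis h) l v \<in> VN k" if "v \<in> VN k" for l v
    using that hneg(2) by (simp add: deriv_field_def VN_closed VN_heis)
  with hneg show ?case
    unfolding map_hneg[OF hneg(1-3)] Y_op_hneg p_def[symmetric] normal_product_def
    by (subst flinear_Sum_any[OF lin normal_product_finite[OF a is_field_Y_op]], intro Sum_any.cong)
       (simp add: eq VN_Y_op[OF _ _ k])
qed (simp_all add: flinear_0[OF flinear_Y_op_left] flinear_add[OF flinear_Y_op_left] flinear_csc[OF flinear_Y_op_left]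
   flinear_0[OF lin] flinear_add[OF lin] flinear_csc[OF lin])

end

section \<open>Automorphisms of V_N as a group of bijections\<close>

lemma VN_Aut_iff: "g \<in> carrier (voa_Aut (V_N k)) \<longleftrightarrow> g \<in> Bij (VN k) \<and>
     (\<forall>u\<in>VN k. \<forall>v\<in>VN k. g (u + v) = g u + g v) \<and>
     (\<forall>c. \<forall>u\<in>VN k. g (csc c u) = csc c (g u)) \<and>
     (\<forall>u\<in>VN k. \<forall>v\<in>VN k. \<forall>n. g (Y_op u n v) = Y_op (g u) n (g v)) \<and>
     g 1 = 1 \<and> g (omega k) = omega k"
  by (simp add: voa_Aut_def V_N_def)

lemma omega_in_VN: "k \<ge> 1 \<Longrightarrow> omega k \<in> VN k"
proof -
  assume k: "k \<ge> 1"
  have "hneg (onb j) 1 * (hneg (onb j) 1 * 1) \<in> VN k" if "j \<in> {1..k-1}" for j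
    using onb_orthonormal(1)[OF that that] one_in_VN[OF k] by (intro VN_hneg) auto
  then show ?thesis unfolding omega_def by (intro VN_closed(3) VN_sum) simp
qed

lemma (in VN_symmetry) in_Aut:
  assumes "bij_betw \<Phi> (VN k) (VN k)"
  shows "restrict \<Phi> (VN k) \<in> carrier (voa_Aut (V_N k))"
  using assms in_VN k unfolding VN_Aut_iff
  by (auto simp: Bij_def flinear_add[OF lin] flinear_csc[OF lin] VN_closed VN_Y_op Y_op one omega
      one_in_VN omega_in_VN bij_betw_restrict_eq)

lemma VN_Aut_mult: "g \<in> carrier (voa_Aut (V_N k)) \<Longrightarrow> g' \<in> carrier (voa_Aut (V_N k)) \<Longrightarrow>
    g \<otimes>\<^bsub>voa_Aut (V_N k)\<^esub> g' = compose (VN k) g g'"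
  by (simp add: voa_Aut_def V_N_def BijGroup_def)

lemma VN_Aut_one: "\<one>\<^bsub>voa_Aut (V_N k)\<^esub> = (\<lambda>v\<in>VN k. v)"
  by (simp add: voa_Aut_def V_N_def BijGroup_def)

lemma VN_Aut_bij: "g \<in> carrier (voa_Aut (V_N k)) \<Longrightarrow> bij_betw g (VN k) (VN k)"
  by (simp add: VN_Aut_iff Bij_def)

lemma VN_Aut_in: "g \<in> carrier (voa_Aut (V_N k)) \<Longrightarrow> v \<in> VN k \<Longrightarrow> g v \<in> VN k"
  using VN_Aut_bij bij_betwE by blast

lemma VN_Aut_hom:
  assumes "g \<in> carrier (voa_Aut (V_N k))"
  shows "u \<in> VN k \<Longrightarrow> v \<in> VN k \<Longrightarrow> g (u + v) = g u + g v" "u \<in> VN k \<Longrightarrow> g (csc c u) = csc c (g u)"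
    "u \<in> VN k \<Longrightarrow> v \<in> VN k \<Longrightarrow> g (Y_op u n v) = Y_op (g u) n (g v)"
    "g 1 = 1" "g (omega k) = omega k" "g 0 = 0"
proof -
  show *: "u \<in> VN k \<Longrightarrow> g (csc c u) = csc c (g u)" for c u using assms by (simp add: VN_Aut_iff)
  show "g 0 = 0" using *[OF VN_closed(1), of 0] by simp
qed (use assms in \<open>simp_all add: VN_Aut_iff\<close>)

lemma group_VN_Aut:
  assumes k: "k \<ge> 1"
  shows "group (voa_Aut (V_N k))"
proof -
  let ?H = "carrier (voa_Aut (V_N k))"
  interpret B: group "BijGroup (VN k)" by (rule group_BijGroup)
  have "subgroup ?H (BijGroup (VN k))"
  proof
    show "?H \<subseteq> carrier (BijGroup (VN k))" by (auto simp: VN_Aut_iff BijGroup_def)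
  next
    fix g g' assume g: "g \<in> ?H" "g' \<in> ?H"
    then have m: "g \<otimes>\<^bsub>BijGroup (VN k)\<^esub> g' = compose (VN k) g g'"
      by (auto simp: VN_Aut_iff BijGroup_def)
    show "g \<otimes>\<^bsub>BijGroup (VN k)\<^esub> g' \<in> ?H"
      unfolding m using g VN_Aut_in[OF g(2)] k
      by (auto simp: VN_Aut_iff compose_Bij compose_eq VN_closed VN_Y_op one_in_VN omega_in_VN)
  next
    show "\<one>\<^bsub>BijGroup (VN k)\<^esub> \<in> ?H"
      using k by (auto simp: BijGroup_def VN_Aut_iff id_Bij VN_closed VN_Y_op one_in_VN omega_in_VN)
  next
    fix g assume g: "g \<in> ?H"
    then have bij: "bij_betw g (VN k) (VN k)" and B: "g \<in> Bij (VN k)" by (auto simp: VN_Aut_iff Bij_def)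
    let ?i = "inv_into (VN k) g"
    have i: "?i v \<in> VN k" "g (?i v) = v" if "v \<in> VN k" for v
      using bij that by (auto simp: bij_betw_def inv_into_into f_inv_into_f)
    have inv: "?i (g v) = v" if "v \<in> VN k" for v
      using bij that by (simp add: bij_betw_def)
    have eqI: "?i v = w" if "w \<in> VN k" "g w = v" for v w using inv[of w] that by simp
    have "inv\<^bsub>BijGroup (VN k)\<^esub> g = restrict ?i (VN k)" using inv_BijGroup[OF B] by simp
    moreover have "restrict ?i (VN k) \<in> ?H"
      unfolding VN_Aut_iff
    proof (intro conjI ballI allI)
      show "restrict ?i (VN k) \<in> Bij (VN k)" by (rule restrict_inv_into_Bij[OF B])
    next
      fix u v assume uv: "u \<in> VN k" "v \<in> VN k"
      have "?i (u + v) = ?i u + ?i v"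
        by (rule eqI) (use uv i g in \<open>auto simp: VN_closed VN_Aut_iff\<close>)
      then show "restrict ?i (VN k) (u + v) = restrict ?i (VN k) u + restrict ?i (VN k) v"
        using uv by (simp add: VN_closed)
      fix n
      have "?i (Y_op u n v) = Y_op (?i u) n (?i v)"
        by (rule eqI) (use uv i g k in \<open>auto simp: VN_Y_op VN_Aut_iff\<close>)
      then show "restrict ?i (VN k) (Y_op u n v) = Y_op (restrict ?i (VN k) u) n (restrict ?i (VN k) v)"
        using uv k by (simp add: VN_Y_op)
    next
      fix c u assume u: "u \<in> VN k"
      have "?i (csc c u) = csc c (?i u)"
        by (rule eqI) (use u i g in \<open>auto simp: VN_closed VN_Aut_iff\<close>)
      then show "restrict ?i (VN k) (csc c u) = csc c (restrict ?i (VN k) u)"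
        using u by (simp add: VN_closed)
    next
      show "restrict ?i (VN k) 1 = 1" "restrict ?i (VN k) (omega k) = omega k"
        using g k eqI[of 1 1] eqI[of "omega k" "omega k"]
        by (auto simp: VN_Aut_iff one_in_VN omega_in_VN)
    qed
    ultimately show "inv\<^bsub>BijGroup (VN k)\<^esub> g \<in> ?H" by simp
  qed
  then have "group ((BijGroup (VN k))\<lparr>carrier := ?H\<rparr>)"
    by (rule subgroup.subgroup_is_group) (rule group_BijGroup)
  moreover have "(BijGroup (VN k))\<lparr>carrier := ?H\<rparr> = voa_Aut (V_N k)"
    by (simp add: voa_Aut_def V_N_def)
  ultimately show ?thesis by simp
qed

text \<open>\<open>VN\<close> is generated by the \<open>e\<^sup>x\<close>: a subleading mode of \<open>Y(e\<^sup>x, z) e\<^bsup>-x\<^esup>\<close> is \<open>x(-1)\<close>.\<close>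

lemma hneg_cvec_mode: "Y_op (evec x) (ip x x - 2) (evec (- x)) = hneg (cvec x) 1"
proof -
  have "Y_op (evec x) (ip x x - 2) (evec (- x)) = exp_creation x (Suc 0) (evec 0)"
    by (simp add: Y_op_evec exp_field_evec ip_uminus Let_def)
  also have "\<dots> = hneg (cvec x) 1"
    by (simp add: exp_creation_def exp_coeff_1 heis_neg evec_0)
  finally show ?thesis .
qed

text \<open>The highest nonzero mode of e^x on e^y has index -\<langle>x, y\<rangle> - 1 and value
  e^{x+y}, so it reveals both the inner product and the sum.\<close>

lemma exp_field_leading:
  "m \<ge> - ip x y \<Longrightarrow> exp_field x m (evec y) = 0"
  "exp_field x (- ip x y - 1) (evec y) = evec (x + y)"
  by (simp_all add: exp_field_evec Let_def exp_creation_def exp_coeff_0)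

text \<open>Values on the e^x fix the values on all x(-1)1, by linearity on h(-1)1, and thus the
  Heisenberg modes that create V_N from the e^x. All later relations between automorphisms are
  verified through this criterion.\<close>

lemma VN_Aut_eqI:
  assumes k: "k \<ge> 1" and g: "g \<in> carrier (voa_Aut (V_N k))" and g': "g' \<in> carrier (voa_Aut (V_N k))"
    and eq: "\<And>x. x \<in> N_lat k \<Longrightarrow> g (evec x) = g' (evec x)"
  shows "g = g'"
proof -
  have g0: "g 0 = 0" if "g \<in> carrier (voa_Aut (V_N k))" for g by (rule VN_Aut_hom(6)[OF that])
  have add: "g (u + v) = g u + g v" "g (csc c u) = csc c (g u)" "g (Y_op u n v) = Y_op (g u) n (g v)"
    if "g \<in> carrier (voa_Aut (V_N k))" "u \<in> VN k" "v \<in> VN k" for g u v c n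
    by (rule VN_Aut_hom[OF that(1)], (rule that)+)+
  have cvec: "g (hneg (cvec x) 1) = g' (hneg (cvec x) 1)" if x: "x \<in> N_lat k" for x
    unfolding hneg_cvec_mode[symmetric]
    using eq[OF x] eq[of "- x"] x k
    by (simp add: add(3)[OF g] add(3)[OF g'] evec_in_VN N_lat_closed)
  have hin: "hneg h n \<in> VN k" if "h \<in> hh k" "n \<ge> 1" for h n
    using VN_hneg[OF one_in_VN[OF k] that] by simp
  have hneg_eq: "g (hneg h 1) = g' (hneg h 1)" if h: "h \<in> hh k" for h
    using k h
  proof (induction rule: hh_induct)
    case (add h h')
    show ?case
      unfolding hneg_add VN_Aut_hom(1)[OF g hin[OF add(1) order_refl] hin[OF add(2) order_refl]]
        VN_Aut_hom(1)[OF g' hin[OF add(1) order_refl] hin[OF add(2) order_refl]] add(3,4) ..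
  next
    case (scl c h)
    show ?case
      unfolding hneg_scl VN_Aut_hom(2)[OF g hin[OF scl(1) order_refl]]
        VN_Aut_hom(2)[OF g' hin[OF scl(1) order_refl]] scl(2) ..
  qed (simp_all only: hneg_zero g0 g g' cvec)
  have "g v = g' v" if "v \<in> VN k" for v
    using that
  proof (induction rule: VN_induct')
    case (hneg v h n)
    \<comment> \<open>Creation by h(-n) is the mode -n of the vector h(-1)1, so automorphisms
      respect it.\<close>
    have eq: "hneg h n * v = Y_op (hneg h 1) (- int n) v"
      using hneg(3) unfolding Y_op_hneg_1 by (simp add: heis_neg)
    have h1: "hneg h 1 \<in> VN k" using hneg(2) by (rule hin) simp
    show ?case
      unfolding eq VN_Aut_hom(3)[OF g h1 hneg(1)] VN_Aut_hom(3)[OF g' h1 hneg(1)] hneg_eq[OF hneg(2)] hneg(4) ..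
  qed (simp_all add: g0 g g' eq add(1)[OF g] add(1)[OF g'] VN_Aut_hom(2)[OF g] VN_Aut_hom(2)[OF g'])
  moreover have "g \<in> extensional (VN k)" "g' \<in> extensional (VN k)"
    using g g' by (auto simp: VN_Aut_iff Bij_def)
  ultimately show ?thesis by (intro extensionalityI)
qed

section \<open>The isometry and the scalars attached to an automorphism\<close>

lemma csc_evec_eq: "csc c (evec x) = csc d (evec y) \<Longrightarrow> c \<noteq> 0 \<Longrightarrow> c = d \<and> x = y"
proof -
  assume eq: "csc c (evec x) = csc d (evec y)" and c: "c \<noteq> 0"
  have "Poly_Mapping.lookup (csc c (evec x)) ({#}, x) = Poly_Mapping.lookup (csc d (evec y)) ({#}, x)"
    by (simp only: eq)
  with c show ?thesis by (auto simp: lookup_csc evec_def lookup_bvec split: if_splits)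
qed

lemma evec_neq_0: "evec x \<noteq> 0"
  using csc_evec_eq[of 1 x 0 x] by auto

lemma VN_Aut_evec:
  assumes k: "k \<ge> 1" and g: "g \<in> carrier (voa_Aut (V_N k))" and x: "x \<in> N_lat k"
  shows "\<exists>c y. c \<noteq> 0 \<and> y \<in> N_lat k \<and> g (evec x) = csc c (evec y)"
proof (rule highest_weight_vector[OF k])
  have xV: "evec x \<in> VN k" using x by (rule evec_in_VN)
  show "g (evec x) \<in> VN k" using g xV by (rule VN_Aut_in)
  have bij: "bij_betw g (VN k) (VN k)" by (rule VN_Aut_bij[OF g])
  have g0: "g 0 = 0" by (rule VN_Aut_hom(6)[OF g])
  have inj: "inj_on g (VN k)" using bij by (rule bij_betw_imp_inj_on)
  show "g (evec x) \<noteq> 0"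
    using inj_onD[OF inj _ xV VN_closed(1)] g0 evec_neq_0[of x] by auto
  \<comment> \<open>Each h' in \<hh> corresponds to some h under g: the preimage of h'(-1)1
    satisfies the same \<open>omega\<close> equation, since g fixes \<open>omega\<close> and is
    injective, and therefore has the form h(-1)1.\<close>
  have ex: "\<exists>h\<in>hh k. \<forall>m. g (heis h m (evec x)) = heis h' m (g (evec x))" if h': "h' \<in> hh k" for h'
  proof -
    have h'V: "hneg h' 1 \<in> VN k" using VN_hneg[OF one_in_VN[OF k] h', of 1] by simp
    then obtain u where u: "u \<in> VN k" "g u = hneg h' 1" using bij_betw_imp_surj_on[OF bij] by (metis imageE)
    have "Y_op (omega k) 1 (g u) = g u" using weight_one_space[OF k h'V] u h' by auto
    then have "g (Y_op (omega k) 1 u) = g u" using VN_Aut_hom(3,5)[OF g] u(1) omega_in_VN[OF k] by simp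
    then have "Y_op (omega k) 1 u = u"
      by (rule inj_onD[OF inj _ VN_Y_op[OF omega_in_VN[OF k] u(1) k] u(1)])
    then obtain h where h: "h \<in> hh k" "u = hneg h 1" using weight_one_space[OF k u(1)] by blast
    have "g (Y_op u m (evec x)) = Y_op (g u) m (g (evec x))" for m
      by (rule VN_Aut_hom(3)[OF g u(1) xV])
    then show ?thesis using h u(2) by (auto simp: Y_op_hneg_1 simp del: One_nat_def)
  qed
  show "heis h' m (g (evec x)) = 0" if "h' \<in> hh k" "m > 0" for h' m
    using ex[OF that(1)] heis_evec[OF that(2)] g0 by metis
  show "\<exists>c. heis h' 0 (g (evec x)) = csc c (g (evec x))" if "h' \<in> hh k" for h'
    using ex[OF that] heis_zero_evec VN_Aut_hom(2)[OF g xV] by metis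
qed

text \<open>The choice is unique whenever a suitable y exists, by \<open>csc_evec_eq\<close>; for
  automorphisms and x in N existence is \<open>VN_Aut_evec\<close>.\<close>

definition lattice_action :: "(fock \<Rightarrow> fock) \<Rightarrow> (nat \<Rightarrow>\<^sub>0 int) \<Rightarrow> (nat \<Rightarrow>\<^sub>0 int)" where
  "lattice_action g x = (SOME y. \<exists>c. c \<noteq> 0 \<and> g (evec x) = csc c (evec y))"

definition lattice_scalar :: "(fock \<Rightarrow> fock) \<Rightarrow> (nat \<Rightarrow>\<^sub>0 int) \<Rightarrow> complex" where
  "lattice_scalar g x = (SOME c. c \<noteq> 0 \<and> g (evec x) = csc c (evec (lattice_action g x)))"

lemma lattice_action_eqI:
  assumes "g (evec x) = csc c (evec y)" "c \<noteq> 0"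
  shows "lattice_action g x = y" "lattice_scalar g x = c"
proof -
  show y: "lattice_action g x = y"
    unfolding lattice_action_def
    by (rule some_equality) (use assms csc_evec_eq in \<open>metis\<close>)+
  show "lattice_scalar g x = c"
    unfolding lattice_scalar_def y
    by (rule some_equality) (use assms csc_evec_eq in \<open>metis\<close>)+
qed

lemma lattice_action:
  assumes k: "k \<ge> 1" and g: "g \<in> carrier (voa_Aut (V_N k))" and x: "x \<in> N_lat k"
  shows "lattice_action g x \<in> N_lat k" "lattice_scalar g x \<noteq> 0"
    "g (evec x) = csc (lattice_scalar g x) (evec (lattice_action g x))"
  using VN_Aut_evec[OF assms] lattice_action_eqI by metis+

lemma lattice_action_hom:
  assumes k: "k \<ge> 1" and g: "g \<in> carrier (voa_Aut (V_N k))" and x: "x \<in> N_lat k" and y: "y \<in> N_lat k"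
  shows "ip (lattice_action g x) (lattice_action g y) = ip x y"
    "lattice_action g (x + y) = lattice_action g x + lattice_action g y"
    "lattice_scalar g (x + y) = lattice_scalar g x * lattice_scalar g y"
proof -
  note A = lattice_action[OF k g]
  let ?f = "lattice_action g" and ?c = "lattice_scalar g"
  have xy: "x + y \<in> N_lat k" using x y k by (simp add: N_lat_closed)
  have g0: "g 0 = 0" by (rule VN_Aut_hom(6)[OF g])
  have Y: "g (exp_field x m (evec y)) = csc (?c x * ?c y) (exp_field (?f x) m (evec (?f y)))" for m
  proof -
    have "g (Y_op (evec x) m (evec y)) = Y_op (g (evec x)) m (g (evec y))"
      by (rule VN_Aut_hom(3)[OF g evec_in_VN[OF x] evec_in_VN[OF y]])
    then show ?thesis unfolding A(3)[OF x] A(3)[OF y]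
      by (simp add: flinear_csc[OF flinear_Y_op_left] flinear_csc[OF flinear_Y_op] Y_op_evec)
  qed
  have nz: "g (evec (x + y)) \<noteq> 0" unfolding A(3)[OF xy] using A(2)[OF xy] evec_neq_0 by simp
  show ip: "ip (?f x) (?f y) = ip x y"
  \<comment> \<open>If the inner products differed, the side with the larger inner product would
    vanish at the leading mode of the other side, where that other side is nonzero.\<close>
  proof (rule linorder_cases[of "ip (?f x) (?f y)" "ip x y"])
    assume "ip (?f x) (?f y) < ip x y"
    then have "exp_field x (- ip (?f x) (?f y) - 1) (evec y) = 0" by (intro exp_field_leading) simp
    with Y[of "- ip (?f x) (?f y) - 1"] have "csc (?c x * ?c y) (evec (?f x + ?f y)) = 0"
      by (simp add: exp_field_leading g0)
    then show ?thesis using A(2)[OF x] A(2)[OF y] evec_neq_0 by simp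
  next
    assume "ip x y < ip (?f x) (?f y)"
    then have "exp_field (?f x) (- ip x y - 1) (evec (?f y)) = 0" by (intro exp_field_leading) simp
    with Y[of "- ip x y - 1"] nz show ?thesis by (simp add: exp_field_leading)
  qed
  \<comment> \<open>With equal inner products the leading modes on both sides correspond. The
    trivial cocycle gives them coefficient 1, so the scalars multiply.\<close>
  have "csc (?c (x + y)) (evec (?f (x + y))) = csc (?c x * ?c y) (evec (?f x + ?f y))"
    using Y[of "- ip x y - 1"] A(3)[OF xy] exp_field_leading(2)[of "?f x" "?f y"]
    by (simp add: exp_field_leading ip)
  from csc_evec_eq[OF this A(2)[OF xy]]
  show "?f (x + y) = ?f x + ?f y" "?c (x + y) = ?c x * ?c y" by simp_all
qed

section \<open>Lifts of isometries and exponentials of zero modes\<close>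

lemma poly_mapping_scl_simps:
  "scl (a + b) x = scl a x + scl b x" "scl a (x + y) = scl a x + scl a y" "scl a (scl b x) = scl (a * b) x"
  "scl 0 x = 0" "scl 1 x = x" "scl (- a) x = - scl a x"
  for a b :: "'a::comm_ring_1"
  by (rule poly_mapping_eqI, simp add: lookup_scl lookup_add algebra_simps)+

lemma poly_mapping_map_trivial: "Poly_Mapping.map (\<lambda>a. 0) x = 0" "Poly_Mapping.map (\<lambda>a. a) x = x"
  by (rule poly_mapping_eqI; transfer; auto simp: when_def)+

lemma scl_sum: "scl a (\<Sum>x\<in>A. f x) = (\<Sum>x\<in>A. scl a (f x))" for a :: "'a::comm_ring_1"
  by (rule poly_mapping_eqI) (simp add: lookup_scl lookup_sum sum_distrib_left)

lemma additive_scl: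
  fixes g :: "(nat \<Rightarrow>\<^sub>0 int) \<Rightarrow> (nat \<Rightarrow>\<^sub>0 int)"
  assumes g: "\<And>x y. g (x + y) = g x + g y"
  shows "g (scl n x) = scl n (g x)"
proof -
  have g0: "g 0 = 0" using g[of 0 0] by simp
  have nat: "g (scl (int n) x) = scl (int n) (g x)" for n
    by (induction n) (simp_all add: poly_mapping_scl_simps poly_mapping_map_trivial g g0)
  have "g (- x) = - g x" for x using g[of "- x" x] g0 by (simp add: eq_neg_iff_add_eq_0)
  then show ?thesis
    by (cases n rule: int_cases2) (simp_all add: nat poly_mapping_scl_simps)
qed

lemma additive_sum:
  fixes g :: "(nat \<Rightarrow>\<^sub>0 int) \<Rightarrow> (nat \<Rightarrow>\<^sub>0 int)"
  assumes g: "\<And>x y. g (x + y) = g x + g y"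
  shows "g (\<Sum>x\<in>A. f x) = (\<Sum>x\<in>A. g (f x))"
  using g[of 0 0] by (induction A rule: infinite_finite_induct) (simp_all add: g)

lemma cvec_sum: "cvec (\<Sum>x\<in>A. f x) = (\<Sum>x\<in>A. cvec (f x))"
  by (induction A rule: infinite_finite_induct) (simp_all add: cvec_zero cvec_add)

lemma cvec_scl: "cvec (scl n x) = scl (of_int n) (cvec x)"
  by (rule poly_mapping_eqI) (simp add: lookup_cvec lookup_scl)

lemma cext_superset:
  assumes "finite S" "Poly_Mapping.keys h \<subseteq> S"
  shows "cext g h = (\<Sum>i\<in>S. scl (Poly_Mapping.lookup h i) (cvec (g (alpha i))))"
  unfolding cext_def
  by (rule sum.mono_neutral_left) (use assms in \<open>auto simp: in_keys_iff poly_mapping_scl_simps poly_mapping_map_trivial\<close>)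

lemma cext_add: "cext g (h + h') = cext g h + cext g h'"
proof -
  let ?S = "Poly_Mapping.keys h \<union> Poly_Mapping.keys h'"
  have k: "Poly_Mapping.keys (h + h') \<subseteq> ?S"
    by (rule Poly_Mapping.keys_add)
  show ?thesis
    by (simp add: cext_superset[of ?S] k lookup_add poly_mapping_scl_simps sum.distrib)
qed

lemma cext_scl: "cext g (scl c h) = scl c (cext g h)"
proof -
  have k: "Poly_Mapping.keys (scl c h) \<subseteq> Poly_Mapping.keys h"
    by (auto simp: in_keys_iff lookup_scl)
  show ?thesis
    by (simp add: cext_superset[of "Poly_Mapping.keys h"] k lookup_scl poly_mapping_scl_simps scl_sum)
qed

lemma cext_zero: "cext g 0 = 0"
  by (simp add: cext_def)

lemma cext_alpha: "cext g (alpha i) = cvec (g (alpha i))"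
  by (simp add: cext_superset[of "{i}"] alpha_def poly_mapping_scl_simps poly_mapping_map_trivial)

lemma cext_cvec:
  assumes g: "\<And>x y. g (x + y) = g x + g y"
  shows "cext g (cvec x) = cvec (g x)"
proof -
  have "g x = (\<Sum>i\<in>Poly_Mapping.keys x. scl (Poly_Mapping.lookup x i) (g (alpha i)))"
    by (subst vec_expand) (simp only: additive_sum[of g, OF g] additive_scl[of g, OF g])
  then show ?thesis by (simp add: cext_def keys_cvec lookup_cvec cvec_sum cvec_scl)
qed

lemma flinear_lift_map: "flinear (lift_map g)"
  by (simp add: lift_map_def flinear_lin)

lemma lift_map_evec: "lift_map g (evec \<gamma>) = evec (g \<gamma>)"
  by (simp add: lift_map_def evec_def lin_bvec)

lemma cext_hh:
  assumes k: "k \<ge> 1" and g: "\<And>x y. g (x + y) = g x + g y" "\<And>x. x \<in> N_lat k \<Longrightarrow> g x \<in> N_lat k"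
    and h: "h \<in> hh k"
  shows "cext g h \<in> hh k"
  using k h
  by (induction rule: hh_induct)
     (simp_all add: cext_zero cext_add cext_scl cext_cvec[of g, OF g(1)] hh_closed[OF k] g(2) cvec_in_hh[OF k])

lemma lift_map_VN:
  assumes k: "k \<ge> 1" and g: "\<And>x y. g (x + y) = g x + g y" "\<And>x. x \<in> N_lat k \<Longrightarrow> g x \<in> N_lat k"
    and v: "v \<in> VN k"
  shows "lift_map g v \<in> VN k"
  using v
proof (induction rule: VN_induct')
  case (hneg v h n)
  then show ?case
    by (simp add: lift_map_mult[of g, OF g(1)] lift_map_hneg[of g, OF g(1)] VN_hneg cext_hh[of k g, OF k g])
qed (simp_all add: flinear_0[OF flinear_lift_map] flinear_add[OF flinear_lift_map]
    flinear_csc[OF flinear_lift_map] VN_closed lift_map_evec evec_in_VN g)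

text \<open>The maps are inverse to each other on N only: reducing indices modulo k is not injective
  on all natural numbers. The conclusion is therefore confined to V_N.\<close>

lemma lift_map_inverse:
  assumes k: "k \<ge> 1" and g: "\<And>x y. g (x + y) = g x + g y" and g': "\<And>x y. g' (x + y) = g' x + g' y"
    and inv: "\<And>x. x \<in> N_lat k \<Longrightarrow> g (g' x) = x" and v: "v \<in> VN k"
  shows "lift_map g (lift_map g' v) = v"
  using v
proof (induction rule: VN_induct')
  case (hneg v h n)
  have "cext g (cext g' h) = h"
    using k hneg(2)
    by (induction rule: hh_induct)
       (simp_all add: cext_zero cext_add cext_scl cext_cvec[of g, OF g] cext_cvec[of g', OF g'] inv)
  with hneg show ?case
    by (simp add: lift_map_mult[of g, OF g] lift_map_hneg[of g, OF g] lift_map_mult[of g', OF g'] lift_map_hneg[of g', OF g'])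
qed (simp_all add: flinear_0[OF flinear_lift_map] flinear_add[OF flinear_lift_map]
    flinear_csc[OF flinear_lift_map] lift_map_evec inv)

lemma cext_isometry:
  assumes k: "k \<ge> 1" and g: "\<And>x y. g (x + y) = g x + g y"
    and iso: "\<And>x y. x \<in> N_lat k \<Longrightarrow> y \<in> N_lat k \<Longrightarrow> ip (g x) (g y) = ip x y"
    and h: "h \<in> hh k" "h' \<in> hh k"
  shows "ip (cext g h) (cext g h') = ip h h'"
  using k h(1)
proof (induction rule: hh_induct)
  case (cvec x)
  show ?case
    using k h(2)
    by (induction rule: hh_induct)
       (simp_all add: cext_zero cext_add cext_scl cext_cvec[of g, OF g] ip_zero ip_add_right ip_scl_right
         ip_cvec iso cvec)
qed (simp_all add: cext_zero cext_add cext_scl ip_zero ip_add_left ip_scl_left)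

text \<open>For m < 0 this is multiplicativity of \<open>lift_map\<close>. For m \<ge> 0 the
  Heisenberg relation reduces it to invariance of the form, transported from N to \<hh> by
  \<open>cext_isometry\<close>.\<close>

lemma lift_map_heis:
  assumes k: "k \<ge> 1" and g: "\<And>x y. g (x + y) = g x + g y"
    and iso: "\<And>x y. x \<in> N_lat k \<Longrightarrow> y \<in> N_lat k \<Longrightarrow> ip (g x) (g y) = ip x y"
    and h: "h \<in> hh k" and v: "v \<in> VN k"
  shows "lift_map g (heis h m v) = heis (cext g h) m (lift_map g v)"
proof (cases "m < 0")
  case True
  then show ?thesis by (simp add: heis_neg lift_map_mult[of g, OF g] lift_map_hneg[of g, OF g])
next
  case False
  have iso': "ip (cext g h) (cext g h') = ip h h'" if "h \<in> hh k" "h' \<in> hh k" for h h'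
    by (rule cext_isometry[of k g]) (use k g iso that in auto)
  show ?thesis using v
  proof (induction rule: VN_induct')
    case (evec \<gamma>)
    show ?case
    proof (cases "m = 0")
      case True
      then show ?thesis
        using iso'[OF h cvec_in_hh[OF k evec]]
        by (simp add: heis_zero_evec lift_map_evec flinear_csc[OF flinear_lift_map] cext_cvec[of g, OF g])
    qed (use False in \<open>simp add: heis_evec lift_map_evec flinear_0[OF flinear_lift_map]\<close>)
  next
    case (hneg v h' n)
    then show ?case
      using False iso'[OF h hneg(2)]
      by (simp add: lift_map_mult[of g, OF g] lift_map_hneg[of g, OF g] heis_hneg_commute
          flinear_add[OF flinear_lift_map] flinear_csc[OF flinear_lift_map])
  qed (simp_all add: flinear_0[OF flinear_heis] flinear_add[OF flinear_heis] flinear_csc[OF flinear_heis]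
    flinear_0[OF flinear_lift_map] flinear_add[OF flinear_lift_map] flinear_csc[OF flinear_lift_map])
qed

text \<open>Invariance of \<open>omega\<close> is an input because it is read off different
  formulas: the sum of squares for -1 and \<open>omega_eq\<close> for permutations.\<close>

lemma lift_in_Aut:
  assumes k: "k \<ge> 1" and g: "\<And>x y. g (x + y) = g x + g y" and g': "\<And>x y. g' (x + y) = g' x + g' y"
    and pres: "\<And>x. x \<in> N_lat k \<Longrightarrow> g x \<in> N_lat k" "\<And>x. x \<in> N_lat k \<Longrightarrow> g' x \<in> N_lat k"
    and inv: "\<And>x. x \<in> N_lat k \<Longrightarrow> g (g' x) = x" "\<And>x. x \<in> N_lat k \<Longrightarrow> g' (g x) = x"
    and iso: "\<And>x y. x \<in> N_lat k \<Longrightarrow> y \<in> N_lat k \<Longrightarrow> ip (g x) (g y) = ip x y"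
    and omega: "lift_map g (omega k) = omega k"
  shows "lift k g \<in> carrier (voa_Aut (V_N k))"
proof -
  have "VN_symmetry k (lift_map g) (cext g) (\<lambda>x. 1) g"
  proof
    show "lift_map g 1 = 1"
      using lift_map_evec[of g 0] g[of 0 0] by (simp add: evec_0)
  qed (simp_all add: k[simplified] flinear_lift_map pres cext_hh[of k g, OF k g pres(1)] lift_map_heis[of k g, OF k g iso]
      lift_map_mult[of g, OF g] lift_map_evec cext_cvec[of g, OF g] iso omega)
  then interpret VN_symmetry k "lift_map g" "cext g" "\<lambda>x. 1" g .
  have "bij_betw (lift_map g) (VN k) (VN k)"
    by (rule bij_betwI[of _ _ _ "lift_map g'"])
       (auto simp: lift_map_VN[of k g, OF k g pres(1)] lift_map_VN[of k g', OF k g' pres(2)]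
         lift_map_inverse[of k g g', OF k g g' inv(1)] lift_map_inverse[of k g' g, OF k g' g inv(2)])
  then show ?thesis unfolding lift_def by (rule in_Aut)
qed

lemma lift_evec: "x \<in> N_lat k \<Longrightarrow> lift k g (evec x) = evec (g x)"
  by (simp add: lift_def evec_in_VN lift_map_evec)

lemma hneg_uminus: "hneg (- h) n = - hneg h n"
  using hneg_add[of "- h" h n] by (simp add: hneg_zero eq_neg_iff_add_eq_0)

lemma theta_in_Aut:
  assumes "k \<ge> 1"
  shows "theta k \<in> carrier (voa_Aut (V_N k))"
  unfolding theta_def
proof (rule lift_in_Aut[where g' = uminus, OF assms])
  have "cext uminus h = - h" for h
  proof -
    have "cext uminus h = - (\<Sum>i\<in>Poly_Mapping.keys h. scl (Poly_Mapping.lookup h i) (alpha i))"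
      unfolding cext_def sum_negf[symmetric]
      by (rule sum.cong, simp, rule poly_mapping_eqI)
         (simp add: lookup_scl cvec_uminus cvec_alpha)
    then show ?thesis using vec_expand[of h] by simp
  qed
  \<comment> \<open>\<open>omega\<close> is a combination of squares of h(-1), in which the signs
    cancel.\<close>
  then show "lift_map uminus (omega k) = omega k"
    by (simp add: omega_def flinear_csc[OF flinear_lift_map] flinear_sum[OF flinear_lift_map]
        lift_map_mult lift_map_hneg hneg_uminus)
qed (simp_all add: N_lat_closed(3)[OF assms] ip_uminus)

section \<open>Lifts of permutations of the coordinates\<close>

lemma reindex_superset:
  assumes "finite S" "Poly_Mapping.keys x \<subseteq> S"
  shows "reindex s x = (\<Sum>i\<in>S. scl (Poly_Mapping.lookup x i) (alpha (s i)))"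
  unfolding reindex_def
  by (rule sum.mono_neutral_left) (use assms in \<open>auto simp: in_keys_iff poly_mapping_scl_simps poly_mapping_map_trivial\<close>)

lemma reindex_add: "reindex s (x + y) = reindex s x + reindex s y"
proof -
  let ?S = "Poly_Mapping.keys x \<union> Poly_Mapping.keys y"
  have k: "Poly_Mapping.keys (x + y) \<subseteq> ?S"
    by (rule Poly_Mapping.keys_add)
  show ?thesis
    by (simp add: reindex_superset[of ?S] k lookup_add poly_mapping_scl_simps sum.distrib)
qed

lemma reindex_alpha: "reindex s (alpha i) = alpha (s i)"
  by (simp add: reindex_superset[of "{i}"] alpha_def poly_mapping_map_trivial)

lemma reindex_reindex: "reindex s (reindex t x) = reindex (\<lambda>i. s (t i)) x"
proof -
  have "reindex s (reindex t x) =
      (\<Sum>i\<in>Poly_Mapping.keys x. reindex s (scl (Poly_Mapping.lookup x i) (alpha (t i))))"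
    unfolding reindex_def[of t] by (rule additive_sum[of "reindex s", OF reindex_add])
  then show ?thesis
    by (simp add: additive_scl[of "reindex s", OF reindex_add] reindex_alpha reindex_def[of "\<lambda>i. s (t i)"])
qed

lemma N_lat_keys: "k \<ge> 1 \<Longrightarrow> x \<in> N_lat k \<Longrightarrow> Poly_Mapping.keys x \<subseteq> {1..k}"
  by (simp add: N_lat_iff)

lemma reindex_cong:
  assumes "k \<ge> 1" "x \<in> N_lat k" "\<And>i. i \<in> {1..k} \<Longrightarrow> s i = t i"
  shows "reindex s x = reindex t x"
  unfolding reindex_def using N_lat_keys[OF assms(1,2)] assms(3) by (intro sum.cong) auto

lemma reindex_id: "reindex (\<lambda>i. i) x = x"
  unfolding reindex_def using vec_expand[of x] by simp

lemma reindex_N_lat: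
  assumes k: "k \<ge> 1" and s: "\<And>i. i \<in> {1..k} \<Longrightarrow> s i \<in> {1..k}" and x: "x \<in> N_lat k"
  shows "reindex s x \<in> N_lat k"
proof -
  have l: "Poly_Mapping.lookup (reindex s x) j =
      (\<Sum>i\<in>{1..k}. if s i = j then Poly_Mapping.lookup x i else 0)" for j
    unfolding reindex_superset[OF _ N_lat_keys[OF k x], simplified]
    by (simp add: lookup_sum lookup_scl alpha_def lookup_single when_def if_distrib cong: if_cong)
  have "(\<Sum>j\<in>{1..k}. Poly_Mapping.lookup (reindex s x) j) =
      (\<Sum>i\<in>{1..k}. \<Sum>j\<in>{1..k}. if s i = j then Poly_Mapping.lookup x i else 0)"
    unfolding l by (rule sum.swap)
  also have "\<dots> = (\<Sum>i\<in>{1..k}. Poly_Mapping.lookup x i)"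
    by (rule sum.cong) (use s in auto)
  also have "\<dots> = 0" using x k by (simp add: N_lat_iff)
  finally have "(\<Sum>j\<in>{1..k}. Poly_Mapping.lookup (reindex s x) j) = 0" .
  moreover have "Poly_Mapping.keys (reindex s x) \<subseteq> {1..k}"
  proof
    fix j assume "j \<in> Poly_Mapping.keys (reindex s x)"
    then have "(\<Sum>i\<in>{1..k}. if s i = j then Poly_Mapping.lookup x i else 0) \<noteq> 0"
      by (simp only: in_keys_iff l not_False_eq_True)
    then obtain i where i: "i \<in> {1..k}" "(if s i = j then Poly_Mapping.lookup x i else 0) \<noteq> 0"
      by (rule sum.not_neutral_contains_not_neutral)
    then show "j \<in> {1..k}" using s[OF i(1)] by (cases "s i = j") auto
  qed
  ultimately show ?thesis using k by (simp add: N_lat_iff)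
qed

lemma lookup_reindex:
  assumes k: "k \<ge> 1" and s: "inj_on s {1..k}" and x: "x \<in> N_lat k" and j: "j \<in> {1..k}"
  shows "Poly_Mapping.lookup (reindex s x) (s j) = Poly_Mapping.lookup x j"
proof -
  have "Poly_Mapping.lookup (reindex s x) (s j) =
      (\<Sum>i\<in>{1..k}. if i = j then Poly_Mapping.lookup x i else 0)"
    unfolding reindex_superset[OF finite_atLeastAtMost N_lat_keys[OF k x]] lookup_sum lookup_scl
  proof (rule sum.cong[OF refl])
    fix i assume "i \<in> {1..k}"
    then have "s i = s j \<longleftrightarrow> i = j" using inj_on_eq_iff[OF s] j by blast
    then show "Poly_Mapping.lookup x i * Poly_Mapping.lookup (alpha (s i)) (s j) =
      (if i = j then Poly_Mapping.lookup x i else 0)"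
      by (cases "i = j") (auto simp: alpha_def lookup_single when_def)
  qed
  then show ?thesis using j by simp
qed

lemma ip_reindex:
  assumes k: "k \<ge> 1" and s: "inj_on s {1..k}" and x: "x \<in> N_lat k" and y: "y \<in> N_lat k"
  shows "ip (reindex s x) (reindex s y) = ip x y"
proof -
  have "ip (reindex s x) (reindex s y) =
      (\<Sum>j\<in>{1..k}. Poly_Mapping.lookup y j * (2 * Poly_Mapping.lookup (reindex s x) (s j)))"
    unfolding reindex_superset[OF finite_atLeastAtMost N_lat_keys[OF k y]] ip_sum_right ip_scl_right ip_alpha ..
  also have "\<dots> = ip x y"
    unfolding ip_superset[OF finite_atLeastAtMost N_lat_keys[OF k x]]
    by (rule sum.cong) (simp_all add: lookup_reindex[OF k s x])
  finally show ?thesis .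
qed

lemma lift_reindex_in_Aut:
  assumes k: "k \<ge> 1" and s: "bij_betw s {1..k} {1..k}"
  shows "lift k (reindex s) \<in> carrier (voa_Aut (V_N k))"
proof -
  let ?t = "inv_into {1..k} s"
  have sk: "s i \<in> {1..k}" "?t i \<in> {1..k}" "s (?t i) = i" "?t (s i) = i" if "i \<in> {1..k}" for i
    using bij_betwE[OF s] bij_betwE[OF bij_betw_inv_into[OF s]] that
      bij_betw_inv_into_right[OF s that] bij_betw_inv_into_left[OF s that] by blast+
  show ?thesis
  proof (rule lift_in_Aut[where g' = "reindex ?t", OF k])
    show "reindex s (reindex ?t x) = x" "reindex ?t (reindex s x) = x" if "x \<in> N_lat k" for x
      unfolding reindex_reindex using reindex_cong[OF k that, of _ "\<lambda>i. i"] sk by (simp_all add: reindex_id)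
    show "ip (reindex s x) (reindex s y) = ip x y" if "x \<in> N_lat k" "y \<in> N_lat k" for x y
      using ip_reindex[OF k _ that] s by (simp add: bij_betw_def)
    note hn = lift_map_hneg[of "reindex s", OF reindex_add] lift_map_mult[of "reindex s", OF reindex_add]
    have a: "lift_map (reindex s) (hneg (alpha i) 1) = hneg (alpha (s i)) 1" for i
      by (simp add: hn cext_alpha reindex_alpha cvec_alpha)
    \<comment> \<open>A permutation of 1, ..., k fixes \<delta> and permutes the squares, so both
      parts of \<open>omega_eq\<close> are invariant.\<close>
    have d: "lift_map (reindex s) (hneg (delta k) 1) = hneg (delta k) 1"
      unfolding delta_def hneg_sum flinear_sum[OF flinear_lift_map] a
      by (rule sum.reindex_bij_betw[OF s])
    show "lift_map (reindex s) (omega k) = omega k"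
      unfolding omega_eq[OF k]
      by (simp only: flinear_csc[OF flinear_lift_map] flinear_minus[OF flinear_lift_map]
          flinear_sum[OF flinear_lift_map] hn(2) a d
          sum.reindex_bij_betw[OF s, of "\<lambda>i. hneg (alpha i) 1 * hneg (alpha i) 1"])
  qed (use sk in \<open>auto simp: reindex_add intro!: reindex_N_lat[OF k]\<close>)
qed

text \<open>The unrestricted form of \<open>exp_zero_mode\<close>, linear on the whole Fock space as
  \<open>VN_symmetry\<close> demands.\<close>

definition charge_scale :: "(nat \<Rightarrow>\<^sub>0 complex) \<Rightarrow> fock \<Rightarrow> fock" where
  "charge_scale h = lin (\<lambda>(M, \<gamma>). csc (exp (ip h (cvec \<gamma>))) (bvec (M, \<gamma>)))"

lemma flinear_charge_scale: "flinear (charge_scale h)"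
  by (simp add: charge_scale_def flinear_lin)

lemma charge_scale_bvec: "charge_scale h (bvec b) = csc (exp (ip h (cvec (snd b)))) (bvec b)"
  by (simp add: charge_scale_def lin_bvec split: prod.splits)

lemma charge_scale_heis_alpha: "charge_scale h (heis (alpha i) m v) = heis (alpha i) m (charge_scale h v)"
proof (rule flinear_eqI[OF flinear_compose[OF flinear_charge_scale flinear_heis]
    flinear_compose[OF flinear_heis flinear_charge_scale]])
  fix b :: basis
  obtain M \<gamma> where b: "b = (M, \<gamma>)" by (cases b)
  consider "m < 0" | "m = 0" | "m > 0" by linarith
  then show "charge_scale h (heis (alpha i) m (bvec b)) = heis (alpha i) m (charge_scale h (bvec b))"
    by cases (simp_all add: b charge_scale_bvec heis_neg heis_zero_bvec heis_alpha_pos hneg_alpha bvec_mult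
        csc_mult_right flinear_csc[OF flinear_charge_scale] flinear_csc[OF flinear_heis] mult_ac)
qed

lemma charge_scale_heis: "charge_scale h (heis h' m v) = heis h' m (charge_scale h v)"
  by (simp add: heis_expand[of h'] flinear_sum[OF flinear_charge_scale] flinear_csc[OF flinear_charge_scale]
      charge_scale_heis_alpha)

lemma charge_scale_evec: "charge_scale h (evec x) = csc (exp (ip h (cvec x))) (evec x)"
  by (simp add: evec_def charge_scale_bvec)

lemma charge_scale_1: "charge_scale h 1 = 1"
  using charge_scale_evec[of h 0] by (simp add: evec_0 cvec_zero ip_zero)

lemma charge_scale_evec_mult:
  "charge_scale h (evec x * v) = csc (exp (ip h (cvec x))) (evec x * charge_scale h v)"
proof (rule flinear_eqI[OF flinear_compose[OF flinear_charge_scale flinear_mult]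
    flinear_compose[OF flinear_scale flinear_compose[OF flinear_mult flinear_charge_scale]]])
  fix b :: basis
  show "charge_scale h (evec x * bvec b) = csc (exp (ip h (cvec x))) (evec x * charge_scale h (bvec b))"
    by (cases b) (simp add: evec_def bvec_mult charge_scale_bvec csc_mult_right cvec_add ip_add_right exp_add)
qed

lemma charge_scale_inverse: "charge_scale (- h) (charge_scale h v) = v"
proof (rule flinear_eqI[OF flinear_compose[OF flinear_charge_scale flinear_charge_scale] flinear_id])
  show "charge_scale (- h) (charge_scale h (bvec b)) = bvec b" for b
    by (simp add: charge_scale_bvec flinear_csc[OF flinear_charge_scale] ip_uminus flip: exp_add)
qed

lemma exp_zero_mode_in_Aut:
  assumes k: "k \<ge> 1"
  shows "exp_zero_mode k h \<in> carrier (voa_Aut (V_N k))"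
proof -
  have sym: "VN_symmetry k (charge_scale h) (\<lambda>h. h) (\<lambda>x. exp (ip h (cvec x))) (\<lambda>x. x)" for h
  proof
    have "charge_scale h (hneg a 1 * hneg a 1) = hneg a 1 * hneg a 1" for a
      using charge_scale_heis[of h a "- 1" "heis a (- 1) 1"] charge_scale_heis[of h a "- 1" 1]
      by (simp add: heis_neg charge_scale_1)
    then show "charge_scale h (omega k) = omega k"
      by (simp only: omega_def flinear_csc[OF flinear_charge_scale] flinear_sum[OF flinear_charge_scale])
  qed (simp_all add: k[simplified] flinear_charge_scale charge_scale_heis charge_scale_evec_mult charge_scale_1)
  interpret VN_symmetry k "charge_scale h" "\<lambda>h. h" "\<lambda>x. exp (ip h (cvec x))" "\<lambda>x. x" by (rule sym)
  have "bij_betw (charge_scale h) (VN k) (VN k)"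
    by (rule bij_betwI[of _ _ _ "charge_scale (- h)"])
       (use VN_symmetry.in_VN[OF sym] charge_scale_inverse[of h] charge_scale_inverse[of "- h"] in auto)
  then show ?thesis
    unfolding exp_zero_mode_def charge_scale_def[symmetric] by (rule in_Aut)
qed

lemma exp_zero_mode_evec: "x \<in> N_lat k \<Longrightarrow> exp_zero_mode k h (evec x) = csc (exp (ip h (cvec x))) (evec x)"
  unfolding exp_zero_mode_def charge_scale_def[symmetric] by (simp add: evec_in_VN charge_scale_evec)

text \<open>Since \<open>x\<close> has coordinate sum \<open>0\<close>, this is \<open>\<langle>\<rho>, x\<rangle> / \<surd>2\<close>.\<close>

definition height :: "nat \<Rightarrow> (nat \<Rightarrow>\<^sub>0 int) \<Rightarrow> int" where
  "height k x = - (\<Sum>i\<in>{1..k}. int i * Poly_Mapping.lookup x i)"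

lemma lookup_map_of_real: "Poly_Mapping.lookup (Poly_Mapping.map of_real r) i = of_real (Poly_Mapping.lookup r i)"
  by transfer (auto simp: when_def)

lemma psi_evec:
  assumes k: "k \<ge> 1" and x: "x \<in> N_lat k"
  shows "psi k (evec x) = csc (cis (2 * pi * of_int (height k x) / of_nat k)) (evec x)"
proof -
  let ?c = "2 * of_real pi * \<i> / (of_real (sqrt 2) * of_nat k) :: complex"
  let ?r = "Poly_Mapping.map of_real (rho k) :: nat \<Rightarrow>\<^sub>0 complex"
  have lrho: "Poly_Mapping.lookup (rho k) i = (real k + 1 - 2 * real i) / (2 * sqrt 2)" if "i \<in> {1..k}" for i
    unfolding rho_eq(1)[OF k] using that by (simp add: lookup_sum lookup_single when_def)
  have lr: "Poly_Mapping.lookup ?r i = of_real (Poly_Mapping.lookup (rho k) i)" for i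
    by (rule lookup_map_of_real)
  have kx: "Poly_Mapping.keys (cvec x) \<subseteq> {1..k}" using N_lat_keys[OF k x] by (simp add: keys_cvec)
  have "ip (cvec x) (scl ?c ?r) = ?c * (\<Sum>i\<in>{1..k}. 2 * of_int (Poly_Mapping.lookup x i) * of_real (Poly_Mapping.lookup (rho k) i))"
    unfolding ip_scl_right ip_superset[OF finite_atLeastAtMost kx] lr lookup_cvec ..
  also have "(\<Sum>i\<in>{1..k}. 2 * of_int (Poly_Mapping.lookup x i) * complex_of_real (Poly_Mapping.lookup (rho k) i)) =
      of_real (\<Sum>i\<in>{1..k}. 2 * of_int (Poly_Mapping.lookup x i) * Poly_Mapping.lookup (rho k) i)"
    by simp
  \<comment> \<open>The i-th coordinate (k + 1 - 2i) / (2 \<surd>2) of \<rho> is split into a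
    constant, which pairs to 0 with x, and a multiple of i, which yields the height.\<close>
  also have "(\<Sum>i\<in>{1..k}. 2 * of_int (Poly_Mapping.lookup x i) * Poly_Mapping.lookup (rho k) i) =
      (\<Sum>i\<in>{1..k}. (real k + 1) / sqrt 2 * of_int (Poly_Mapping.lookup x i) - sqrt 2 * (real i * of_int (Poly_Mapping.lookup x i)))"
  proof (rule sum.cong[OF refl])
    fix i assume i: "i \<in> {1..k}"
    have "2 / sqrt 2 = sqrt 2" by (simp add: real_div_sqrt)
    moreover have "2 * a * ((c - 2 * b) / (2 * r)) = c / r * a - 2 / r * (b * a)" for a b c r :: real
      by (cases "r = 0") (simp_all add: field_simps)
    ultimately show "2 * of_int (Poly_Mapping.lookup x i) * Poly_Mapping.lookup (rho k) i =
      (real k + 1) / sqrt 2 * of_int (Poly_Mapping.lookup x i) - sqrt 2 * (real i * of_int (Poly_Mapping.lookup x i))"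
      unfolding lrho[OF i] by (simp only:)
  qed
  also have "\<dots> = sqrt 2 * of_int (height k x)"
  proof -
    have "(\<Sum>i\<in>{1..k}. real_of_int (Poly_Mapping.lookup x i)) = 0"
      using x k by (simp add: N_lat_iff flip: of_int_sum)
    then show ?thesis
      unfolding sum_subtractf sum_distrib_left[symmetric] by (simp add: height_def)
  qed
  finally have "ip (scl ?c ?r) (cvec x) = ?c * of_real (sqrt 2 * of_int (height k x))"
    by (simp only: ip_commute)
  also have "\<dots> = \<i> * of_real (2 * pi * of_int (height k x) / of_nat k)"
    by simp
  finally show ?thesis
    unfolding psi_def exp_zero_mode_evec[OF x] by (simp only: cis_conv_exp)
qed

section \<open>The elements of the normalizer\<close>

lemma idx_range: "k \<ge> 1 \<Longrightarrow> idx k m \<in> {1..k}"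
proof -
  assume k: "k \<ge> 1"
  then have "0 \<le> (m - 1) mod int k" "(m - 1) mod int k < int k" by simp_all
  then show ?thesis by (auto simp: idx_def)
qed

lemma idx_eq_iff: "k \<ge> 1 \<Longrightarrow> idx k m = idx k n \<longleftrightarrow> [m = n] (mod int k)"
proof -
  assume k: "k \<ge> 1"
  then have "idx k m = idx k n \<longleftrightarrow> (m - 1) mod int k = (n - 1) mod int k"
    by (simp add: idx_def nat_eq_iff)
  also have "\<dots> \<longleftrightarrow> [m = n] (mod int k)"
    by (simp add: cong_def mod_eq_dvd_iff)
  finally show ?thesis .
qed

lemma idx_cong: "[int (idx k m) = m] (mod int k)" if "k \<ge> 1"
proof -
  have "int (idx k m) = (m - 1) mod int k + 1" using that by (simp add: idx_def)
  then show ?thesis by (simp add: cong_def mod_simps)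
qed

lemma idx_int: "i \<in> {1..k} \<Longrightarrow> idx k (int i) = i"
  by (cases i) (auto simp: idx_def)

text \<open>One family containing the cycle (s = 1, c = 1) and the multiplications (c = 0). The
  residue 0 is represented by the index k.\<close>

definition aff :: "nat \<Rightarrow> int \<Rightarrow> int \<Rightarrow> nat \<Rightarrow> nat" where
  "aff k s c i = idx k (s * int i + c)"

lemma aff_idx: "k \<ge> 1 \<Longrightarrow> aff k s c (idx k m) = idx k (s * m + c)"
  unfolding aff_def by (simp add: idx_eq_iff cong_add cong_mult idx_cong)

lemma aff_range: "k \<ge> 1 \<Longrightarrow> aff k s c i \<in> {1..k}"
  by (simp only: aff_def idx_range)

lemma aff_bij:
  assumes k: "k \<ge> 1" and s: "coprime s (int k)"
  shows "bij_betw (aff k s c) {1..k} {1..k}"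
proof -
  have "inj_on (aff k s c) {1..k}"
  proof (rule inj_onI)
    fix i j assume ij: "i \<in> {1..k}" "j \<in> {1..k}" "aff k s c i = aff k s c j"
    then have "[s * int i + c = s * int j + c] (mod int k)" by (simp only: aff_def idx_eq_iff[OF k])
    then have "[int i = int j] (mod int k)"
      using cong_mult_lcancel[OF s] by (simp add: cong_add_rcancel)
    then have "idx k (int i) = idx k (int j)" by (simp only: idx_eq_iff[OF k])
    then show "i = j" using ij by (simp add: idx_int)
  qed
  then show ?thesis
    unfolding bij_betw_def using endo_inj_surj[of "{1..k}" "aff k s c"] aff_range[OF k] by blast
qed

definition zeta :: "nat \<Rightarrow> int \<Rightarrow> complex" where
  "zeta k n = cis (2 * pi * of_int n / of_nat k)"

section \<open>Roots of unity\<close>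

lemma zeta_add: "zeta k (m + n) = zeta k m * zeta k n"
  by (simp add: zeta_def cis_mult add_divide_distrib distrib_left)

lemma zeta_0: "zeta k 0 = 1"
  by (simp add: zeta_def)

lemma zeta_neq_0: "zeta k n \<noteq> 0"
  by (simp add: zeta_def)

lemma zeta_cong:
  assumes k: "k \<ge> 1" and mn: "[m = n] (mod int k)"
  shows "zeta k m = zeta k n"
proof -
  obtain l where l: "n = m + int k * l" using mn by (auto simp: cong_iff_lin)
  have "2 * pi * of_int (int k * l) / of_nat k = 2 * pi * of_int l" using k by simp
  then have "zeta k (int k * l) = cis (2 * pi * of_int l)" by (simp only: zeta_def)
  also have "\<dots> = 1" by (rule cis_multiple_2pi) simp
  finally show ?thesis unfolding l zeta_add by simp
qed

lemma zeta_eq_1: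
  assumes k: "k \<ge> 1" and z: "zeta k n = 1"
  shows "[n = 0] (mod int k)"
proof -
  have "0 \<le> n mod int k" "n mod int k < int k" using k by simp_all
  then obtain m where m: "m < k" "int m = n mod int k" by (metis nat_int nonneg_int_cases of_nat_less_iff)
  have "zeta k (int m) = 1" using zeta_cong[OF k, of "int m" n] z m by (simp add: cong_def)
  then have "cis (2 * pi * real m / real k) = cis (2 * pi * real 0 / real k)" by (simp add: zeta_def)
  then have "m = 0"
    using bij_betw_roots_unity[of k] k m(1) by (auto simp: bij_betw_def inj_on_def)
  then show ?thesis using m by (simp add: cong_def)
qed

lemma root_of_unity_zeta: "k \<ge> 1 \<Longrightarrow> z ^ k = 1 \<Longrightarrow> \<exists>m. z = zeta k m"
proof -
  assume "k \<ge> 1" "z ^ k = 1"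
  then have "z \<in> (\<lambda>m. cis (2 * pi * real m / real k)) ` {..<k}"
    using bij_betw_imp_surj_on[OF bij_betw_roots_unity[of k]] by auto
  then obtain m where "z = cis (2 * pi * real m / real k)" by blast
  then have "z = zeta k (int m)" by (simp add: zeta_def)
  then show ?thesis ..
qed

lemma N_lat_induct [consumes 2, case_names zero add uminus beta]:
  assumes "k \<ge> 1" "x \<in> N_lat k" "P 0"
    "\<And>x y. x \<in> N_lat k \<Longrightarrow> y \<in> N_lat k \<Longrightarrow> P x \<Longrightarrow> P y \<Longrightarrow> P (x + y)"
    "\<And>x. x \<in> N_lat k \<Longrightarrow> P x \<Longrightarrow> P (- x)"
    "\<And>i. i \<in> {1..k-1} \<Longrightarrow> P (beta i)"
  shows "P x"
proof -
  obtain c where x: "x = (\<Sum>i\<in>{1..k-1}. scl (c i) (beta i))"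
    using assms(2) unfolding N_lat_def beta_span_def by blast
  have nat: "P (scl (int n) (beta i)) \<and> scl (int n) (beta i) \<in> N_lat k" if "i \<in> {1..k-1}" for n i
  proof (induction n)
    case 0
    show ?case using assms(3) N_lat_closed(1)[OF assms(1)] by (simp add: poly_mapping_map_trivial)
  next
    case (Suc n)
    have "scl (int (Suc n)) (beta i :: nat \<Rightarrow>\<^sub>0 int) = beta i + scl (int n) (beta i)"
      by (rule poly_mapping_eqI) (simp add: lookup_scl lookup_add algebra_simps)
    moreover have "(beta i :: nat \<Rightarrow>\<^sub>0 int) \<in> N_lat k" using beta_in_span[OF that] by (simp add: N_lat_def)
    ultimately show ?case using Suc assms(4,6) that N_lat_closed(2)[OF assms(1)] by simp
  qed
  have b: "P (scl n (beta i)) \<and> scl n (beta i) \<in> N_lat k" if "i \<in> {1..k-1}" for n i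
  proof (cases n rule: int_cases2)
    case (nonpos m)
    then show ?thesis using nat[OF that, of m] assms(5) N_lat_closed(3)[OF assms(1)]
      by (simp add: poly_mapping_scl_simps)
  qed (use nat[OF that] in simp)
  have "P (\<Sum>i\<in>A. scl (c i) (beta i)) \<and> (\<Sum>i\<in>A. scl (c i) (beta i)) \<in> N_lat k" if "A \<subseteq> {1..k-1}" for A
    using that
    by (induction A rule: infinite_finite_induct) (simp_all add: assms(3,4) b N_lat_closed[OF assms(1)])
  then show ?thesis unfolding x by blast
qed

lemma alpha_diff_in_N_lat: "i \<in> {1..k} \<Longrightarrow> j \<in> {1..k} \<Longrightarrow> alpha i - alpha j \<in> N_lat k"
proof -
  assume ij: "i \<in> {1..k}" "j \<in> {1..k}"
  have l: "Poly_Mapping.lookup (alpha i - alpha j :: nat \<Rightarrow>\<^sub>0 int) l = (if l = i then 1 else 0) - (if l = j then 1 else 0)" for l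
    by (simp add: alpha_def lookup_minus lookup_single when_def)
  show ?thesis
    by (subst N_lat_iff) (use ij in \<open>auto simp: in_keys_iff l sum_subtractf split: if_splits\<close>)
qed

lemma alpha_diff_eq:
  assumes "alpha i - alpha j = (alpha p - alpha q :: nat \<Rightarrow>\<^sub>0 int)" "i \<noteq> j"
  shows "p = i" "q = j"
proof -
  have "Poly_Mapping.lookup (alpha i - alpha j :: nat \<Rightarrow>\<^sub>0 int) l = Poly_Mapping.lookup (alpha p - alpha q) l" for l
    using assms(1) by simp
  from this[of i] this[of j] assms(2) show "p = i" "q = j"
    by (auto simp: alpha_def lookup_minus lookup_single when_def split: if_splits)
qed

lemma reindex_alpha_diff: "reindex s (alpha i - alpha j) = alpha (s i) - alpha (s j)"
  using reindex_add[of s "alpha i - alpha j" "alpha j"] by (simp add: reindex_alpha)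

lemma reindex_uminus: "reindex s (- x) = - reindex s x"
  using reindex_add[of s x "- x"] by (simp add: reindex_def eq_neg_iff_add_eq_0 add.commute)

lemma height_add: "height k (x + y) = height k x + height k y"
  by (simp add: height_def lookup_add algebra_simps sum.distrib)

lemma height_uminus: "height k (- x) = - height k x"
  by (simp add: height_def sum_negf)

lemma height_beta: "i \<in> {1..k-1} \<Longrightarrow> height k (beta i) = 1"
proof -
  assume i: "i \<in> {1..k-1}"
  have "(\<Sum>j\<in>{1..k}. int j * Poly_Mapping.lookup (beta i) j) =
      (\<Sum>j\<in>{1..k}. (if j = i then int i else 0) - (if j = Suc i then int (Suc i) else 0))"
    by (rule sum.cong) (auto simp: lookup_beta)
  also have "\<dots> = int i - int (Suc i)" using i by (subst sum_subtractf) auto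
  finally show ?thesis by (simp add: height_def)
qed

text \<open>The height of \<alpha>_p - \<alpha>_q is q - p, so an affine map multiplies it by s, up
  to multiples of k caused by reducing the indices. This governs how affine lifts conjugate \<psi>;
  for s = 1 they commute with it.\<close>

lemma height_reindex:
  assumes k: "k \<ge> 1" and x: "x \<in> N_lat k"
  shows "[height k (reindex (aff k s c) x) = s * height k x] (mod int k)"
  using k x
proof (induction rule: N_lat_induct)
  case zero
  then show ?case by (simp add: reindex_def height_def)
next
  case (add x y)
  then show ?case by (simp add: reindex_add height_add distrib_left cong_add)
next
  case (uminus x)
  then show ?case by (simp add: reindex_uminus height_uminus cong_minus_minus_iff)
next
  case (beta i)
  have h: "height k (alpha p - alpha q) = int q - int p" if "p \<in> {1..k}" "q \<in> {1..k}" for p q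
  proof -
    have "(\<Sum>j\<in>{1..k}. int j * Poly_Mapping.lookup (alpha p - alpha q) j) =
      (\<Sum>j\<in>{1..k}. (if j = p then int p else 0) - (if j = q then int q else 0))"
      by (rule sum.cong) (auto simp: alpha_def lookup_minus lookup_single when_def)
    also have "\<dots> = int p - int q" using that by (subst sum_subtractf) auto
    finally show ?thesis by (simp add: height_def)
  qed
  have "height k (reindex (aff k s c) (beta i)) = int (aff k s c (Suc i)) - int (aff k s c i)"
    unfolding beta_def reindex_alpha_diff Suc_eq_plus1 by (rule h[OF aff_range[OF k] aff_range[OF k]])
  also have "[\<dots> = (s * int (Suc i) + c) - (s * int i + c)] (mod int k)"
    unfolding aff_def by (intro cong_diff idx_cong[OF k])
  also have "(s * int (Suc i) + c) - (s * int i + c) = s * height k (beta i)"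
    using height_beta[OF beta] by (simp add: algebra_simps)
  finally show ?case .
qed

text \<open>The squares of the coordinates sum to 2, so all coordinates are 0, 1 or -1. Comparing
  the number of 1 and -1 entries via coordinate sum 0 leaves one of each.\<close>

lemma norm_four_vector:
  assumes k: "k \<ge> 1" and x: "x \<in> N_lat k" and ip: "ip x x = 4"
  shows "\<exists>p\<in>{1..k}. \<exists>q\<in>{1..k}. p \<noteq> q \<and> x = alpha p - alpha q"
proof -
  let ?l = "Poly_Mapping.lookup x"
  have sum0: "(\<Sum>i\<in>{1..k}. ?l i) = 0" and keys: "Poly_Mapping.keys x \<subseteq> {1..k}"
    using x k by (simp_all add: N_lat_iff)
  have "ip x x = 2 * (\<Sum>i\<in>{1..k}. ?l i ^ 2)"
    by (simp add: ip_superset[OF finite_atLeastAtMost keys] sum_distrib_left power2_eq_square mult.assoc)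
  with ip have sq: "(\<Sum>i\<in>{1..k}. ?l i ^ 2) = 2" by simp
  have bound: "?l i ^ 2 \<le> 2" if "i \<in> {1..k}" for i
    using member_le_sum[OF that, of "\<lambda>i. ?l i ^ 2"] sq by simp
  have abs1: "\<bar>?l i\<bar> \<le> 1" if "i \<in> {1..k}" for i
  proof (rule ccontr)
    assume "\<not> \<bar>?l i\<bar> \<le> 1"
    then have "2 * 2 \<le> \<bar>?l i\<bar> * \<bar>?l i\<bar>" by (intro mult_mono) auto
    with bound[OF that] show False by (simp add: power2_eq_square)
  qed
  then have vals: "?l i = 0 \<or> ?l i = 1 \<or> ?l i = - 1" if "i \<in> {1..k}" for i
    using abs1[OF that] by auto
  define A B where "A = {i \<in> {1..k}. ?l i = 1}" and "B = {i \<in> {1..k}. ?l i = - 1}"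
  have "(\<Sum>i\<in>{1..k}. ?l i) = (\<Sum>i\<in>{1..k}. (if ?l i = 1 then 1 else 0) - (if ?l i = - 1 then 1 else 0))"
    by (rule sum.cong) (use vals in fastforce)+
  then have d: "int (card A) - int (card B) = 0"
    using sum0 by (simp add: sum_subtractf A_def B_def Int_def flip: sum.inter_filter)
  have "(\<Sum>i\<in>{1..k}. ?l i ^ 2) = (\<Sum>i\<in>{1..k}. (if ?l i = 1 then 1 else 0) + (if ?l i = - 1 then 1 else 0))"
    by (rule sum.cong) (use vals in fastforce)+
  then have "int (card A) + int (card B) = 2"
    using sq by (simp add: sum.distrib A_def B_def Int_def flip: sum.inter_filter)
  with d have "card A = 1" "card B = 1" by linarith+
  then obtain p q where pq: "A = {p}" "B = {q}" by (metis card_1_singletonE)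
  then have p: "p \<in> {1..k}" "?l p = 1" and q: "q \<in> {1..k}" "?l q = - 1"
    unfolding A_def B_def by blast+
  have "x = alpha p - alpha q"
  proof (rule poly_mapping_eqI)
    fix i
    have r: "Poly_Mapping.lookup (alpha p - alpha q) i = (if i = p then 1 else 0) - (if i = q then 1 else 0)"
      by (simp add: alpha_def lookup_minus lookup_single when_def)
    show "?l i = Poly_Mapping.lookup (alpha p - alpha q) i"
    proof (cases "i \<in> {1..k}")
      case True
      then have "i \<in> A \<longleftrightarrow> ?l i = 1" "i \<in> B \<longleftrightarrow> ?l i = - 1" by (simp_all add: A_def B_def)
      then have "i = p \<longleftrightarrow> ?l i = 1" "i = q \<longleftrightarrow> ?l i = - 1" unfolding pq by simp_all
      with vals[OF True] show ?thesis unfolding r by fastforce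
    next
      case False
      then have "?l i = 0" "i \<noteq> p" "i \<noteq> q"
        using keys p(1) q(1) by (auto simp only: in_keys_iff subset_iff)
      then show ?thesis unfolding r by simp
    qed
  qed
  with p q show ?thesis by (metis one_neq_neg_one)
qed

section \<open>Isometries and characters compatible with the k-cycle\<close>

lemma ip_alpha_diff: "ip (alpha a - alpha b) (alpha c - alpha d) =
    (if a = c then 2 else 0) - (if a = d then 2 else 0) - (if b = c then 2 else 0) + (if b = d then 2 else (0::int))"
  by (simp add: ip_diff ip_alpha_left) (simp add: alpha_def lookup_single when_def)

lemma N_lat_definite:
  assumes k: "k \<ge> 1" and x: "x \<in> N_lat k" and ip: "ip x x = 0"
  shows "x = 0"
proof (rule ccontr)
  assume "x \<noteq> 0"
  then have "(\<Sum>i\<in>{1..k}. Poly_Mapping.lookup x i ^ 2) \<ge> 2" by (rule N_lat_norm[OF k x])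
  moreover have "ip x x = 2 * (\<Sum>i\<in>{1..k}. Poly_Mapping.lookup x i ^ 2)"
    by (simp only: ip_superset[OF finite_atLeastAtMost N_lat_keys[OF k x]] sum_distrib_left power2_eq_square mult.assoc)
  ultimately show False using ip by simp
qed

lemma scl_zero_right: "scl a 0 = 0"
  by (rule poly_mapping_eqI) (simp add: lookup_scl)

text \<open>The orbit of \<beta>_1 under the cycle generates N, so f is determined by f \<beta>_1
  and t. Coprimality of t is obtained here too, from injectivity of f.\<close>

lemma lattice_isometry_intertwining:
  assumes k: "k \<ge> 3"
    and f: "\<And>x. x \<in> N_lat k \<Longrightarrow> f x \<in> N_lat k" "\<And>x y. x \<in> N_lat k \<Longrightarrow> y \<in> N_lat k \<Longrightarrow> f (x + y) = f x + f y"
      "\<And>x y. x \<in> N_lat k \<Longrightarrow> y \<in> N_lat k \<Longrightarrow> ip (f x) (f y) = ip x y"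
    and comm: "\<And>x. x \<in> N_lat k \<Longrightarrow> f (reindex (aff k 1 1) x) = reindex (aff k 1 t) (f x)"
  shows "coprime t (int k) \<and> (\<exists>c. (\<forall>x\<in>N_lat k. f x = reindex (aff k t c) x) \<or>
    (\<forall>x\<in>N_lat k. f x = - reindex (aff k t c) x))"
proof -
  have k1: "k \<ge> 1" using k by simp
  have f0: "f 0 = 0" using f(2)[of 0 0] N_lat_closed(1)[OF k1] by simp
  have fu: "f (- x) = - f x" if "x \<in> N_lat k" for x
    using f(2)[OF that N_lat_closed(3)[OF k1 that]] f0 by (simp add: eq_neg_iff_add_eq_0 add.commute)
  \<comment> \<open>A cyclic continuation of the simple vectors: \<open>b i\<close> is \<beta>_i for
    1 \<le> i < k, and \<open>b k\<close> = \<alpha>_k - \<alpha>_1 closes the cycle.\<close>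
  define b where "b i = (alpha (idx k i) - alpha (idx k (i + 1)) :: nat \<Rightarrow>\<^sub>0 int)" for i
  have bN: "b i \<in> N_lat k" for i unfolding b_def by (intro alpha_diff_in_N_lat idx_range k1)
  have bnu: "reindex (aff k 1 m) (b i) = b (i + m)" for i m
    by (simp add: b_def reindex_alpha_diff aff_idx[OF k1] algebra_simps)
  have fb: "f (b (1 + int n)) = reindex (aff k 1 (t * int n)) (f (b 1))" for n
  proof (induction n)
    case 0
    have "reindex (aff k 1 0) (f (b 1)) = reindex (\<lambda>i. i) (f (b 1))"
      by (rule reindex_cong[OF k1 f(1)[OF bN]]) (simp add: aff_def idx_int)
    then show ?case by (simp add: reindex_id)
  next
    case (Suc n)
    have "f (b (1 + int (Suc n))) = f (reindex (aff k 1 1) (b (1 + int n)))" by (simp add: bnu algebra_simps)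
    also have "\<dots> = reindex (aff k 1 t) (reindex (aff k 1 (t * int n)) (f (b 1)))" by (simp add: comm bN Suc)
    also have "\<dots> = reindex (aff k 1 (t * int (Suc n))) (f (b 1))"
      unfolding reindex_reindex
      by (rule reindex_cong[OF k1 f(1)[OF bN]]) (simp add: aff_idx[OF k1] aff_def[of k 1 "t * int n"], simp add: aff_def algebra_simps)
    finally show ?case .
  qed
  have i123: "idx k 1 = 1" "idx k 2 = 2" "idx k 3 = 3" using k by (simp_all add: idx_def nat_mod_distrib[symmetric])
  have b1: "b 1 = alpha 1 - alpha 2" and b2: "b 2 = alpha 2 - alpha 3"
    by (simp_all add: b_def i123)
  have "ip (f (b 1)) (f (b 1)) = 4" by (simp add: f(3) bN, simp add: b1 ip_alpha_diff)
  then obtain p q where pq: "p \<in> {1..k}" "q \<in> {1..k}" "p \<noteq> q" "f (b 1) = alpha p - alpha q"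
    using norm_four_vector[OF k1 f(1)[OF bN]] by blast
  have fbn: "f (b (1 + int n)) = alpha (idx k (int p + t * int n)) - alpha (idx k (int q + t * int n))" for n
    unfolding fb pq(4) reindex_alpha_diff by (simp add: aff_def)
  have "ip (f (b 1)) (f (b 2)) = - 2" by (simp add: f(3) bN, simp add: b1 b2 ip_alpha_diff)
  then have ip: "ip (alpha p - alpha q) (alpha (idx k (int p + t)) - alpha (idx k (int q + t))) = (- 2 :: int)"
    using fbn[of 1] pq(4) by simp
  have idx_iff: "i = idx k m \<longleftrightarrow> [int i = m] (mod int k)" if "i \<in> {1..k}" for i m
    using idx_eq_iff[OF k1, of "int i" m] idx_int[OF that] by simp
  have pt: "p = idx k (int p + t) \<longleftrightarrow> [t = 0] (mod int k)" "q = idx k (int q + t) \<longleftrightarrow> [t = 0] (mod int k)"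
    unfolding idx_iff[OF pq(1)] idx_iff[OF pq(2)]
    by (auto simp: cong_iff_dvd_diff dvd_minus_iff)
  \<comment> \<open>The matches of p with p + t and of q with q + t contribute positively to the
    product. The value -2 thus needs a crossed match.\<close>
  have cases: "q = idx k (int p + t) \<or> p = idx k (int q + t)"
    using ip pt by (auto simp: ip_alpha_diff split: if_splits)
  have ex: "\<exists>c. \<exists>e\<in>{1, - 1}. \<forall>n. f (b (1 + int n)) = scl e (reindex (aff k t c) (b (1 + int n)))"
    using cases
  proof
    assume q: "q = idx k (int p + t)"
    have "idx k (int q + t * int n) = idx k (int p + t + t * int n)" for n
      unfolding idx_eq_iff[OF k1] q by (intro cong_add idx_cong k1 cong_refl)
    \<comment> \<open>The shift is p - t because the affine map has to send the index 1 to p; in the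
      other case it sends 1 to q and a sign appears.\<close>
    then have "f (b (1 + int n)) = reindex (aff k t (int p - t)) (b (1 + int n))" for n
      unfolding fbn by (simp add: b_def reindex_alpha_diff aff_idx[OF k1] algebra_simps)
    then show ?thesis
      by (intro exI[of _ "int p - t"] bexI[of _ 1]) (simp_all add: poly_mapping_scl_simps poly_mapping_map_trivial)
  next
    assume p: "p = idx k (int q + t)"
    have "idx k (int p + t * int n) = idx k (int q + t + t * int n)" for n
      unfolding idx_eq_iff[OF k1] p by (intro cong_add idx_cong k1 cong_refl)
    then have "f (b (1 + int n)) = - reindex (aff k t (int q - t)) (b (1 + int n))" for n
      unfolding fbn by (simp add: b_def reindex_alpha_diff aff_idx[OF k1] algebra_simps)
    then show ?thesis
      by (intro exI[of _ "int q - t"] bexI[of _ "- 1"]) (simp_all add: poly_mapping_scl_simps poly_mapping_map_trivial)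
  qed
  then obtain c e where e: "e \<in> {1, - 1}"
    and fc: "\<And>n. f (b (1 + int n)) = scl e (reindex (aff k t c) (b (1 + int n)))" by blast
  have fx: "f x = scl e (reindex (aff k t c) x)" if "x \<in> N_lat k" for x
    using k1 that
  proof (induction rule: N_lat_induct)
    case zero
    show ?case using f0 scl_zero_right[of e] by (simp add: reindex_def)
  next
    case (add x y)
    then show ?case by (simp add: f(2) reindex_add poly_mapping_scl_simps)
  next
    case (uminus x)
    then show ?case by (simp add: fu reindex_uminus) (rule poly_mapping_eqI, simp add: lookup_scl)
  next
    case (beta i)
    have "b (1 + int (i - 1)) = beta i"
    proof -
      have "1 + int (i - 1) = int i" "int i + 1 = int (Suc i)" using beta by auto
      then show ?thesis using beta by (simp only: b_def beta_def) (simp add: idx_int del: of_nat_Suc)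
    qed
    with fc[of "i - 1"] show ?case by simp
  qed
  have "coprime t (int k)"
  proof -
    \<comment> \<open>With k' = k / d, the number t k' is a multiple of k, so f takes the same value
      on b (1 + k') and b 1. Definiteness of the form makes f injective, hence k divides k' and d =
      1.\<close>
    define d where "d = gcd t (int k)"
    have d: "d dvd t" "d dvd int k" "d > 0" using k by (auto simp: d_def)
    define k' where "k' = nat (int k div d)"
    have k': "int k = d * int k'" using d by (auto simp: k'_def pos_imp_zdiv_nonneg_iff)
    obtain t' where t': "t = d * t'" using d(1) by blast
    have "t * int k' = int k * t'" unfolding k' t' by (simp add: algebra_simps)
    then have tk: "[t * (1 + int k' + m) + c = t * (1 + m) + c] (mod int k)" for m
      by (simp add: cong_iff_dvd_diff algebra_simps)
    have "f (b (1 + int k')) = f (b 1)"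
      using fc[of k'] fc[of 0] tk[of 0] tk[of 1] by (simp add: b_def reindex_alpha_diff aff_idx[OF k1] idx_eq_iff[OF k1, THEN iffD2] add_ac)
    moreover define w where "w = b (1 + int k') + - b 1"
    ultimately have fw: "f w = 0"
      unfolding w_def f(2)[OF bN N_lat_closed(3)[OF k1 bN]] fu[OF bN] by simp
    have wN: "w \<in> N_lat k" unfolding w_def by (intro N_lat_closed k1 bN)
    have "ip w w = 0" using f(3)[OF wN wN] fw by (simp add: ip_zero)
    then have "w = 0" by (rule N_lat_definite[OF k1 wN])
    then have "b 1 = b (1 + int k')" by (simp add: w_def)
    then have "idx k (1 + int k') = idx k 1"
      unfolding b_def by (rule alpha_diff_eq) (use i123 in simp)
    then have "[1 + int k' = 1] (mod int k)" by (simp only: idx_eq_iff[OF k1])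
    then have "int k dvd int k'" by (simp add: cong_iff_dvd_diff)
    moreover have "k' > 0" using k' k by (cases k') auto
    ultimately have "int k \<le> int k'" by (intro zdvd_imp_le) auto
    then have "d * int k' \<le> 1 * int k'" using k' by simp
    then have "d \<le> 1" using \<open>k' > 0\<close> by (simp add: mult_le_cancel_right)
    with d(3) have "d = 1" by simp
    then show ?thesis by (simp add: d_def coprime_iff_gcd_eq_1)
  qed
  moreover have "(\<forall>x\<in>N_lat k. f x = reindex (aff k t c) x) \<or> (\<forall>x\<in>N_lat k. f x = - reindex (aff k t c) x)"
    using e fx by (auto simp: poly_mapping_scl_simps poly_mapping_map_trivial)
  ultimately show ?thesis by blast
qed

lemma nu_invariant_character:
  assumes k: "k \<ge> 3"
    and chi: "\<And>x y. x \<in> N_lat k \<Longrightarrow> y \<in> N_lat k \<Longrightarrow> \<chi> (x + y) = \<chi> x * \<chi> y" "\<And>x. x \<in> N_lat k \<Longrightarrow> \<chi> x \<noteq> (0::complex)"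
    and inv: "\<And>x. x \<in> N_lat k \<Longrightarrow> \<chi> (reindex (aff k 1 1) x) = \<chi> x"
  shows "\<exists>m. \<forall>x\<in>N_lat k. \<chi> x = zeta k (m * height k x)"
proof -
  have k1: "k \<ge> 1" using k by simp
  have chi0: "\<chi> 0 = 1" using chi(1)[of 0 0] chi(2)[of 0] N_lat_closed(1)[OF k1] by simp
  have chiu: "\<chi> (- x) = inverse (\<chi> x)" if "x \<in> N_lat k" for x
    using chi(1)[OF that N_lat_closed(3)[OF k1 that]] chi0 chi(2)[OF that] by (simp add: field_simps)
  define b where "b i = (alpha (idx k i) - alpha (idx k (i + 1)) :: nat \<Rightarrow>\<^sub>0 int)" for i
  have bN: "b i \<in> N_lat k" for i unfolding b_def by (intro alpha_diff_in_N_lat idx_range k1)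
  define z where "z = \<chi> (b 1)"
  have zb: "\<chi> (b (1 + int n)) = z" for n
  proof (induction n)
    case (Suc n)
    have "b (1 + int (Suc n)) = reindex (aff k 1 1) (b (1 + int n))"
      by (simp add: b_def reindex_alpha_diff aff_idx[OF k1] algebra_simps)
    then show ?case using inv[OF bN] Suc by simp
  qed (simp add: z_def)
  \<comment> \<open>A telescoping sum of n consecutive vectors b; at n = k the vector on the left is
    0.\<close>
  have "\<chi> (alpha (idx k 1) - alpha (idx k (1 + int n))) = z ^ n" for n
  proof (induction n)
    case (Suc n)
    have eq: "alpha (idx k 1) - alpha (idx k (1 + int (Suc n))) = (alpha (idx k 1) - alpha (idx k (1 + int n))) + b (1 + int n)"
      by (simp add: b_def add_ac)
    have N: "alpha (idx k 1) - alpha (idx k (1 + int n)) \<in> N_lat k"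
      by (intro alpha_diff_in_N_lat idx_range k1)
    show ?case unfolding eq chi(1)[OF N bN] zb Suc by simp
  qed (simp add: chi0)
  from this[of k] have "z ^ k = 1"
    using idx_eq_iff[OF k1, of "1 + int k" 1] chi0 by (simp add: cong_def)
  then obtain m where m: "z = zeta k m" using root_of_unity_zeta[OF k1] by blast
  have "\<chi> x = zeta k (m * height k x)" if "x \<in> N_lat k" for x
    using k1 that
  proof (induction rule: N_lat_induct)
    case zero
    show ?case by (simp add: chi0 height_def zeta_0)
  next
    case (add x y)
    then show ?case by (simp add: chi(1) height_add distrib_left zeta_add)
  next
    case (uminus x)
    have "zeta k (m * height k x) * zeta k (- (m * height k x)) = 1"
      unfolding zeta_add[symmetric] by (simp add: zeta_0)
    then show ?case using uminus by (simp add: chiu height_uminus inverse_unique)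
  next
    case (beta i)
    have "b (1 + int (i - 1)) = beta i"
    proof -
      have "1 + int (i - 1) = int i" "int i + 1 = int (Suc i)" using beta by auto
      then show ?thesis using beta by (simp only: b_def beta_def) (simp add: idx_int del: of_nat_Suc)
    qed
    then show ?case using zb[of "i - 1"] height_beta[OF beta] m by simp
  qed
  then show ?thesis by blast
qed

section \<open>Group structure\<close>

lemma set_mult_iff: "x \<in> A <#>\<^bsub>G\<^esub> B \<longleftrightarrow> (\<exists>a\<in>A. \<exists>b\<in>B. x = a \<otimes>\<^bsub>G\<^esub> b)"
  by (auto simp: set_mult_def)

lemma bex_set_mult_iff: "(\<exists>x\<in>A <#>\<^bsub>G\<^esub> B. Q x) \<longleftrightarrow> (\<exists>a\<in>A. \<exists>b\<in>B. Q (a \<otimes>\<^bsub>G\<^esub> b))"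
  by (auto simp: set_mult_def)

lemma (in group) normal_in_subgroupI:
  assumes A: "subgroup A G" and E: "subgroup E G" and AE: "A \<subseteq> E"
    and conj: "\<And>x a. x \<in> E \<Longrightarrow> a \<in> A \<Longrightarrow> \<exists>a'\<in>A. x \<otimes> a = a' \<otimes> x"
  shows "A \<lhd> G\<lparr>carrier := E\<rparr>"
proof -
  interpret E: group "G\<lparr>carrier := E\<rparr>" by (rule subgroup_imp_group[OF E])
  have "x \<otimes> a \<otimes> inv x \<in> A" if x: "x \<in> E" and a: "a \<in> A" for x a
  proof -
    obtain a' where a': "a' \<in> A" "x \<otimes> a = a' \<otimes> x" using conj[OF x a] by blast
    have "x \<in> carrier G" "a' \<in> carrier G"
      using x a'(1) subgroup.mem_carrier[OF E] subgroup.mem_carrier[OF A] by blast+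
    then have "x \<otimes> a \<otimes> inv x = a'" unfolding a'(2) by (simp add: m_assoc)
    with a' show ?thesis by simp
  qed
  moreover have "inv\<^bsub>G\<lparr>carrier := E\<rparr>\<^esub> x = inv x" if "x \<in> E" for x
    using m_inv_consistent[OF E that] .
  ultimately show ?thesis
    unfolding E.normal_inv_iff using subgroup_incl[OF A E AE] by simp
qed

text \<open>The exchange rule b a = a' b sorts any product of elements a b, which makes the product
  set a subgroup and A normal in it. It is phrased without inverses because the relations for
  automorphisms are obtained in this form.\<close>

lemma (in group) split_extensionI:
  assumes A: "subgroup A G" and B: "subgroup B G"
    and conj: "\<And>a b. a \<in> A \<Longrightarrow> b \<in> B \<Longrightarrow> \<exists>a'\<in>A. b \<otimes> a = a' \<otimes> b"
    and int: "\<And>x. x \<in> A \<Longrightarrow> x \<in> B \<Longrightarrow> x = \<one>"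
  shows "split_extension G (A <#> B) A B"
proof -
  let ?E = "A <#> B"
  note car = subgroup.mem_carrier[OF A] subgroup.mem_carrier[OF B]
  have mem: "a \<otimes> b \<in> ?E" if "a \<in> A" "b \<in> B" for a b using that by (auto simp: set_mult_def)
  have elim: "\<exists>a\<in>A. \<exists>b\<in>B. x = a \<otimes> b" if "x \<in> ?E" for x using that by (auto simp: set_mult_def)
  have E: "subgroup ?E G"
  proof (rule subgroupI)
    show "?E \<subseteq> carrier G" using elim car by blast
    show "?E \<noteq> {}" using mem subgroup.one_closed[OF A] subgroup.one_closed[OF B] by blast
  next
    fix x assume "x \<in> ?E"
    then obtain a b where ab: "a \<in> A" "b \<in> B" "x = a \<otimes> b" using elim by blast
    obtain a' where a': "a' \<in> A" "inv b \<otimes> inv a = a' \<otimes> inv b"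
      using conj subgroup.m_inv_closed[OF A ab(1)] subgroup.m_inv_closed[OF B ab(2)] by blast
    have "inv x = inv b \<otimes> inv a" unfolding ab(3) using ab car by (simp add: inv_mult_group)
    then show "inv x \<in> ?E" unfolding a'(2) using mem[OF a'(1) subgroup.m_inv_closed[OF B ab(2)]] by simp
  next
    fix x y assume "x \<in> ?E" "y \<in> ?E"
    then obtain a b c d where abcd: "a \<in> A" "b \<in> B" "x = a \<otimes> b" "c \<in> A" "d \<in> B" "y = c \<otimes> d"
      using elim by meson
    obtain c' where c': "c' \<in> A" "b \<otimes> c = c' \<otimes> b" using conj abcd by blast
    have "x \<otimes> y = a \<otimes> (b \<otimes> c) \<otimes> d" unfolding abcd(3,6) using abcd car by (simp add: m_assoc)
    also have "\<dots> = (a \<otimes> c') \<otimes> (b \<otimes> d)" unfolding c'(2) using abcd c' car by (simp add: m_assoc)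
    finally show "x \<otimes> y \<in> ?E"
      using mem subgroup.m_closed[OF A abcd(1) c'(1)] subgroup.m_closed[OF B abcd(2,5)] by simp
  qed
  have AE: "A \<subseteq> ?E"
  proof
    fix a assume "a \<in> A"
    then show "a \<in> ?E" using mem[OF _ subgroup.one_closed[OF B], of a] car by simp
  qed
  have BE: "B \<subseteq> ?E"
  proof
    fix b assume "b \<in> B"
    then show "b \<in> ?E" using mem[OF subgroup.one_closed[OF A], of b] car by simp
  qed
  have "A \<lhd> G\<lparr>carrier := ?E\<rparr>"
  proof (rule normal_in_subgroupI[OF A E AE])
    fix x h assume "x \<in> ?E" and h: "h \<in> A"
    then obtain a b where ab: "a \<in> A" "b \<in> B" "x = a \<otimes> b" using elim by blast
    obtain h' where h': "h' \<in> A" "b \<otimes> h = h' \<otimes> b" using conj h ab(2) by blast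
    have "x \<otimes> h = a \<otimes> (b \<otimes> h)" unfolding ab(3) using ab h car by (simp add: m_assoc)
    also have "\<dots> = (a \<otimes> h' \<otimes> inv a) \<otimes> x"
      unfolding h'(2) ab(3) using ab h' car by (simp add: m_assoc inv_solve_left)
    finally show "\<exists>a'\<in>A. x \<otimes> h = a' \<otimes> x"
      using ab(1) h'(1) by (intro bexI[of _ "a \<otimes> h' \<otimes> inv a"] subgroup.m_closed[OF A] subgroup.m_inv_closed[OF A])
  qed
  moreover have "A \<inter> B = {\<one>}" using int subgroup.one_closed[OF A] subgroup.one_closed[OF B] by blast
  ultimately show ?thesis
    unfolding split_extension_def using E subgroup_incl[OF B E BE] by simp
qed

lemma (in group) internal_direct_productI:
  assumes A: "subgroup A G" and B: "subgroup B G"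
    and comm: "\<And>a b. a \<in> A \<Longrightarrow> b \<in> B \<Longrightarrow> b \<otimes> a = a \<otimes> b"
    and int: "\<And>x. x \<in> A \<Longrightarrow> x \<in> B \<Longrightarrow> x = \<one>"
  shows "internal_direct_product G (A <#> B) A B"
proof -
  have split: "split_extension G (A <#> B) A B"
    by (rule split_extensionI[OF A B]) (use comm int in blast)+
  then have E: "subgroup (A <#> B) G" and BE: "B \<subseteq> A <#> B"
    using subgroup.subset[of B "G\<lparr>carrier := A <#> B\<rparr>"] by (simp_all add: split_extension_def)
  have "B \<lhd> G\<lparr>carrier := A <#> B\<rparr>"
  proof (rule normal_in_subgroupI[OF B E BE])
    fix x h assume "x \<in> A <#> B" and h: "h \<in> B"
    then obtain a b where ab: "a \<in> A" "b \<in> B" "x = a \<otimes> b" by (auto simp: set_mult_def)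
    have car: "a \<in> carrier G" "b \<in> carrier G" "h \<in> carrier G"
      using ab h subgroup.mem_carrier[OF A] subgroup.mem_carrier[OF B] by blast+
    have h': "b \<otimes> h \<otimes> inv b \<in> B"
      using ab(2) h by (intro subgroup.m_closed[OF B] subgroup.m_inv_closed[OF B])
    have "x \<otimes> h = a \<otimes> (b \<otimes> h \<otimes> inv b) \<otimes> b"
      unfolding ab(3) using car by (simp add: m_assoc)
    also have "\<dots> = (b \<otimes> h \<otimes> inv b) \<otimes> x"
      unfolding comm[OF ab(1) h', symmetric] ab(3) using car by (simp add: m_assoc)
    finally show "\<exists>h'\<in>B. x \<otimes> h = h' \<otimes> x" using h' by blast
  qed
  with split show ?thesis by (simp add: split_extension_def internal_direct_product_def)
qed

text \<open>An additive family indexed by the integers consists of the powers of f 1. This replaces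
  \<open>generate\<close> by an explicit parametrization.\<close>

lemma (in group) generate_range_additive:
  fixes f :: "int \<Rightarrow> 'a"
  assumes f: "\<And>n. f n \<in> carrier G" and add: "\<And>m n. f (m + n) = f m \<otimes> f n"
  shows "generate G {f 1} = range f"
proof -
  have f0: "f 0 = \<one>" using add[of 0 0] f[of 0] by (simp add: l_cancel_one)
  have nat: "f (int n) = f 1 [^] n" for n
  proof (induction n)
    case (Suc n)
    have "f (int (Suc n)) = f (int n) \<otimes> f 1" using add[of "int n" 1] by (simp add: add.commute)
    with Suc show ?case by simp
  qed (simp add: f0)
  have neg: "f (- n) = inv (f n)" for n
  proof -
    have "f (- n) \<otimes> f n = \<one>" using add[of "- n" n, symmetric] f0 by simp
    then have "inv (f n) = f (- n)" by (rule inv_equality[OF _ f f])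
    then show ?thesis ..
  qed
  have "f n = f 1 [^] n" for n
  proof (cases n rule: int_cases2)
    case (nonneg m)
    then show ?thesis using nat[of m] by (simp only: int_pow_int)
  next
    case (nonpos m)
    then show ?thesis using neg[of "int m"] nat[of m] int_pow_neg_int[OF f[of 1], of m] by (simp only:)
  qed
  then have "range f = range (\<lambda>n. f 1 [^] (n :: int))" by (intro image_cong refl)
  then show ?thesis unfolding generate_pow[OF f] by blast
qed

definition psi_vec :: "nat \<Rightarrow> (nat \<Rightarrow>\<^sub>0 complex)" where
  "psi_vec k = scl (2 * of_real pi * \<i> / (of_real (sqrt 2) * of_nat k)) (Poly_Mapping.map of_real (rho k))"

text \<open>The integer powers of \<psi>, given directly as exponentials so that their eigenvalue on
  every e^x is available for negative n as well.\<close>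

definition psi_pow :: "nat \<Rightarrow> int \<Rightarrow> fock \<Rightarrow> fock" where
  "psi_pow k n = exp_zero_mode k (scl (of_int n) (psi_vec k))"

definition aff_lift :: "nat \<Rightarrow> int \<Rightarrow> int \<Rightarrow> fock \<Rightarrow> fock" where
  "aff_lift k s c = lift k (reindex (aff k s c))"

lemma psi_eq: "psi k = psi_pow k 1"
  by (simp add: psi_def psi_pow_def psi_vec_def poly_mapping_scl_simps poly_mapping_map_trivial)

lemma psi_pow_evec:
  assumes k: "k \<ge> 1" and x: "x \<in> N_lat k"
  shows "psi_pow k n (evec x) = csc (zeta k (n * height k x)) (evec x)"
proof -
  have "psi k = exp_zero_mode k (psi_vec k)" by (simp add: psi_def psi_vec_def)
  then have "csc (exp (ip (psi_vec k) (cvec x))) (evec x) = csc (zeta k (height k x)) (evec x)"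
    using psi_evec[OF assms] exp_zero_mode_evec[OF x, of "psi_vec k"] by (simp add: zeta_def)
  from csc_evec_eq[OF this] have e: "exp (ip (psi_vec k) (cvec x)) = zeta k (height k x)" by simp
  have "exp (of_int n * ip (psi_vec k) (cvec x)) = exp (ip (psi_vec k) (cvec x)) powi n"
    by (simp add: exp_power_int)
  also have "\<dots> = zeta k (n * height k x)"
    unfolding e zeta_def by (simp add: cis_power_int mult_ac)
  finally show ?thesis
    unfolding psi_pow_def exp_zero_mode_evec[OF x] ip_scl_left by simp
qed

lemma nu_hat_eq: "nu_hat k = aff_lift k 1 1"
proof -
  have "(\<lambda>i. idx k (int i + 1)) = aff k 1 1" by (rule ext) (simp add: aff_def)
  then show ?thesis by (simp add: nu_hat_def nu_def aff_lift_def)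
qed

lemma mult_lift_eq: "mult_lift k s = aff_lift k s 0"
proof -
  have "(\<lambda>i. idx k (s * int i)) = aff k s 0" by (rule ext) (simp add: aff_def)
  then show ?thesis by (simp add: mult_lift_def aff_lift_def)
qed

locale sqrt2_A_lattice =
  fixes k :: nat
  assumes k3: "k \<ge> 3"
begin

abbreviation G where "G \<equiv> voa_Aut (V_N k)"

lemma k1: "k \<ge> 1"
  using k3 by simp

sublocale G: group "voa_Aut (V_N k)"
  by (rule group_VN_Aut[OF k1])

section \<open>Relations between \<psi>, \<theta> and the affine lifts\<close>

lemma psi_pow_in: "psi_pow k n \<in> carrier G"
  unfolding psi_pow_def by (rule exp_zero_mode_in_Aut[OF k1])

lemma theta_in: "theta k \<in> carrier G"
  by (rule theta_in_Aut[OF k1])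

lemma aff_lift_in: "coprime s (int k) \<Longrightarrow> aff_lift k s c \<in> carrier G"
  unfolding aff_lift_def by (intro lift_reindex_in_Aut k1 aff_bij)

lemma aff_lift_1_in: "aff_lift k 1 c \<in> carrier G"
  by (rule aff_lift_in) simp

lemma aff_N: "x \<in> N_lat k \<Longrightarrow> reindex (aff k s c) x \<in> N_lat k"
  by (intro reindex_N_lat k1 aff_range)

lemma uminus_N: "x \<in> N_lat k \<Longrightarrow> - x \<in> N_lat k"
  by (rule N_lat_closed(3)[OF k1])

lemma mult_apply: "g \<in> carrier G \<Longrightarrow> h \<in> carrier G \<Longrightarrow> v \<in> VN k \<Longrightarrow> (g \<otimes>\<^bsub>G\<^esub> h) v = g (h v)"
  by (simp add: VN_Aut_mult compose_eq)

lemma mult_evec: "g \<in> carrier G \<Longrightarrow> h \<in> carrier G \<Longrightarrow> x \<in> N_lat k \<Longrightarrow> (g \<otimes>\<^bsub>G\<^esub> h) (evec x) = g (h (evec x))"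
  by (intro mult_apply evec_in_VN)

lemma one_evec: "x \<in> N_lat k \<Longrightarrow> \<one>\<^bsub>G\<^esub> (evec x) = evec x"
  by (simp add: VN_Aut_one evec_in_VN)

lemma theta_evec: "x \<in> N_lat k \<Longrightarrow> theta k (evec x) = evec (- x)"
  by (simp add: theta_def lift_evec)

lemma aff_lift_evec: "x \<in> N_lat k \<Longrightarrow> aff_lift k s c (evec x) = evec (reindex (aff k s c) x)"
  by (simp add: aff_lift_def lift_evec)

lemma csc_evec: "g \<in> carrier G \<Longrightarrow> x \<in> N_lat k \<Longrightarrow> g (csc c (evec x)) = csc c (g (evec x))"
  by (intro VN_Aut_hom(2) evec_in_VN)

lemmas psi_pow_ev = psi_pow_evec[OF k1]

lemmas eqI = VN_Aut_eqI[OF k1]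

lemma psi_pow_add: "psi_pow k (m + n) = psi_pow k m \<otimes>\<^bsub>G\<^esub> psi_pow k n"
  by (rule eqI) (simp_all add: psi_pow_in mult_evec psi_pow_ev csc_evec distrib_right zeta_add mult.commute)

lemma psi_pow_cong: "[m = n] (mod int k) \<Longrightarrow> psi_pow k m = psi_pow k n"
  by (rule eqI) (auto simp: psi_pow_in psi_pow_ev intro!: arg_cong[of _ _ "\<lambda>c. csc c _"] zeta_cong k1 cong_mult cong_refl simp del: One_nat_def)

lemma theta_theta: "theta k \<otimes>\<^bsub>G\<^esub> theta k = \<one>\<^bsub>G\<^esub>"
  by (rule eqI) (simp_all add: theta_in mult_evec theta_evec uminus_N one_evec)

lemma theta_psi_pow: "theta k \<otimes>\<^bsub>G\<^esub> psi_pow k n = psi_pow k (- n) \<otimes>\<^bsub>G\<^esub> theta k"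
  by (rule eqI) (simp_all add: theta_in psi_pow_in mult_evec theta_evec psi_pow_ev csc_evec uminus_N height_uminus)

lemma theta_aff_lift:
  "coprime s (int k) \<Longrightarrow> theta k \<otimes>\<^bsub>G\<^esub> aff_lift k s c = aff_lift k s c \<otimes>\<^bsub>G\<^esub> theta k"
  by (rule eqI) (simp_all add: theta_in aff_lift_in mult_evec theta_evec aff_lift_evec uminus_N aff_N reindex_uminus)

lemma aff_lift_cong:
  assumes "[s = t] (mod int k)" "[c = d] (mod int k)"
  shows "aff_lift k s c = aff_lift k t d"
proof -
  have "aff k s c = aff k t d"
    by (rule ext) (use assms in \<open>simp add: aff_def idx_eq_iff[OF k1] cong_add cong_mult\<close>)
  then show ?thesis by (simp add: aff_lift_def)
qed

lemma aff_lift_mult: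
  assumes "coprime s (int k)" "coprime t (int k)"
  shows "aff_lift k s c \<otimes>\<^bsub>G\<^esub> aff_lift k t d = aff_lift k (s * t) (s * d + c)"
proof (rule eqI)
  fix x assume x: "x \<in> N_lat k"
  have "aff k s c (aff k t d i) = aff k (s * t) (s * d + c) i" for i
    unfolding aff_def[of k t] aff_idx[OF k1] by (simp add: aff_def algebra_simps)
  with x show "(aff_lift k s c \<otimes>\<^bsub>G\<^esub> aff_lift k t d) (evec x) = aff_lift k (s * t) (s * d + c) (evec x)"
    using assms by (simp add: mult_evec aff_lift_in aff_lift_evec aff_N reindex_reindex)
qed (use assms in \<open>simp_all add: aff_lift_in\<close>)

lemma aff_lift_id: "aff_lift k 1 0 = \<one>\<^bsub>G\<^esub>"
proof (rule eqI)
  fix x assume x: "x \<in> N_lat k"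
  have "reindex (aff k 1 0) x = reindex (\<lambda>i. i) x"
    by (rule reindex_cong[OF k1 x]) (simp add: aff_def idx_int)
  with x show "aff_lift k 1 0 (evec x) = \<one>\<^bsub>G\<^esub> (evec x)"
    by (simp add: aff_lift_evec one_evec reindex_id)
qed (simp_all add: aff_lift_1_in)

text \<open>The affine map multiplies heights by s modulo k, so conjugation divides the exponent of
  \<psi> by s; t is the inverse of s.\<close>

lemma aff_lift_psi_pow:
  assumes s: "coprime s (int k)" and st: "[s * t = 1] (mod int k)"
  shows "aff_lift k s c \<otimes>\<^bsub>G\<^esub> psi_pow k n = psi_pow k (n * t) \<otimes>\<^bsub>G\<^esub> aff_lift k s c"
proof (rule eqI)
  fix x assume x: "x \<in> N_lat k"
  have "[n * t * height k (reindex (aff k s c) x) = n * t * (s * height k x)] (mod int k)"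
    by (intro cong_mult cong_refl height_reindex k1 x)
  also have "n * t * (s * height k x) = s * t * (n * height k x)" by (simp add: algebra_simps)
  also have "[s * t * (n * height k x) = 1 * (n * height k x)] (mod int k)"
    by (intro cong_mult st cong_refl)
  finally have "zeta k (n * t * height k (reindex (aff k s c) x)) = zeta k (1 * (n * height k x))"
    by (rule zeta_cong[OF k1])
  with x s show "(aff_lift k s c \<otimes>\<^bsub>G\<^esub> psi_pow k n) (evec x) = (psi_pow k (n * t) \<otimes>\<^bsub>G\<^esub> aff_lift k s c) (evec x)"
    by (simp add: mult_evec aff_lift_in psi_pow_in aff_lift_evec psi_pow_ev csc_evec aff_N)
qed (use s in \<open>simp_all add: aff_lift_in psi_pow_in\<close>)

text \<open>The image of \<alpha>_i - \<alpha>_j for some j \<noteq> i recovers the image of the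
  index i, and an affine map is determined modulo k by its values at 1 and 2.\<close>

lemma aff_lift_eq_iff:
  assumes "aff_lift k s c = aff_lift k t d" and s: "coprime s (int k)"
  shows "[s = t] (mod int k)" "[c = d] (mod int k)"
proof -
  have aff: "aff k s c i = aff k t d i" if i: "i \<in> {1..k}" for i
  proof -
    obtain j where j: "j \<in> {1..k}" "i \<noteq> j" using k3 by (metis atLeastAtMost_iff le_refl k1 numeral_le_one_iff order_trans semiring_norm(70))
    have N: "alpha i - alpha j \<in> N_lat k" by (rule alpha_diff_in_N_lat[OF i j(1)])
    have "csc 1 (evec (reindex (aff k s c) (alpha i - alpha j))) = csc 1 (evec (reindex (aff k t d) (alpha i - alpha j)))"
      using assms(1) aff_lift_evec[OF N] by metis
    from csc_evec_eq[OF this] have eq: "alpha (aff k s c i) - alpha (aff k s c j) = (alpha (aff k t d i) - alpha (aff k t d j) :: nat \<Rightarrow>\<^sub>0 int)"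
      by (simp add: reindex_alpha_diff)
    have "aff k s c i \<noteq> aff k s c j"
      using inj_on_eq_iff[OF bij_betw_imp_inj_on[OF aff_bij[OF k1 s]] i j(1)] j(2) by simp
    from alpha_diff_eq(1)[OF eq this] show ?thesis by simp
  qed
  have 1: "[s * 1 + c = t * 1 + d] (mod int k)" and 2: "[s * 2 + c = t * 2 + d] (mod int k)"
    using aff[of 1] aff[of 2] k3 by (simp_all add: aff_def idx_eq_iff[OF k1])
  from cong_diff[OF 2 1] show "[s = t] (mod int k)" by simp
  from cong_diff[OF 1 this] show "[c = d] (mod int k)" by simp
qed

text \<open>A permutation inducing -1 would have to swap 1 with 2 and also 2 with 3. Three distinct
  indices are what makes this contradictory.\<close>

lemma theta_not_aff_lift: "theta k \<noteq> aff_lift k s c"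
proof
  assume eq: "theta k = aff_lift k s c"
  have r: "1 \<in> {1..k}" "2 \<in> {1..k}" "3 \<in> {1..k}" using k3 by auto
  have "alpha j - alpha i = (alpha (aff k s c i) - alpha (aff k s c j) :: nat \<Rightarrow>\<^sub>0 int)" if "i \<in> {1..k}" "j \<in> {1..k}" for i j
  proof -
    have N: "alpha i - alpha j \<in> N_lat k" by (rule alpha_diff_in_N_lat[OF that])
    have "csc 1 (evec (- (alpha i - alpha j))) = csc 1 (evec (reindex (aff k s c) (alpha i - alpha j)))"
      using eq theta_evec[OF N] aff_lift_evec[OF N] by metis
    from csc_evec_eq[OF this] show ?thesis by (simp add: reindex_alpha_diff)
  qed
  from alpha_diff_eq[OF this[OF r(1,2)]] alpha_diff_eq[OF this[OF r(2,3)]] show False by simp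
qed

text \<open>Separates powers of \<psi>, which only rescale the e^x, from products of \<theta> and
  affine lifts, which move them without scalars.\<close>

lemma psi_pow_trivial:
  assumes "\<And>x. x \<in> N_lat k \<Longrightarrow> \<exists>y. psi_pow k n (evec x) = evec y"
  shows "psi_pow k n = \<one>\<^bsub>G\<^esub>"
proof (rule eqI)
  fix x assume x: "x \<in> N_lat k"
  obtain y where "psi_pow k n (evec x) = evec y" using assms[OF x] by blast
  then have "csc (zeta k (n * height k x)) (evec x) = csc 1 (evec y)" by (simp add: psi_pow_ev[OF x])
  from csc_evec_eq[OF this zeta_neq_0] have "zeta k (n * height k x) = 1" by (rule conjunct1)
  then show "psi_pow k n (evec x) = \<one>\<^bsub>G\<^esub> (evec x)"
    by (simp add: psi_pow_ev[OF x] one_evec[OF x])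
qed (simp_all add: psi_pow_in)

lemma psi_pow_inj: "psi_pow k m = psi_pow k n \<Longrightarrow> [m = n] (mod int k)"
proof -
  assume eq: "psi_pow k m = psi_pow k n"
  have 1: "1 \<in> {1..k-1}" using k3 by simp
  have b: "beta 1 \<in> N_lat k" unfolding N_lat_def by (rule beta_in_span[OF 1])
  have "csc (zeta k m) (evec (beta 1)) = csc (zeta k n) (evec (beta 1))"
    using eq psi_pow_ev[OF b, of m] psi_pow_ev[OF b, of n] height_beta[OF 1] by simp
  from csc_evec_eq[OF this zeta_neq_0] have z: "zeta k m = zeta k n" by simp
  have "zeta k (m - n) * zeta k n = zeta k m" unfolding zeta_add[symmetric] by simp
  then have "zeta k (m - n) = 1" using z zeta_neq_0[of k n] by simp
  then have "[m - n = 0] (mod int k)" by (rule zeta_eq_1[OF k1])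
  then show ?thesis by (simp add: cong_diff_iff_cong_0)
qed

text \<open>The lattice part of \<open>g\<close> is \<open>\<plusminus>\<close> an affine permutation \<open>i \<mapsto> t i + c\<close>, and what remains is a
  \<open>\<nu>\<close>-invariant character of \<open>N\<close>.\<close>

lemma normalizing_automorphism:
  assumes g: "g \<in> carrier G" and comm: "g \<otimes>\<^bsub>G\<^esub> aff_lift k 1 1 = aff_lift k 1 t \<otimes>\<^bsub>G\<^esub> g"
  shows "coprime t (int k)" "\<exists>n c. \<exists>e\<in>{\<one>\<^bsub>G\<^esub>, theta k}. g = psi_pow k n \<otimes>\<^bsub>G\<^esub> (e \<otimes>\<^bsub>G\<^esub> aff_lift k t c)"
proof -
  let ?f = "lattice_action g" and ?\<chi> = "lattice_scalar g"
  note act = lattice_action[OF k1 g] and hom = lattice_action_hom[OF k1 g]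
  have fc: "?f (reindex (aff k 1 1) x) = reindex (aff k 1 t) (?f x) \<and> ?\<chi> (reindex (aff k 1 1) x) = ?\<chi> x"
    if x: "x \<in> N_lat k" for x
  proof -
    have "(g \<otimes>\<^bsub>G\<^esub> aff_lift k 1 1) (evec x) = csc (?\<chi> (reindex (aff k 1 1) x)) (evec (?f (reindex (aff k 1 1) x)))"
      by (simp add: mult_evec g aff_lift_1_in x aff_lift_evec act(3)[OF aff_N[OF x]])
    moreover have "(aff_lift k 1 t \<otimes>\<^bsub>G\<^esub> g) (evec x) = csc (?\<chi> x) (evec (reindex (aff k 1 t) (?f x)))"
      by (simp add: mult_evec g aff_lift_1_in x act(3)[OF x] csc_evec act(1) aff_lift_evec)
    ultimately have "csc (?\<chi> (reindex (aff k 1 1) x)) (evec (?f (reindex (aff k 1 1) x))) =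
        csc (?\<chi> x) (evec (reindex (aff k 1 t) (?f x)))"
      unfolding comm by simp
    from csc_evec_eq[OF this act(2)[OF aff_N[OF x]]] show ?thesis by simp
  qed
  have L: "coprime t (int k) \<and> (\<exists>c. (\<forall>x\<in>N_lat k. ?f x = reindex (aff k t c) x) \<or>
      (\<forall>x\<in>N_lat k. ?f x = - reindex (aff k t c) x))"
    by (rule lattice_isometry_intertwining[OF k3]) (use act(1) hom(1,2) fc in auto)
  then show t: "coprime t (int k)" ..
  obtain m where m: "\<And>x. x \<in> N_lat k \<Longrightarrow> ?\<chi> x = zeta k (m * height k x)"
    using nu_invariant_character[OF k3, of ?\<chi>] hom(3) act(2) fc by blast
  obtain t' where t': "[t * t' = 1] (mod int k)" using cong_solve_coprime_int[OF t] by blast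
  \<comment> \<open>The power of \<psi> acts after the affine map, which has multiplied the height
    by t; the inverse t' compensates for that.\<close>
  have z: "zeta k (m * t' * height k (reindex (aff k t c) x)) = zeta k (m * height k x)" if "x \<in> N_lat k" for c x
  proof (rule zeta_cong[OF k1])
    have "[m * t' * height k (reindex (aff k t c) x) = m * t' * (t * height k x)] (mod int k)"
      by (intro cong_mult cong_refl height_reindex k1 that)
    also have "m * t' * (t * height k x) = t * t' * (m * height k x)" by (simp add: algebra_simps)
    also have "[t * t' * (m * height k x) = 1 * (m * height k x)] (mod int k)"
      by (intro cong_mult t' cong_refl)
    finally show "[m * t' * height k (reindex (aff k t c) x) = m * height k x] (mod int k)" by simp
  qed
  from L obtain c where c: "(\<forall>x\<in>N_lat k. ?f x = reindex (aff k t c) x) \<or> (\<forall>x\<in>N_lat k. ?f x = - reindex (aff k t c) x)"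
    by blast
  have A: "aff_lift k t c \<in> carrier G" by (rule aff_lift_in[OF t])
  show "\<exists>n c. \<exists>e\<in>{\<one>\<^bsub>G\<^esub>, theta k}. g = psi_pow k n \<otimes>\<^bsub>G\<^esub> (e \<otimes>\<^bsub>G\<^esub> aff_lift k t c)"
    using c
  proof
    assume f: "\<forall>x\<in>N_lat k. ?f x = reindex (aff k t c) x"
    have "g = psi_pow k (m * t') \<otimes>\<^bsub>G\<^esub> aff_lift k t c"
      by (rule eqI) (simp_all add: g A psi_pow_in mult_evec aff_lift_evec aff_N psi_pow_ev act(3) f m z)
    then show ?thesis using A by (metis G.l_one insertI1)
  next
    assume f: "\<forall>x\<in>N_lat k. ?f x = - reindex (aff k t c) x"
    \<comment> \<open>Here \<theta> acts before the power of \<psi> and negates the height, so the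
      exponent changes sign.\<close>
    have "g = psi_pow k (- (m * t')) \<otimes>\<^bsub>G\<^esub> (theta k \<otimes>\<^bsub>G\<^esub> aff_lift k t c)"
      by (rule eqI) (simp_all add: g A psi_pow_in theta_in mult_evec aff_lift_evec theta_evec aff_N uminus_N
          psi_pow_ev height_uminus act(3) f m z)
    then show ?thesis by blast
  qed
qed

definition P where "P = generate G {psi k}"
definition T where "T = generate G {theta k}"
definition R where "R = generate G {nu_hat k}"
definition U where "U = Zk_units k"

section \<open>The four subgroups and their mutual position\<close>

lemma P_eq: "P = range (psi_pow k)"
  unfolding P_def psi_eq by (rule G.generate_range_additive[OF psi_pow_in psi_pow_add])

lemma R_eq: "R = range (aff_lift k 1)"
  unfolding R_def nu_hat_eq
  by (rule G.generate_range_additive[OF aff_lift_1_in]) (simp add: aff_lift_mult add.commute)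

lemma T_eq: "T = {\<one>\<^bsub>G\<^esub>, theta k}"
proof -
  define f where "f n = (if even n then \<one>\<^bsub>G\<^esub> else theta k)" for n :: int
  have "generate G {f 1} = range f"
    by (rule G.generate_range_additive) (auto simp: f_def theta_in theta_theta)
  moreover have "range f \<subseteq> {f 0, f 1}" by (auto simp: f_def)
  then have "range f = {f 0, f 1}" by blast
  ultimately show ?thesis by (simp add: T_def f_def)
qed

sublocale Z: residues "int k" "residue_ring (int k)"
  by unfold_locales (use k3 in auto)

lemma Zk_units_carrier: "carrier (units_of (residue_ring (int k))) = {s. 0 < s \<and> s < int k \<and> coprime s (int k)}"
  by (simp add: units_of_carrier Z.res_units_eq)

text \<open>\<open>Zk_units\<close> runs over the representatives between 0 and k, but the lift
  depends on the multiplier only modulo k, so all integers coprime to k may be used.\<close>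

lemma U_eq: "U = {aff_lift k s 0 | s. coprime s (int k)}"
proof -
  have "aff_lift k s 0 \<in> U" if s: "coprime s (int k)" for s
  proof -
    have "coprime (s mod int k) (int k)" using s k3 by simp
    moreover from this have "s mod int k \<noteq> 0" using k3 by (intro notI) simp
    ultimately have "s mod int k \<in> carrier (units_of (residue_ring (int k)))"
      using k3 pos_mod_bound[of "int k" s] pos_mod_sign[of "int k" s] unfolding Zk_units_carrier
      by (simp add: less_le)
    moreover have "aff_lift k s 0 = mult_lift k (s mod int k)"
      unfolding mult_lift_eq by (rule aff_lift_cong) (simp_all add: cong_def)
    ultimately show ?thesis unfolding U_def Zk_units_def by blast
  qed
  moreover have "U \<subseteq> {aff_lift k s 0 | s. coprime s (int k)}"
    unfolding U_def Zk_units_def Zk_units_carrier mult_lift_eq by blast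
  ultimately show ?thesis by blast
qed

lemma mult_lift_iso: "mult_lift k \<in> iso (units_of (residue_ring (int k))) (G\<lparr>carrier := U\<rparr>)"
proof (rule isoI)
  show "mult_lift k \<in> hom (units_of (residue_ring (int k))) (G\<lparr>carrier := U\<rparr>)"
  proof (rule homI)
    fix s t assume st: "s \<in> carrier (units_of (residue_ring (int k)))" "t \<in> carrier (units_of (residue_ring (int k)))"
    then have "aff_lift k (s * t mod int k) 0 = aff_lift k (s * t) (s * 0 + 0)"
      by (intro aff_lift_cong) (simp_all add: cong_def)
    with st show "mult_lift k (s \<otimes>\<^bsub>units_of (residue_ring (int k))\<^esub> t) = mult_lift k s \<otimes>\<^bsub>G\<lparr>carrier := U\<rparr>\<^esub> mult_lift k t"
      by (simp add: mult_lift_eq units_of_mult Z.res_mult_eq Zk_units_carrier aff_lift_mult)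
  qed (simp add: U_def Zk_units_def)
  have "inj_on (mult_lift k) (carrier (units_of (residue_ring (int k))))"
  proof (rule inj_onI)
    fix s t assume st: "s \<in> carrier (units_of (residue_ring (int k)))" "t \<in> carrier (units_of (residue_ring (int k)))"
      and "mult_lift k s = mult_lift k t"
    then have "[s = t] (mod int k)" using aff_lift_eq_iff(1)[of s 0 t 0] by (simp add: mult_lift_eq Zk_units_carrier)
    then show "s = t" using st by (simp add: Zk_units_carrier cong_def)
  qed
  then show "bij_betw (mult_lift k) (carrier (units_of (residue_ring (int k)))) (carrier (G\<lparr>carrier := U\<rparr>))"
    by (simp add: bij_betw_def U_def Zk_units_def)
qed

lemma subgroup_P: "subgroup P G" and subgroup_T: "subgroup T G" and subgroup_R: "subgroup R G"
  unfolding P_def T_def R_def psi_eq nu_hat_eq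
  by (intro G.generate_is_subgroup, simp add: psi_pow_in theta_in aff_lift_1_in)+

lemma inverse_mod: "coprime s (int k) \<Longrightarrow> \<exists>t. [s * t = 1] (mod int k) \<and> coprime t (int k)"
proof -
  assume "coprime s (int k)"
  then obtain t where t: "[s * t = 1] (mod int k)" using cong_solve_coprime_int by blast
  then have "[t * s = 1] (mod int k)" by (simp add: mult.commute)
  then have "coprime t (int k)" unfolding coprime_iff_invertible_int by blast
  with t show ?thesis by blast
qed

lemma subgroup_U: "subgroup U G"
proof (rule G.subgroupI)
  show "U \<subseteq> carrier G" unfolding U_eq using aff_lift_in by blast
  have "aff_lift k 1 0 \<in> U" unfolding U_eq by fastforce
  then show "U \<noteq> {}" by blast
next
  fix x assume "x \<in> U"
  then obtain s where s: "x = aff_lift k s 0" "coprime s (int k)" unfolding U_eq by blast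
  obtain t where t: "[s * t = 1] (mod int k)" "coprime t (int k)" using inverse_mod[OF s(2)] by blast
  have "aff_lift k t 0 \<otimes>\<^bsub>G\<^esub> x = aff_lift k (t * s) 0" using s t by (simp add: aff_lift_mult)
  also have "\<dots> = \<one>\<^bsub>G\<^esub>" unfolding aff_lift_id[symmetric] using t by (intro aff_lift_cong) (simp_all add: mult.commute)
  finally have "inv\<^bsub>G\<^esub> x = aff_lift k t 0" using s t by (intro G.inv_equality) (simp_all add: aff_lift_in)
  with t show "inv\<^bsub>G\<^esub> x \<in> U" unfolding U_eq by blast
next
  fix x y assume "x \<in> U" "y \<in> U"
  then obtain s t where st: "x = aff_lift k s 0" "coprime s (int k)" "y = aff_lift k t 0" "coprime t (int k)"
    unfolding U_eq by blast
  then have "x \<otimes>\<^bsub>G\<^esub> y = aff_lift k (s * t) 0" "coprime (s * t) (int k)" by (simp_all add: aff_lift_mult)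
  then show "x \<otimes>\<^bsub>G\<^esub> y \<in> U" unfolding U_eq by blast
qed

lemma split_RU: "split_extension G (R <#>\<^bsub>G\<^esub> U) R U"
proof (rule G.split_extensionI[OF subgroup_R subgroup_U])
  fix a b assume "a \<in> R" "b \<in> U"
  then obtain c s where cs: "a = aff_lift k 1 c" "b = aff_lift k s 0" "coprime s (int k)" unfolding R_eq U_eq by blast
  then have "b \<otimes>\<^bsub>G\<^esub> a = aff_lift k 1 (s * c) \<otimes>\<^bsub>G\<^esub> b" by (simp add: aff_lift_mult)
  then show "\<exists>a'\<in>R. b \<otimes>\<^bsub>G\<^esub> a = a' \<otimes>\<^bsub>G\<^esub> b" unfolding R_eq by blast
next
  fix x assume "x \<in> R" "x \<in> U"
  then obtain c s where cs: "x = aff_lift k 1 c" "x = aff_lift k s 0" "coprime s (int k)" unfolding R_eq U_eq by blast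
  then have "[c = 0] (mod int k)" using aff_lift_eq_iff(2)[of 1 c s 0] by simp
  then show "x = \<one>\<^bsub>G\<^esub>" unfolding cs(1) aff_lift_id[symmetric] by (intro aff_lift_cong) simp_all
qed

lemma RU_eq: "R <#>\<^bsub>G\<^esub> U = {aff_lift k s c | s c. coprime s (int k)}"
proof -
  have "aff_lift k 1 c \<otimes>\<^bsub>G\<^esub> aff_lift k s 0 = aff_lift k s c" if "coprime s (int k)" for s c
    using that by (simp add: aff_lift_mult)
  note eq = this
  have "x \<in> R <#>\<^bsub>G\<^esub> U \<longleftrightarrow> (\<exists>s c. coprime s (int k) \<and> x = aff_lift k 1 c \<otimes>\<^bsub>G\<^esub> aff_lift k s 0)" for x
    unfolding set_mult_def R_eq U_eq by blast
  then have "x \<in> R <#>\<^bsub>G\<^esub> U \<longleftrightarrow> (\<exists>s c. coprime s (int k) \<and> x = aff_lift k s c)" for x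
    using eq by metis
  then show ?thesis by blast
qed

lemma R_subset_RU: "R \<subseteq> R <#>\<^bsub>G\<^esub> U"
  unfolding RU_eq unfolding R_eq by (auto intro: exI[of _ 1])

lemma subgroup_RU: "subgroup (R <#>\<^bsub>G\<^esub> U) G"
  using split_RU by (simp add: split_extension_def)

lemma theta_commutes: "a \<in> T \<Longrightarrow> b \<in> R <#>\<^bsub>G\<^esub> U \<Longrightarrow> b \<otimes>\<^bsub>G\<^esub> a = a \<otimes>\<^bsub>G\<^esub> b"
  unfolding T_eq RU_eq by (auto simp: theta_aff_lift aff_lift_in)

lemma T_inter: "x \<in> T \<Longrightarrow> x \<in> R <#>\<^bsub>G\<^esub> U \<Longrightarrow> x = \<one>\<^bsub>G\<^esub>"
  unfolding T_eq RU_eq by (auto simp: theta_not_aff_lift theta_not_aff_lift[symmetric])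

lemma direct_TRU: "internal_direct_product G (T <#>\<^bsub>G\<^esub> (R <#>\<^bsub>G\<^esub> U)) T (R <#>\<^bsub>G\<^esub> U)"
  by (rule G.internal_direct_productI[OF subgroup_T subgroup_RU theta_commutes T_inter])

lemma direct_TR: "internal_direct_product G (T <#>\<^bsub>G\<^esub> R) T R"
  by (rule G.internal_direct_productI[OF subgroup_T subgroup_R])
     (use theta_commutes T_inter R_subset_RU in blast)+

lemma subgroup_TRU: "subgroup (T <#>\<^bsub>G\<^esub> (R <#>\<^bsub>G\<^esub> U)) G" and subgroup_TR: "subgroup (T <#>\<^bsub>G\<^esub> R) G"
  using direct_TRU direct_TR by (simp_all add: internal_direct_product_def)

lemma TRU_elim:
  assumes "b \<in> T <#>\<^bsub>G\<^esub> (R <#>\<^bsub>G\<^esub> U)"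
  obtains e s c where "e \<in> {\<one>\<^bsub>G\<^esub>, theta k}" "coprime s (int k)" "b = e \<otimes>\<^bsub>G\<^esub> aff_lift k s c"
proof -
  obtain e y where e: "e \<in> T" "y \<in> R <#>\<^bsub>G\<^esub> U" "b = e \<otimes>\<^bsub>G\<^esub> y"
    using assms unfolding set_mult_iff[of b _ T] by blast
  moreover obtain s c where "coprime s (int k)" "y = aff_lift k s c" using e(2) unfolding RU_eq by blast
  ultimately show ?thesis using that unfolding T_eq by blast
qed

lemma TR_subset: "T <#>\<^bsub>G\<^esub> R \<subseteq> T <#>\<^bsub>G\<^esub> (R <#>\<^bsub>G\<^esub> U)"
proof
  fix x assume "x \<in> T <#>\<^bsub>G\<^esub> R"
  then obtain a b where "a \<in> T" "b \<in> R" "x = a \<otimes>\<^bsub>G\<^esub> b" unfolding set_mult_iff by blast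
  then show "x \<in> T <#>\<^bsub>G\<^esub> (R <#>\<^bsub>G\<^esub> U)" using R_subset_RU unfolding set_mult_iff[of x _ T] by blast
qed

lemma T_subset: "T \<subseteq> T <#>\<^bsub>G\<^esub> (R <#>\<^bsub>G\<^esub> U)"
proof
  fix x assume x: "x \<in> T"
  have "\<one>\<^bsub>G\<^esub> \<in> R <#>\<^bsub>G\<^esub> U" by (rule subgroup.one_closed[OF subgroup_RU])
  moreover have "x = x \<otimes>\<^bsub>G\<^esub> \<one>\<^bsub>G\<^esub>" using subgroup.mem_carrier[OF subgroup_T x] by simp
  ultimately show "x \<in> T <#>\<^bsub>G\<^esub> (R <#>\<^bsub>G\<^esub> U)" using x unfolding set_mult_iff[of x _ T] by blast
qed

text \<open>An affine lift multiplies the exponent of \<psi> by the inverse of its multiplier and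
  \<theta> negates it; both stay inside the powers of \<psi>.\<close>

lemma P_conj:
  assumes "a \<in> P" "b \<in> T <#>\<^bsub>G\<^esub> (R <#>\<^bsub>G\<^esub> U)"
  shows "\<exists>a'\<in>P. b \<otimes>\<^bsub>G\<^esub> a = a' \<otimes>\<^bsub>G\<^esub> b"
proof -
  obtain n where a: "a = psi_pow k n" using assms(1) unfolding P_eq by blast
  obtain e s c where b: "e \<in> {\<one>\<^bsub>G\<^esub>, theta k}" "coprime s (int k)" "b = e \<otimes>\<^bsub>G\<^esub> aff_lift k s c"
    using TRU_elim[OF assms(2)] .
  obtain t where t: "[s * t = 1] (mod int k)" using inverse_mod[OF b(2)] by blast
  note car = psi_pow_in aff_lift_in[OF b(2)] theta_in
  have e: "e \<in> carrier G" using b(1) theta_in by auto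
  have "\<exists>n'. e \<otimes>\<^bsub>G\<^esub> psi_pow k (n * t) = psi_pow k n' \<otimes>\<^bsub>G\<^esub> e"
    using b(1) theta_psi_pow[of "n * t"] psi_pow_in by auto
  then obtain n' where n': "e \<otimes>\<^bsub>G\<^esub> psi_pow k (n * t) = psi_pow k n' \<otimes>\<^bsub>G\<^esub> e" by blast
  have "b \<otimes>\<^bsub>G\<^esub> a = e \<otimes>\<^bsub>G\<^esub> (aff_lift k s c \<otimes>\<^bsub>G\<^esub> psi_pow k n)"
    unfolding a b(3) using e car by (simp add: G.m_assoc)
  also have "\<dots> = e \<otimes>\<^bsub>G\<^esub> psi_pow k (n * t) \<otimes>\<^bsub>G\<^esub> aff_lift k s c"
    unfolding aff_lift_psi_pow[OF b(2) t] using e car by (simp add: G.m_assoc)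
  also have "\<dots> = psi_pow k n' \<otimes>\<^bsub>G\<^esub> b"
    unfolding n' b(3) using e car by (simp add: G.m_assoc)
  finally show ?thesis unfolding P_eq by blast
qed

lemma P_inter:
  assumes "x \<in> P" "x \<in> T <#>\<^bsub>G\<^esub> (R <#>\<^bsub>G\<^esub> U)"
  shows "x = \<one>\<^bsub>G\<^esub>"
proof -
  obtain n where a: "x = psi_pow k n" using assms(1) unfolding P_eq by blast
  obtain e s c where b: "e \<in> {\<one>\<^bsub>G\<^esub>, theta k}" "coprime s (int k)" "x = e \<otimes>\<^bsub>G\<^esub> aff_lift k s c"
    using TRU_elim[OF assms(2)] .
  have e: "e \<in> carrier G" using b(1) theta_in by auto
  have "\<exists>y. x (evec v) = evec y" if v: "v \<in> N_lat k" for v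
  proof -
    have "x (evec v) = e (evec (reindex (aff k s c) v))"
      unfolding b(3) by (simp add: mult_evec e aff_lift_in b(2) v aff_lift_evec)
    then show ?thesis using b(1) one_evec[OF aff_N[OF v]] theta_evec[OF aff_N[OF v]] by auto
  qed
  then show ?thesis unfolding a by (rule psi_pow_trivial)
qed

section \<open>Centralizer, normalizer and dihedral subgroup\<close>

lemma split_PT: "split_extension G (P <#>\<^bsub>G\<^esub> T) P T"
  by (rule G.split_extensionI[OF subgroup_P subgroup_T]) (use P_conj P_inter T_subset in blast)+

text \<open>Commuting with the cycle is the case t = 1 of \<open>normalizing_automorphism\<close>.
  Conversely \<psi>, \<theta> and translations of the indices each commute with it.\<close>

lemma centralizer_eq: "centralizer G (nu_hat k) = P <#>\<^bsub>G\<^esub> (T <#>\<^bsub>G\<^esub> R)"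
proof (intro equalityI subsetI)
  fix g assume "g \<in> centralizer G (nu_hat k)"
  then have g: "g \<in> carrier G" "g \<otimes>\<^bsub>G\<^esub> aff_lift k 1 1 = aff_lift k 1 1 \<otimes>\<^bsub>G\<^esub> g"
    by (simp_all add: centralizer_def nu_hat_eq)
  then obtain n c e where "e \<in> {\<one>\<^bsub>G\<^esub>, theta k}" "g = psi_pow k n \<otimes>\<^bsub>G\<^esub> (e \<otimes>\<^bsub>G\<^esub> aff_lift k 1 c)"
    using normalizing_automorphism(2) by blast
  then show "g \<in> P <#>\<^bsub>G\<^esub> (T <#>\<^bsub>G\<^esub> R)"
    unfolding set_mult_iff bex_set_mult_iff P_eq T_eq R_eq by blast
next
  fix g assume "g \<in> P <#>\<^bsub>G\<^esub> (T <#>\<^bsub>G\<^esub> R)"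
  then obtain n c e where e: "e \<in> {\<one>\<^bsub>G\<^esub>, theta k}" and g: "g = psi_pow k n \<otimes>\<^bsub>G\<^esub> (e \<otimes>\<^bsub>G\<^esub> aff_lift k 1 c)"
    unfolding set_mult_iff bex_set_mult_iff P_eq T_eq R_eq by blast
  let ?\<nu> = "aff_lift k 1 1"
  have eG: "e \<in> carrier G" using e theta_in by auto
  note car = psi_pow_in aff_lift_1_in eG
  have 1: "aff_lift k 1 c \<otimes>\<^bsub>G\<^esub> ?\<nu> = ?\<nu> \<otimes>\<^bsub>G\<^esub> aff_lift k 1 c" by (simp add: aff_lift_mult add.commute)
  have 2: "e \<otimes>\<^bsub>G\<^esub> ?\<nu> = ?\<nu> \<otimes>\<^bsub>G\<^esub> e" using e theta_aff_lift[of 1 1] aff_lift_1_in by auto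
  have 3: "psi_pow k n \<otimes>\<^bsub>G\<^esub> ?\<nu> = ?\<nu> \<otimes>\<^bsub>G\<^esub> psi_pow k n" using aff_lift_psi_pow[of 1 1 1 n] by simp
  have "g \<otimes>\<^bsub>G\<^esub> ?\<nu> = psi_pow k n \<otimes>\<^bsub>G\<^esub> (e \<otimes>\<^bsub>G\<^esub> (aff_lift k 1 c \<otimes>\<^bsub>G\<^esub> ?\<nu>))"
    unfolding g using car by (simp add: G.m_assoc)
  also have "\<dots> = psi_pow k n \<otimes>\<^bsub>G\<^esub> ((e \<otimes>\<^bsub>G\<^esub> ?\<nu>) \<otimes>\<^bsub>G\<^esub> aff_lift k 1 c)"
    unfolding 1 using car by (simp add: G.m_assoc)
  also have "\<dots> = (psi_pow k n \<otimes>\<^bsub>G\<^esub> ?\<nu>) \<otimes>\<^bsub>G\<^esub> (e \<otimes>\<^bsub>G\<^esub> aff_lift k 1 c)"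
    unfolding 2 using car by (simp add: G.m_assoc)
  also have "\<dots> = ?\<nu> \<otimes>\<^bsub>G\<^esub> g"
    unfolding 3 g using car by (simp add: G.m_assoc)
  finally show "g \<in> centralizer G (nu_hat k)"
    unfolding centralizer_def nu_hat_eq using car by (simp add: g)
qed

lemma split_centralizer: "split_extension G (centralizer G (nu_hat k)) P (T <#>\<^bsub>G\<^esub> R)"
  unfolding centralizer_eq
  by (rule G.split_extensionI[OF subgroup_P subgroup_TR]) (use P_conj P_inter TR_subset in blast)+

lemma split_PTRU: "split_extension G (P <#>\<^bsub>G\<^esub> (T <#>\<^bsub>G\<^esub> (R <#>\<^bsub>G\<^esub> U))) P (T <#>\<^bsub>G\<^esub> (R <#>\<^bsub>G\<^esub> U))"
  by (rule G.split_extensionI[OF subgroup_P subgroup_TRU P_conj P_inter])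

text \<open>Powers of \<psi> and \<theta> centralize the cycle, while an affine lift with multiplier
  s raises its powers to the s-th power.\<close>

lemma R_conj:
  assumes "x \<in> P <#>\<^bsub>G\<^esub> (T <#>\<^bsub>G\<^esub> (R <#>\<^bsub>G\<^esub> U))" "r \<in> R"
  shows "\<exists>r'\<in>R. x \<otimes>\<^bsub>G\<^esub> r = r' \<otimes>\<^bsub>G\<^esub> x"
proof -
  obtain d where r: "r = aff_lift k 1 d" using assms(2) unfolding R_eq by blast
  obtain n y where y: "y \<in> T <#>\<^bsub>G\<^esub> (R <#>\<^bsub>G\<^esub> U)" "x = psi_pow k n \<otimes>\<^bsub>G\<^esub> y"
    using assms(1) unfolding set_mult_iff[of x _ P] unfolding P_eq by blast
  obtain e s c where b: "e \<in> {\<one>\<^bsub>G\<^esub>, theta k}" "coprime s (int k)" "y = e \<otimes>\<^bsub>G\<^esub> aff_lift k s c"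
    using TRU_elim[OF y(1)] .
  let ?r = "aff_lift k 1 (s * d)"
  have eG: "e \<in> carrier G" using b(1) theta_in by auto
  note car = psi_pow_in aff_lift_1_in eG aff_lift_in[OF b(2)]
  have 1: "aff_lift k s c \<otimes>\<^bsub>G\<^esub> r = ?r \<otimes>\<^bsub>G\<^esub> aff_lift k s c" using b(2) by (simp add: r aff_lift_mult add.commute)
  have 2: "e \<otimes>\<^bsub>G\<^esub> ?r = ?r \<otimes>\<^bsub>G\<^esub> e" using b(1) theta_aff_lift[of 1 "s * d"] aff_lift_1_in by auto
  have 3: "psi_pow k n \<otimes>\<^bsub>G\<^esub> ?r = ?r \<otimes>\<^bsub>G\<^esub> psi_pow k n" using aff_lift_psi_pow[of 1 1 "s * d" n] by simp
  have "x \<otimes>\<^bsub>G\<^esub> r = psi_pow k n \<otimes>\<^bsub>G\<^esub> (e \<otimes>\<^bsub>G\<^esub> (aff_lift k s c \<otimes>\<^bsub>G\<^esub> r))"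
    unfolding y(2) b(3) r using car by (simp add: G.m_assoc)
  also have "\<dots> = psi_pow k n \<otimes>\<^bsub>G\<^esub> ((e \<otimes>\<^bsub>G\<^esub> ?r) \<otimes>\<^bsub>G\<^esub> aff_lift k s c)"
    unfolding 1 using car by (simp add: G.m_assoc)
  also have "\<dots> = (psi_pow k n \<otimes>\<^bsub>G\<^esub> ?r) \<otimes>\<^bsub>G\<^esub> (e \<otimes>\<^bsub>G\<^esub> aff_lift k s c)"
    unfolding 2 using car by (simp add: G.m_assoc)
  also have "\<dots> = ?r \<otimes>\<^bsub>G\<^esub> x"
    unfolding 3 y(2) b(3) using car by (simp add: G.m_assoc)
  finally show ?thesis unfolding R_eq by blast
qed

lemma normalizer_eq: "normalizer G R = P <#>\<^bsub>G\<^esub> (T <#>\<^bsub>G\<^esub> (R <#>\<^bsub>G\<^esub> U))"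
proof
  let ?E = "P <#>\<^bsub>G\<^esub> (T <#>\<^bsub>G\<^esub> (R <#>\<^bsub>G\<^esub> U))"
  have E: "subgroup ?E G" using split_PTRU by (simp add: split_extension_def)
  have one: "\<one>\<^bsub>G\<^esub> \<in> P" "\<one>\<^bsub>G\<^esub> \<in> T" using subgroup.one_closed subgroup_P subgroup_T by blast+
  have RE: "R \<subseteq> ?E"
  proof
    fix r assume r: "r \<in> R"
    then have "r = \<one>\<^bsub>G\<^esub> \<otimes>\<^bsub>G\<^esub> (\<one>\<^bsub>G\<^esub> \<otimes>\<^bsub>G\<^esub> r)" using subgroup.mem_carrier[OF subgroup_R] by simp
    then show "r \<in> ?E"
      using one r R_subset_RU unfolding set_mult_iff[of _ _ P] bex_set_mult_iff[where A = T] by blast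
  qed
  have "subgroup ?E (G\<lparr>carrier := normalizer G R\<rparr>)"
    by (rule G.normal_imp_subgroup_normalizer[OF E G.normal_in_subgroupI[OF subgroup_R E RE R_conj]])
  then show "?E \<subseteq> normalizer G R" using subgroup.subset by fastforce
  show "normalizer G R \<subseteq> ?E"
  proof
    fix g assume "g \<in> normalizer G R"
    moreover have "R \<subseteq> carrier G" using subgroup.subset[OF subgroup_R] .
    ultimately have g: "g \<in> carrier G" and gR: "g <#\<^bsub>G\<^esub> R #>\<^bsub>G\<^esub> inv\<^bsub>G\<^esub> g = R"
      by (simp_all add: normalizer_def stabilizer_def)
    \<comment> \<open>The conjugate of the generator alone supplies the exponent t; its coprimality
      to k then comes from the classification.\<close>
    have "aff_lift k 1 1 \<in> R" unfolding R_eq by blast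
    then have "g \<otimes>\<^bsub>G\<^esub> aff_lift k 1 1 \<otimes>\<^bsub>G\<^esub> inv\<^bsub>G\<^esub> g \<in> R"
      using gR unfolding l_coset_def r_coset_def by blast
    then obtain t where t: "g \<otimes>\<^bsub>G\<^esub> aff_lift k 1 1 \<otimes>\<^bsub>G\<^esub> inv\<^bsub>G\<^esub> g = aff_lift k 1 t" unfolding R_eq by blast
    have comm: "g \<otimes>\<^bsub>G\<^esub> aff_lift k 1 1 = aff_lift k 1 t \<otimes>\<^bsub>G\<^esub> g"
      unfolding t[symmetric] using g aff_lift_1_in by (simp add: G.m_assoc)
    obtain n c e where e: "e \<in> {\<one>\<^bsub>G\<^esub>, theta k}" "g = psi_pow k n \<otimes>\<^bsub>G\<^esub> (e \<otimes>\<^bsub>G\<^esub> aff_lift k t c)"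
      using normalizing_automorphism(2)[OF g comm] by blast
    have "aff_lift k t c \<in> R <#>\<^bsub>G\<^esub> U"
      unfolding RU_eq using normalizing_automorphism(1)[OF g comm] by blast
    with e show "g \<in> ?E"
      unfolding set_mult_iff[of _ _ P] bex_set_mult_iff[where A = T] unfolding P_eq T_eq by blast
  qed
qed

text \<open>The pair (i, b) corresponds to \<psi>^i, followed on the right by \<theta> if b holds.
  The product rule holds because \<theta> inverts \<psi> and \<open>psi_pow\<close> is periodic
  modulo k.\<close>

lemma dihedral_iso: "G\<lparr>carrier := P <#>\<^bsub>G\<^esub> T\<rparr> \<cong> Dih k"
proof -
  define h where "h = (\<lambda>(i, b). psi_pow k i \<otimes>\<^bsub>G\<^esub> (if b then theta k else \<one>\<^bsub>G\<^esub>))"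
  have hG: "h x \<in> carrier G" for x
    by (cases x) (simp add: h_def psi_pow_in theta_in)
  have k0: "0 < int k" using k3 by simp
  have mult: "h (x \<otimes>\<^bsub>Dih k\<^esub> y) = h x \<otimes>\<^bsub>G\<^esub> h y" for x y
  proof -
    obtain i b j c where xy: "x = (i, b)" "y = (j, c)" by (cases x, cases y) blast
    let ?e = "\<lambda>b. if b then theta k else \<one>\<^bsub>G\<^esub>"
    have eG: "?e b \<in> carrier G" for b by (simp add: theta_in)
    have "h x \<otimes>\<^bsub>G\<^esub> h y = psi_pow k i \<otimes>\<^bsub>G\<^esub> (?e b \<otimes>\<^bsub>G\<^esub> psi_pow k j) \<otimes>\<^bsub>G\<^esub> ?e c"
      unfolding xy h_def prod.case using eG psi_pow_in by (simp add: G.m_assoc)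
    also have "?e b \<otimes>\<^bsub>G\<^esub> psi_pow k j = psi_pow k (if b then - j else j) \<otimes>\<^bsub>G\<^esub> ?e b"
      by (simp add: theta_psi_pow psi_pow_in)
    also have "psi_pow k i \<otimes>\<^bsub>G\<^esub> (psi_pow k (if b then - j else j) \<otimes>\<^bsub>G\<^esub> ?e b) \<otimes>\<^bsub>G\<^esub> ?e c =
        (psi_pow k i \<otimes>\<^bsub>G\<^esub> psi_pow k (if b then - j else j)) \<otimes>\<^bsub>G\<^esub> (?e b \<otimes>\<^bsub>G\<^esub> ?e c)"
      using eG psi_pow_in by (simp only: G.m_assoc G.m_closed)
    also have "psi_pow k i \<otimes>\<^bsub>G\<^esub> psi_pow k (if b then - j else j) = psi_pow k ((if b then i - j else i + j) mod int k)"
      unfolding psi_pow_add[symmetric] by (rule psi_pow_cong) (simp add: cong_def)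
    also have "?e b \<otimes>\<^bsub>G\<^esub> ?e c = ?e (b \<noteq> c)" by (simp add: theta_theta theta_in)
    finally show ?thesis by (simp add: xy h_def Dih_def)
  qed
  have inj: "inj_on h (carrier (Dih k))"
  proof (rule inj_onI)
    fix x y assume xy: "x \<in> carrier (Dih k)" "y \<in> carrier (Dih k)" "h x = h y"
    obtain i b j c where x: "x = (i, b)" and y: "y = (j, c)" by (cases x, cases y) blast
    let ?e = "\<lambda>b. if b then theta k else \<one>\<^bsub>G\<^esub>"
    have 1: "1 \<in> {1..k-1}" using k3 by simp
    \<comment> \<open>One test vector suffices: its first coordinate is nonzero, so v and -v differ
      and the image of e^v reveals b. Cancelling the factor for b then leaves equal powers of
      \<psi>.\<close>
    define v where "v = (beta 1 :: nat \<Rightarrow>\<^sub>0 int)"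
    have b1: "v \<in> N_lat k" unfolding v_def N_lat_def by (rule beta_in_span[OF 1])
    have hv: "height k v = 1" unfolding v_def by (rule height_beta[OF 1])
    have ev: "h (i, b) (evec (v)) = csc (zeta k (if b then - i else i)) (evec (if b then - v else v))" for i b
      using hv
      by (simp add: h_def mult_evec b1 psi_pow_in theta_in theta_evec one_evec psi_pow_ev uminus_N height_uminus)
    have "csc (zeta k (if b then - i else i)) (evec (if b then - v else v)) =
        csc (zeta k (if c then - j else j)) (evec (if c then - v else v))"
      using arg_cong[OF xy(3), of "\<lambda>g. g (evec v)"] unfolding x y ev .
    from csc_evec_eq[OF this zeta_neq_0]
    have eq: "(if b then - v else v :: nat \<Rightarrow>\<^sub>0 int) = (if c then - v else v)" by simp
    have "Poly_Mapping.lookup v 1 = 1" by (simp add: v_def lookup_beta)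
    with arg_cong[OF eq, of "\<lambda>w. Poly_Mapping.lookup w 1"] have bc: "b = c" by (simp split: if_splits)
    have "psi_pow k i = psi_pow k j"
      using xy(3) G.r_cancel[of "?e b" "psi_pow k i" "psi_pow k j"] unfolding x y bc h_def
      by (simp add: psi_pow_in theta_in split: if_splits)
    then have "[i = j] (mod int k)" by (rule psi_pow_inj)
    then have "i = j" using xy(1,2) unfolding x y by (simp add: Dih_def cong_def)
    with bc show "x = y" by (simp add: x y)
  qed
  have surj: "h ` carrier (Dih k) = P <#>\<^bsub>G\<^esub> T"
  proof (intro equalityI subsetI)
    fix x assume "x \<in> h ` carrier (Dih k)"
    then show "x \<in> P <#>\<^bsub>G\<^esub> T"
      by (auto simp: h_def set_mult_def P_eq T_eq)
  next
    fix x assume "x \<in> P <#>\<^bsub>G\<^esub> T"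
    then obtain n e where e: "e \<in> {\<one>\<^bsub>G\<^esub>, theta k}" "x = psi_pow k n \<otimes>\<^bsub>G\<^esub> e"
      unfolding set_mult_def P_eq T_eq by blast
    have "psi_pow k n = psi_pow k (n mod int k)" by (rule psi_pow_cong) (simp add: cong_def)
    then have "x = h (n mod int k, False) \<or> x = h (n mod int k, True)" using e by (auto simp: h_def)
    moreover have "(n mod int k, b) \<in> carrier (Dih k)" for b using k0 by (simp add: Dih_def)
    ultimately show "x \<in> h ` carrier (Dih k)" by blast
  qed
  have bij: "bij_betw h (carrier (Dih k)) (P <#>\<^bsub>G\<^esub> T)" using inj surj by (simp add: bij_betw_def)
  have closed: "x \<otimes>\<^bsub>Dih k\<^esub> y \<in> carrier (Dih k)" for x y
    using k0 by (cases x; cases y) (simp add: Dih_def)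
  let ?i = "inv_into (carrier (Dih k)) h"
  have "?i \<in> iso (G\<lparr>carrier := P <#>\<^bsub>G\<^esub> T\<rparr>) (Dih k)"
  proof (rule isoI)
    show "?i \<in> hom (G\<lparr>carrier := P <#>\<^bsub>G\<^esub> T\<rparr>) (Dih k)"
    proof (rule homI)
      fix x y assume "x \<in> carrier (G\<lparr>carrier := P <#>\<^bsub>G\<^esub> T\<rparr>)" "y \<in> carrier (G\<lparr>carrier := P <#>\<^bsub>G\<^esub> T\<rparr>)"
      then have "x \<in> h ` carrier (Dih k)" "y \<in> h ` carrier (Dih k)" unfolding surj by simp_all
      then obtain u v where uv: "u \<in> carrier (Dih k)" "x = h u" "v \<in> carrier (Dih k)" "y = h v"
        by blast
      have "?i (h (u \<otimes>\<^bsub>Dih k\<^esub> v)) = u \<otimes>\<^bsub>Dih k\<^esub> v" by (rule inv_into_f_f[OF inj closed])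
      with uv show "?i (x \<otimes>\<^bsub>G\<lparr>carrier := P <#>\<^bsub>G\<^esub> T\<rparr>\<^esub> y) = ?i x \<otimes>\<^bsub>Dih k\<^esub> ?i y"
        by (simp add: mult inv_into_f_f[OF inj])
    next
      fix x assume "x \<in> carrier (G\<lparr>carrier := P <#>\<^bsub>G\<^esub> T\<rparr>)"
      then have "x \<in> h ` carrier (Dih k)" unfolding surj by simp
      then show "?i x \<in> carrier (Dih k)" by (rule inv_into_into)
    qed
    show "bij_betw ?i (carrier (G\<lparr>carrier := P <#>\<^bsub>G\<^esub> T\<rparr>)) (carrier (Dih k))"
      using bij_betw_inv_into[OF bij] by simp
  qed
  then show ?thesis by (auto simp: is_iso_def)
qed

end

theorem theorem5p1:
  fixes k :: nat
  assumes "k \<ge> 3"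
  shows
    "let G = voa_Aut (V_N k);
         P = generate G {psi k};
         T = generate G {theta k};
         R = generate G {nu_hat k};
         U = Zk_units k
     in
       (internal_direct_product G (T <#>\<^bsub>G\<^esub> R) T R \<and>
        split_extension G (centralizer G (nu_hat k)) P (T <#>\<^bsub>G\<^esub> R) \<and>
        split_extension G (P <#>\<^bsub>G\<^esub> T) P T \<and>
        G\<lparr>carrier := P <#>\<^bsub>G\<^esub> T\<rparr> \<cong> Dih k)
     \<and>
       (mult_lift k \<in> iso (units_of (residue_ring (int k))) (G\<lparr>carrier := U\<rparr>) \<and>
        split_extension G (R <#>\<^bsub>G\<^esub> U) R U \<and>
        internal_direct_product G (T <#>\<^bsub>G\<^esub> (R <#>\<^bsub>G\<^esub> U)) T (R <#>\<^bsub>G\<^esub> U) \<and>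
        split_extension G (normalizer G R) P (T <#>\<^bsub>G\<^esub> (R <#>\<^bsub>G\<^esub> U)))"
proof -
  interpret sqrt2_A_lattice k by unfold_locales (rule assms)
  show ?thesis
    unfolding Let_def P_def[symmetric] T_def[symmetric] R_def[symmetric] U_def[symmetric] normalizer_eq
    using direct_TR split_centralizer split_PT dihedral_iso mult_lift_iso split_RU direct_TRU split_PTRU
    by blast
qed

end
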